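(* Let $X_{1,\ell_1}$ and $X_{2,\ell_2}$ ($\ell_1,\ell_2\in\mathbb N$) be two sequences of operators with $X_{1,\ell_1}\to X_1$ and $X_{2,\ell_2}\to X_2$ in operator norm. Assume that the spectra of all the operators $X_{1,\ell_1}$, $X_{2,\ell_2}$, $X_1$, $X_2$ lie within a bounded, polynomially convex compact set. Let $\beta(\lambda_1,\lambda_2)$ be a holomorphic function such that $$\left|\frac{\partial^{\vartheta_1+\vartheta_2}}{\partial\lambda_1^{\vartheta_1}\partial\lambda_2^{\vartheta_2}}\beta(\lambda_1,\lambda_2)\right|<\infty\qquad\text{for all }(\vartheta_1,\vartheta_2)\in\mathbb N_0^2 .$$ Then, for every operator $Y$, $T_\beta^{X_{1,\ell_1},X_{2,\ell_2}}(Y)\to T_\beta^{X_1,X_2}(Y)$ in operator norm, i.e. $$\lim_{\ell_1,\ell_2\to\infty}\left\Vert T_\beta^{X_{1,\ell_1},X_{2,\ell_2}}(Y)-T_\beta^{X_1,X_2}(Y)\right\Vert=0 .$$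
   Context: $\mathbb N_0$ is the set of non-negative integers and $\|\cdot\|$ is the operator norm. All operators act on a complex Hilbert space, with identity $I$; they need not be self-adjoint. Each parameter operator $X$ is assumed to admit a spectral decomposition $X=\int_{\sigma(X)}\lambda\,dE_X(\lambda)+\int_{\sigma(X)}(X-\lambda I)\,dE_X(\lambda)$, where $\sigma(X)$ is the spectrum and $E_X$ is a spectral measure on $\sigma(X)$ (projection-valued, projections not necessarily orthogonal) with $\int_{\sigma(X)}dE_X(\lambda)=I$ and, formally, with $\delta(\lambda,\lambda')$ the delta symbol, $dE_X(\lambda)\,dE_X(\lambda')=\delta(\lambda,\lambda')\,dE_X(\lambda)$, $dE_X(\lambda')(X-\lambda I)dE_X(\lambda)=(X-\lambda I)dE_X(\lambda)dE_X(\lambda')=\delta(\lambda,\lambda')(X-\lambda I)dE_X(\lambda)$, and $(X-\lambda I)dE_X(\lambda)\,(X-\lambda' I)dE_X(\lambda')=\delta(\lambda,\lambda')(X-\lambda I)^2dE_X(\lambda)$. For each $\lambda\in\sigma(X)$, $(X-\lambda I)dE_X(\lambda)$ is nilpotent, of order $m_\lambda\ge 1$: $[(X-\lambda I)dE_X(\lambda)]^\ell=0$ for $\ell\ge m_\lambda$. An integral $\int g(\lambda)(X-\lambda I)^q dE_X(\lambda)$ is read by expanding $(X-\lambda I)^q$ in powers of $X$ and $\lambda$. All integrals are assumed to be well defined. Generalized double operator integral (GDOI): for operators $X_1,X_2,Y$ and a bivariate analytic function $\beta$ (defined on a domain containing the pairs of spectral points), $$T_\beta^{X_1,X_2}(Y)=\int_{\sigma(X_1)}\int_{\sigma(X_2)}\sum_{q_1=0}^{m_{\lambda_1}-1}\sum_{q_2=0}^{m_{\lambda_2}-1}\frac{\beta^{(q_1,q_2)}(\lambda_1,\lambda_2)}{q_1!\,q_2!}(X_1-\lambda_1I)^{q_1}dE_{X_1}(\lambda_1)\,Y\,(X_2-\lambda_2I)^{q_2}dE_{X_2}(\lambda_2),$$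 where $\beta^{(q_1,q_2)}$ is the partial derivative of order $q_1$ in the first and $q_2$ in the second variable, $\beta^{(0,0)}=\beta$, and $(X-\lambda I)^0=I$. *)

theory Defs
  imports
    "HOL-Analysis.Analysis"
    "HOL-Library.Disjoint_Sets"
    "HOL-Computational_Algebra.Polynomial"
begin

section \<open>Complex Hilbert spaces and bounded operators\<close>

text \<open>
  The real inner product, norm and scalar multiplication inherited from the superclasses are tied
  to the complex structure by the last two axioms; \<open>cinner\<close> is antilinear in its first argument.
\<close>

class complex_hilbert = real_inner + banach +
  fixes scaleC :: "complex \<Rightarrow> 'a \<Rightarrow> 'a" (infixr "*\<^sub>C" 75)
    and cinner :: "'a \<Rightarrow> 'a \<Rightarrow> complex"
  assumes scaleC_add_right: "c *\<^sub>C (x + y) = c *\<^sub>C x + c *\<^sub>C y"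
    and scaleC_add_left: "(c + d) *\<^sub>C x = c *\<^sub>C x + d *\<^sub>C x"
    and scaleC_scaleC: "c *\<^sub>C d *\<^sub>C x = (c * d) *\<^sub>C x"
    and scaleC_one: "1 *\<^sub>C x = x"
    and cinner_commute: "cinner x y = cnj (cinner y x)"
    and cinner_add_right: "cinner x (y + z) = cinner x y + cinner x z"
    and cinner_scaleC_right: "cinner x (c *\<^sub>C y) = c * cinner x y"
    and scaleC_of_real: "complex_of_real r *\<^sub>C x = scaleR r x"
    and inner_eq_Re_cinner: "inner x y = Re (cinner x y)"

instantiation complex :: complex_hilbert
begin

definition scaleC_complex :: "complex \<Rightarrow> complex \<Rightarrow> complex"
  where "scaleC_complex c x = c * x"

definition cinner_complex :: "complex \<Rightarrow> complex \<Rightarrow> complex"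
  where "cinner_complex x y = cnj x * y"

instance
  by standard
    (auto simp: scaleC_complex_def cinner_complex_def algebra_simps scaleR_conv_of_real
      inner_complex_def)

end

lemma norm_scaleC: "norm (c *\<^sub>C x) = cmod c * norm (x::'a::complex_hilbert)"
proof -
  have self: "cinner y y = complex_of_real ((norm y)\<^sup>2)" for y :: 'a
  proof -
    have "Im (cinner y y) = 0"
      using arg_cong[OF cinner_commute[of y y], of Im] by simp
    moreover have "Re (cinner y y) = (norm y)\<^sup>2"
      by (metis inner_eq_Re_cinner power2_norm_eq_inner)
    ultimately show ?thesis
      by (simp add: complex_eq_iff)
  qed
  have left: "cinner (c *\<^sub>C x) y = cnj c * cinner x y" for y
    by (metis cinner_commute cinner_scaleC_right complex_cnj_mult)
  have "cinner (c *\<^sub>C x) (c *\<^sub>C x) = cnj c * (c * cinner x x)"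
    by (simp add: left cinner_scaleC_right)
  also have "\<dots> = complex_of_real ((cmod c)\<^sup>2) * cinner x x"
    by (metis complex_norm_square mult.assoc mult.commute of_real_power)
  also have "\<dots> = complex_of_real ((cmod c * norm x)\<^sup>2)"
    by (simp add: self power_mult_distrib)
  finally have "complex_of_real ((norm (c *\<^sub>C x))\<^sup>2) = complex_of_real ((cmod c * norm x)\<^sup>2)"
    unfolding self .
  then have "(norm (c *\<^sub>C x))\<^sup>2 = (cmod c * norm x)\<^sup>2"
    using of_real_eq_iff by blast
  then show ?thesis
    by (simp add: power2_eq_iff_nonneg)
qed

lemma bounded_linear_scaleC: "bounded_linear (scaleC c :: 'a::complex_hilbert \<Rightarrow> 'a)"
proof (rule bounded_linear_intro[where K = "cmod c"])
  show "c *\<^sub>C (r *\<^sub>R x) = r *\<^sub>R (c *\<^sub>C x)" for r and x :: 'a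
    by (metis mult.commute scaleC_of_real scaleC_scaleC)
qed (auto simp: scaleC_add_right norm_scaleC mult.commute)

text \<open>
  Bounded operators are elements of \<open>'a \<Rightarrow>\<^sub>L 'a\<close>, whose \<open>norm\<close> is the operator norm, that are in
  addition complex-linear.
\<close>

definition complex_linear :: "('a::complex_hilbert \<Rightarrow>\<^sub>L 'a) \<Rightarrow> bool"
  where "complex_linear A \<longleftrightarrow> (\<forall>c x. A (c *\<^sub>C x) = c *\<^sub>C A x)"

definition scalar_op :: "complex \<Rightarrow> 'a::complex_hilbert \<Rightarrow>\<^sub>L 'a"
  where "scalar_op c = Blinfun (scaleC c)"

lemma scalar_op_apply: "scalar_op c x = c *\<^sub>C x"
  by (simp add: scalar_op_def bounded_linear_Blinfun_apply bounded_linear_scaleC)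

definition op_pow :: "('a::real_normed_vector \<Rightarrow>\<^sub>L 'a) \<Rightarrow> nat \<Rightarrow> 'a \<Rightarrow>\<^sub>L 'a"
  where "op_pow A n = (((o\<^sub>L) A) ^^ n) id_blinfun"

definition spectrum :: "('a::complex_hilbert \<Rightarrow>\<^sub>L 'a) \<Rightarrow> complex set"
  where "spectrum A = {z. \<not> (\<exists>B. (A - scalar_op z) o\<^sub>L B = id_blinfun \<and>
                                B o\<^sub>L (A - scalar_op z) = id_blinfun)}"


section \<open>Spectral measures and integration against them\<close>

definition borel_subsets :: "complex set \<Rightarrow> complex set set"
  where "borel_subsets S = {B. B \<in> sets borel \<and> B \<subseteq> S}"

text \<open>The projections need not be orthogonal; \<open>E B o\<^sub>L E B = E B\<close> is the case \<open>B = C\<close>.\<close>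

definition spectral_measure :: "complex set \<Rightarrow> (complex set \<Rightarrow> 'a::complex_hilbert \<Rightarrow>\<^sub>L 'a) \<Rightarrow> bool"
  where "spectral_measure S E \<longleftrightarrow>
    S \<in> sets borel \<and>
    (\<forall>B\<in>borel_subsets S. complex_linear (E B)) \<and>
    (\<forall>B\<in>borel_subsets S. \<forall>C\<in>borel_subsets S. E B o\<^sub>L E C = E (B \<inter> C)) \<and>
    E S = id_blinfun \<and>
    (\<forall>A :: nat \<Rightarrow> complex set. range A \<subseteq> borel_subsets S \<longrightarrow> disjoint_family A \<longrightarrow>
       (\<forall>x. (\<lambda>n. E (A n) x) sums E (\<Union>n. A n) x))"

text \<open>
  Integrals against spectral measures are limits of Riemann sums over finite tagged Borel
  partitions, directed by refinement. The limits are taken in the strong operator topology, the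
  topology in which spectral measures are countably additive.
\<close>

definition finite_borel_partition :: "complex set \<Rightarrow> complex set set \<Rightarrow> bool"
  where "finite_borel_partition S Q \<longleftrightarrow> finite Q \<and> Q \<subseteq> sets borel \<and> partition_on S Q"

definition tagged_partition :: "complex set \<Rightarrow> (complex \<times> complex set) set \<Rightarrow> bool"
  where "tagged_partition S P \<longleftrightarrow>
    finite_borel_partition S (snd ` P) \<and> inj_on snd P \<and> (\<forall>(a, A)\<in>P. a \<in> A)"

definition refinement_filter :: "complex set \<Rightarrow> (complex \<times> complex set) set filter"
  where "refinement_filter S =
    (INF Q\<in>{Q. finite_borel_partition S Q}.
       principal {P. tagged_partition S P \<and> refines S (snd ` P) Q})"

text \<open>
  \<open>has_spectral_integral E B F T\<close> says that \<open>T\<close> is the integral of \<open>F(\<lambda>) dE(\<lambda>)\<close> over \<open>B\<close> for an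
  operator-valued integrand \<open>F\<close>. For \<open>F(\<lambda>) = g(\<lambda>)(X - \<lambda>I)\<^sup>q\<close> each Riemann sum equals the
  one obtained by expanding the power binomially in powers of \<open>X\<close> and \<open>\<lambda>\<close>.
\<close>

definition has_spectral_integral ::
  "(complex set \<Rightarrow> 'a::complex_hilbert \<Rightarrow>\<^sub>L 'a) \<Rightarrow> complex set \<Rightarrow> (complex \<Rightarrow> 'a \<Rightarrow>\<^sub>L 'a) \<Rightarrow> ('a \<Rightarrow>\<^sub>L 'a) \<Rightarrow> bool"
  where "has_spectral_integral E B F T \<longleftrightarrow>
    (\<forall>x. ((\<lambda>P. (\<Sum>(a, A)\<in>P. F a o\<^sub>L E A) x) \<longlongrightarrow> T x) (refinement_filter B))"

definition spectral_integrable ::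
  "(complex set \<Rightarrow> 'a::complex_hilbert \<Rightarrow>\<^sub>L 'a) \<Rightarrow> complex set \<Rightarrow> (complex \<Rightarrow> 'a \<Rightarrow>\<^sub>L 'a) \<Rightarrow> bool"
  where "spectral_integrable E B F \<longleftrightarrow> (\<exists>T. has_spectral_integral E B F T)"

definition spectral_integral ::
  "(complex set \<Rightarrow> 'a::complex_hilbert \<Rightarrow>\<^sub>L 'a) \<Rightarrow> complex set \<Rightarrow> (complex \<Rightarrow> 'a \<Rightarrow>\<^sub>L 'a) \<Rightarrow> 'a \<Rightarrow>\<^sub>L 'a"
  where "spectral_integral E B F = (THE T. has_spectral_integral E B F T)"

lemma finite_borel_partition_inter:
  assumes "finite_borel_partition S Q" "finite_borel_partition S R"
  shows "\<exists>W. finite_borel_partition S W \<and> refines S W Q \<and> refines S W R"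
proof -
  define W where "W = (\<lambda>(A, B). A \<inter> B) ` (Q \<times> R) - {{}}"
  have Q: "finite Q" "Q \<subseteq> sets borel" "partition_on S Q"
    and R: "finite R" "R \<subseteq> sets borel" "partition_on S R"
    using assms by (auto simp: finite_borel_partition_def)
  have "partition_on S W"
  proof (rule partition_onI)
    have "\<Union> W = \<Union> Q \<inter> \<Union> R"
      unfolding W_def by blast
    then show "\<Union> W = S"
      using Q(3) R(3) by (simp add: partition_on_def)
    show "disjnt p q" if "p \<in> W" "q \<in> W" "p \<noteq> q" for p q
    proof -
      obtain A B C D where *: "p = A \<inter> B" "q = C \<inter> D" "A \<in> Q" "C \<in> Q" "B \<in> R" "D \<in> R"
        using \<open>p \<in> W\<close> \<open>q \<in> W\<close> unfolding W_def by auto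
      then have "A \<noteq> C \<or> B \<noteq> D"
        using \<open>p \<noteq> q\<close> by auto
      then have "A \<inter> C = {} \<or> B \<inter> D = {}"
        using * disjointD[OF partition_onD2[OF Q(3)]] disjointD[OF partition_onD2[OF R(3)]] by metis
      then show ?thesis
        using * by (auto simp: disjnt_def)
    qed
  qed (auto simp: W_def)
  moreover have "finite W" "W \<subseteq> sets borel"
    using Q R by (auto simp: W_def)
  moreover have "\<forall>X\<in>W. \<exists>Y\<in>Q. X \<subseteq> Y" "\<forall>X\<in>W. \<exists>Y\<in>R. X \<subseteq> Y"
    by (auto simp: W_def)
  ultimately have "finite_borel_partition S W \<and> refines S W Q \<and> refines S W R"
    using Q(3) R(3) by (simp add: finite_borel_partition_def refines_def)
  then show ?thesis ..
qed

lemma tagged_partition_exists: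
  assumes "finite_borel_partition S Q"
  shows "\<exists>P. tagged_partition S P \<and> snd ` P = Q"
proof -
  have "\<forall>A\<in>Q. \<exists>a. a \<in> A"
    using assms by (metis ex_in_conv finite_borel_partition_def partition_on_def)
  then obtain t where "\<forall>A\<in>Q. t A \<in> A"
    by metis
  moreover have "snd ` ((\<lambda>A. (t A, A)) ` Q) = Q"
    by (simp add: image_image)
  ultimately have "tagged_partition S ((\<lambda>A. (t A, A)) ` Q)"
    using assms by (auto simp: tagged_partition_def inj_on_def)
  then show ?thesis
    using \<open>snd ` ((\<lambda>A. (t A, A)) ` Q) = Q\<close> by blast
qed

lemma refinement_filter_neq_bot: "refinement_filter S \<noteq> bot"
proof (cases "{Q. finite_borel_partition S Q} = {}")
  case True
  show ?thesis
    unfolding refinement_filter_def True trivial_limit_def by (simp add: eventually_top)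
next
  case False
  have ev: "eventually P (refinement_filter S) \<longleftrightarrow>
      (\<exists>Q\<in>{Q. finite_borel_partition S Q}.
         eventually P (principal {P. tagged_partition S P \<and> refines S (snd ` P) Q}))" for P
    unfolding refinement_filter_def
  proof (rule eventually_INF_base[OF False])
    fix Q R
    assume "Q \<in> {Q. finite_borel_partition S Q}" "R \<in> {Q. finite_borel_partition S Q}"
    then obtain W where W: "finite_borel_partition S W" "refines S W Q" "refines S W R"
      using finite_borel_partition_inter[of S Q R] by auto
    have "{P. tagged_partition S P \<and> refines S (snd ` P) W} \<subseteq>
        {P. tagged_partition S P \<and> refines S (snd ` P) Q} \<inter>
        {P. tagged_partition S P \<and> refines S (snd ` P) R}"
      using W(2,3) by (auto intro: refines_trans)
    then show "\<exists>W\<in>{Q. finite_borel_partition S Q}.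
        principal {P. tagged_partition S P \<and> refines S (snd ` P) W}
        \<le> inf (principal {P. tagged_partition S P \<and> refines S (snd ` P) Q})
              (principal {P. tagged_partition S P \<and> refines S (snd ` P) R})"
      using W(1) by (intro bexI[of _ W]) (simp_all only: inf_principal principal_le_iff mem_Collect_eq)
  qed
  show ?thesis
    unfolding trivial_limit_def ev
  proof
    assume "\<exists>Q\<in>{Q. finite_borel_partition S Q}.
        eventually (\<lambda>_. False) (principal {P. tagged_partition S P \<and> refines S (snd ` P) Q})"
    then obtain Q where Q: "finite_borel_partition S Q"
      and empty: "\<And>P. \<not> (tagged_partition S P \<and> refines S (snd ` P) Q)"
      by (simp only: eventually_principal) auto
    obtain P where "tagged_partition S P" "snd ` P = Q"
      using tagged_partition_exists[OF Q] by auto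
    with empty[of P] Q show False
      by (simp add: finite_borel_partition_def refines_refl)
  qed
qed

lemma spectral_integral_unique:
  assumes T: "has_spectral_integral E B F T"
  shows "spectral_integral E B F = T"
  unfolding spectral_integral_def
proof (rule the_equality)
  fix T' assume T': "has_spectral_integral E B F T'"
  show "T' = T"
  proof (rule blinfun_eqI)
    show "T' x = T x" for x
      by (rule tendsto_unique[OF refinement_filter_neq_bot
            T'[unfolded has_spectral_integral_def, rule_format]
            T[unfolded has_spectral_integral_def, rule_format]])
  qed
qed (fact T)

text \<open>
  Integrated form of the formal relations between \<open>dE(\<lambda>)\<close> and \<open>(X - \<lambda>I)dE(\<lambda>)\<close>: a product of
  differentials carrying a delta symbol becomes an identity between integrals over Borel sets
  \<open>B\<close>, \<open>C\<close> and \<open>B \<inter> C\<close>. Likewise \<open>[(X - \<lambda>I)dE(\<lambda>)]\<^sup>l = 0\<close> for \<open>l \<ge> m \<lambda>\<close> is required over every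
  Borel set on which \<open>m \<le> l\<close>; at single points only it would be void for non-atomic \<open>E\<close>.
  Measurability of \<open>m\<close> makes the integrands containing \<open>m\<close> measurable.
\<close>

definition spectral_decomposition ::
  "('a::complex_hilbert \<Rightarrow>\<^sub>L 'a) \<Rightarrow> (complex set \<Rightarrow> 'a \<Rightarrow>\<^sub>L 'a) \<Rightarrow> (complex \<Rightarrow> nat) \<Rightarrow> bool"
  where "spectral_decomposition X E m \<longleftrightarrow>
    (let S = spectrum X;
         D = (\<lambda>q z. op_pow (X - scalar_op z) q);
         N = (\<lambda>B. spectral_integral E B (D 1))
     in complex_linear X \<and>
        spectral_measure S E \<and>
        (\<forall>B\<in>borel_subsets S. spectral_integrable E B scalar_op \<and>
           (\<forall>q. spectral_integrable E B (D q))) \<and>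
        X = spectral_integral E S scalar_op + N S \<and>
        (\<forall>B\<in>borel_subsets S. \<forall>C\<in>borel_subsets S.
           E C o\<^sub>L N B = N (B \<inter> C) \<and>
           N B o\<^sub>L E C = N (B \<inter> C) \<and>
           N B o\<^sub>L N C = spectral_integral E (B \<inter> C) (D 2)) \<and>
        (\<forall>z\<in>S. 1 \<le> m z) \<and>
        (\<forall>l. {z\<in>S. m z \<le> l} \<in> sets borel) \<and>
        (\<forall>l\<ge>1. \<forall>B\<in>borel_subsets S. (\<forall>z\<in>B. m z \<le> l) \<longrightarrow> op_pow (N B) l = 0))"


section \<open>Generalized double operator integrals\<close>

definition holomorphic2_on :: "(complex \<times> complex \<Rightarrow> complex) \<Rightarrow> (complex \<times> complex) set \<Rightarrow> bool"
  where "holomorphic2_on \<beta> D \<longleftrightarrow>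
    (\<forall>p\<in>D. \<exists>a b. (\<beta> has_derivative (\<lambda>(h, k). a * h + b * k)) (at p within D))"

definition partial_deriv ::
  "nat \<Rightarrow> nat \<Rightarrow> (complex \<times> complex \<Rightarrow> complex) \<Rightarrow> complex \<times> complex \<Rightarrow> complex"
  where "partial_deriv q1 q2 \<beta> =
    (\<lambda>(z1, z2). (deriv ^^ q1) (\<lambda>w1. (deriv ^^ q2) (\<lambda>w2. \<beta> (w1, w2)) z2) z1)"

definition gdoi_sum ::
  "('a::complex_hilbert \<Rightarrow>\<^sub>L 'a) \<Rightarrow> (complex set \<Rightarrow> 'a \<Rightarrow>\<^sub>L 'a) \<Rightarrow> (complex \<Rightarrow> nat) \<Rightarrow>
   ('a \<Rightarrow>\<^sub>L 'a) \<Rightarrow> (complex set \<Rightarrow> 'a \<Rightarrow>\<^sub>L 'a) \<Rightarrow> (complex \<Rightarrow> nat) \<Rightarrow>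
   (complex \<times> complex \<Rightarrow> complex) \<Rightarrow> ('a \<Rightarrow>\<^sub>L 'a) \<Rightarrow>
   (complex \<times> complex set) set \<Rightarrow> (complex \<times> complex set) set \<Rightarrow> 'a \<Rightarrow>\<^sub>L 'a"
  where "gdoi_sum X1 E1 m1 X2 E2 m2 \<beta> Y P1 P2 =
    (\<Sum>(a, A)\<in>P1. \<Sum>(b, B)\<in>P2. \<Sum>q1<m1 a. \<Sum>q2<m2 b.
       scalar_op (partial_deriv q1 q2 \<beta> (a, b) / (fact q1 * fact q2)) o\<^sub>L
       (op_pow (X1 - scalar_op a) q1 o\<^sub>L E1 A) o\<^sub>L Y o\<^sub>L (op_pow (X2 - scalar_op b) q2 o\<^sub>L E2 B))"

text \<open>
  The double integral is the joint limit over pairs of partitions; the summation bounds \<open>m\<^sub>\<lambda>\<close> are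
  evaluated at the tags, like the rest of the integrand.
\<close>

definition has_gdoi ::
  "('a::complex_hilbert \<Rightarrow>\<^sub>L 'a) \<Rightarrow> (complex set \<Rightarrow> 'a \<Rightarrow>\<^sub>L 'a) \<Rightarrow> (complex \<Rightarrow> nat) \<Rightarrow>
   ('a \<Rightarrow>\<^sub>L 'a) \<Rightarrow> (complex set \<Rightarrow> 'a \<Rightarrow>\<^sub>L 'a) \<Rightarrow> (complex \<Rightarrow> nat) \<Rightarrow>
   (complex \<times> complex \<Rightarrow> complex) \<Rightarrow> ('a \<Rightarrow>\<^sub>L 'a) \<Rightarrow> ('a \<Rightarrow>\<^sub>L 'a) \<Rightarrow> bool"
  where "has_gdoi X1 E1 m1 X2 E2 m2 \<beta> Y T \<longleftrightarrow>
    (\<forall>x. ((\<lambda>(P1, P2). gdoi_sum X1 E1 m1 X2 E2 m2 \<beta> Y P1 P2 x) \<longlongrightarrow> T x)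
           (refinement_filter (spectrum X1) \<times>\<^sub>F refinement_filter (spectrum X2)))"

definition gdoi_exists ::
  "('a::complex_hilbert \<Rightarrow>\<^sub>L 'a) \<Rightarrow> (complex set \<Rightarrow> 'a \<Rightarrow>\<^sub>L 'a) \<Rightarrow> (complex \<Rightarrow> nat) \<Rightarrow>
   ('a \<Rightarrow>\<^sub>L 'a) \<Rightarrow> (complex set \<Rightarrow> 'a \<Rightarrow>\<^sub>L 'a) \<Rightarrow> (complex \<Rightarrow> nat) \<Rightarrow>
   (complex \<times> complex \<Rightarrow> complex) \<Rightarrow> ('a \<Rightarrow>\<^sub>L 'a) \<Rightarrow> bool"
  where "gdoi_exists X1 E1 m1 X2 E2 m2 \<beta> Y \<longleftrightarrow> (\<exists>T. has_gdoi X1 E1 m1 X2 E2 m2 \<beta> Y T)"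

definition gdoi ::
  "('a::complex_hilbert \<Rightarrow>\<^sub>L 'a) \<Rightarrow> (complex set \<Rightarrow> 'a \<Rightarrow>\<^sub>L 'a) \<Rightarrow> (complex \<Rightarrow> nat) \<Rightarrow>
   ('a \<Rightarrow>\<^sub>L 'a) \<Rightarrow> (complex set \<Rightarrow> 'a \<Rightarrow>\<^sub>L 'a) \<Rightarrow> (complex \<Rightarrow> nat) \<Rightarrow>
   (complex \<times> complex \<Rightarrow> complex) \<Rightarrow> ('a \<Rightarrow>\<^sub>L 'a) \<Rightarrow> ('a \<Rightarrow>\<^sub>L 'a)"
  where "gdoi X1 E1 m1 X2 E2 m2 \<beta> Y = (THE T. has_gdoi X1 E1 m1 X2 E2 m2 \<beta> Y T)"

lemma gdoi_unique:
  assumes T: "has_gdoi X1 E1 m1 X2 E2 m2 \<beta> Y T"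
  shows "gdoi X1 E1 m1 X2 E2 m2 \<beta> Y = T"
  unfolding gdoi_def
proof (rule the_equality)
  have nb: "refinement_filter (spectrum X1) \<times>\<^sub>F refinement_filter (spectrum X2) \<noteq> bot"
    by (simp add: prod_filter_eq_bot refinement_filter_neq_bot)
  fix T' assume T': "has_gdoi X1 E1 m1 X2 E2 m2 \<beta> Y T'"
  show "T' = T"
  proof (rule blinfun_eqI)
    show "T' x = T x" for x
      by (rule tendsto_unique[OF nb T'[unfolded has_gdoi_def, rule_format]
            T[unfolded has_gdoi_def, rule_format]])
  qed
qed (fact T)


section \<open>Polynomial convexity\<close>

text \<open>The bound \<open>M\<close> ranges over all upper bounds of \<open>\<bar>p\<bar>\<close> on \<open>K\<close>, so that its infimum is the supremum of \<open>\<bar>p\<bar>\<close>.\<close>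

definition polynomial_hull :: "complex set \<Rightarrow> complex set"
  where "polynomial_hull K =
    {z. \<forall>p M. (\<forall>w\<in>K. cmod (poly p w) \<le> M) \<longrightarrow> cmod (poly p z) \<le> M}"

definition polynomially_convex :: "complex set \<Rightarrow> bool"
  where "polynomially_convex K \<longleftrightarrow> polynomial_hull K = K"

end

theory Submission
  imports
    Defs
    "HOL-Complex_Analysis.Cauchy_Integral_Formula"
    "HOL-Complex_Analysis.Winding_Numbers"
begin

text \<open>
  The double operator integral has the Cauchy representation
  \<open>T\<^sub>\<beta>(Y) = (2\<pi>\<i>)\<^bsup>-2\<^esup> \<integral>\<integral> \<beta>(z, w) (z - X\<^sub>1)\<^bsup>-1\<^esup> Y (w - X\<^sub>2)\<^bsup>-1\<^esup> dz dw\<close> over cycles around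
  the two spectra inside the domain of \<open>\<beta>\<close>. The cycles depend only on \<open>X\<^sub>1\<close> and \<open>X\<^sub>2\<close> because
  spectra are upper semicontinuous, and resolvents converge uniformly on compact sets off the
  spectrum, so continuity in the operator norm is immediate.

  To obtain the representation, insert Cauchy's formula for \<open>\<beta>\<^bsup>(q1,q2)\<^esup>(a, b)\<close> into a Riemann
  sum. What remains are the one-variable sums
  \<open>\<Sum>\<^sub>A (\<Sum>q<m(a). (z - a)\<^bsup>-q-1\<^esup> (X - a)\<^sup>q) E(A)\<close>. Restricted to a set \<open>C\<close> on which \<open>m = j\<close>, such a sum
  differs from \<open>(z - X)\<^bsup>-1\<^esup> E(C)\<close> by a factor \<open>U\<^sup>j\<close>, where \<open>U = X E(C) - \<Sum>\<^sub>A a E(A)\<close> tends in norm to the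
  nilpotent part \<open>N(C)\<close> and \<open>N(C)\<^sup>j = 0\<close>. Countable additivity over the level sets of \<open>m\<close>, which
  may be unbounded, then identifies the two operators.
\<close>

section \<open>Cauchy cycles around compact sets\<close>

text \<open>The two double integrals cannot be compared term by term: when operators converge in
  norm, their spectral measures need not converge and the nilpotency orders may jump, as when a
  Jordan block is perturbed into a diagonalizable matrix. The Cauchy representation is used because
  \<open>E\<close> and \<open>m\<close> disappear from it and only resolvents remain. Since the
  integrals are assumed to exist, it suffices to identify whatever strong limit the Riemann sums
  have.

  The obstacle is that spectral integrals are strong limits, while nilpotency has to be exploited in
  norm. The bridge is a norm bound for sums of projections of disjoint sets with coefficients of
  modulus at most \<open>k\<close>: it is \<open>4 * E_bound * k\<close>, whatever the number of
  parts. For orthogonal projections this would be Pythagoras; here it rests on the uniform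
  boundedness of \<open>E\<close>, proved through Baire category, and on splitting the values of
  real functionals by their sign.\<close>

definition gridpt :: "real \<Rightarrow> int \<Rightarrow> int \<Rightarrow> complex"
  where "gridpt d i j = Complex (d * of_int i) (d * of_int j)"

definition gridsq :: "real \<Rightarrow> int \<times> int \<Rightarrow> complex set"
  where "gridsq d = (\<lambda>(i, j). cbox (gridpt d i j) (gridpt d (i + 1) (j + 1)))"

definition gridint :: "real \<Rightarrow> int \<times> int \<Rightarrow> complex set"
  where "gridint d = (\<lambda>(i, j). box (gridpt d i j) (gridpt d (i + 1) (j + 1)))"

lemma mem_gridsq_iff:
  "z \<in> gridsq d (i, j) \<longleftrightarrow> d * of_int i \<le> Re z \<and> Re z \<le> d * of_int (i + 1) \<and>
     d * of_int j \<le> Im z \<and> Im z \<le> d * of_int (j + 1)"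
  by (auto simp: gridsq_def gridpt_def in_cbox_complex_iff)

lemma mem_gridint_iff:
  "z \<in> gridint d (i, j) \<longleftrightarrow> d * of_int i < Re z \<and> Re z < d * of_int (i + 1) \<and>
     d * of_int j < Im z \<and> Im z < d * of_int (j + 1)"
  by (auto simp: gridint_def gridpt_def in_box_complex_iff)

lemma gridint_eq:
  assumes "d > 0" "z \<in> gridint d (k, l)" "z \<in> gridsq d (i, j)"
  shows "(i, j) = (k, l)"
proof -
  have "d * of_int i < d * of_int (k + 1)" "d * of_int k < d * of_int (i + 1)"
    "d * of_int j < d * of_int (l + 1)" "d * of_int l < d * of_int (j + 1)"
    using assms(2,3) unfolding mem_gridint_iff mem_gridsq_iff by linarith+
  then have "(of_int i :: real) < of_int (k + 1)" "(of_int k :: real) < of_int (i + 1)"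
    "(of_int j :: real) < of_int (l + 1)" "(of_int l :: real) < of_int (j + 1)"
    using mult_less_cancel_left_pos[OF assms(1)] by blast+
  then show ?thesis
    unfolding of_int_less_iff by simp
qed

lemma in_gridsq_floor:
  assumes "d > 0"
  shows "z \<in> gridsq d (\<lfloor>Re z / d\<rfloor>, \<lfloor>Im z / d\<rfloor>)"
proof -
  have "d * of_int \<lfloor>x / d\<rfloor> \<le> x \<and> x \<le> d * of_int (\<lfloor>x / d\<rfloor> + 1)" for x :: real
  proof -
    have "of_int \<lfloor>x / d\<rfloor> \<le> x / d" "x / d \<le> of_int (\<lfloor>x / d\<rfloor> + 1)"
      by linarith+
    then show ?thesis
      unfolding pos_le_divide_eq[OF assms] pos_divide_le_eq[OF assms] by (simp only: mult.commute)
  qed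
  then show ?thesis
    unfolding mem_gridsq_iff by blast
qed

text \<open>Lets a point on a grid line be approached through a single open cell, where Cauchy's
  formula is available.\<close>

lemma closure_gridint:
  assumes "d > 0"
  shows "closure (gridint d (i, j)) = gridsq d (i, j)"
proof -
  have "Complex (d * of_int i + d / 2) (d * of_int j + d / 2) \<in> gridint d (i, j)"
    using assms by (simp add: mem_gridint_iff distrib_left)
  then show ?thesis
    unfolding gridint_def gridsq_def prod.case using closure_box by blast
qed

lemma gridsq_dist:
  assumes "z \<in> gridsq d (i, j)" "w \<in> gridsq d (i, j)"
  shows "dist z w \<le> 2 * d"
proof -
  have "\<bar>Re (z - w)\<bar> \<le> d" "\<bar>Im (z - w)\<bar> \<le> d"
    using assms by (auto simp: mem_gridsq_iff distrib_left)
  then show ?thesis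
    using cmod_le[of "z - w"] by (simp add: dist_norm)
qed

lemma finite_gridsq_meeting:
  assumes "d > 0" "bounded K"
  shows "finite {q. gridsq d q \<inter> K \<noteq> {}}"
proof -
  obtain B where B: "\<And>z. z \<in> K \<Longrightarrow> cmod z \<le> B"
    using assms(2) by (auto simp: bounded_iff)
  define n where "n = \<lceil>B / d\<rceil> + 1"
  have "{q. gridsq d q \<inter> K \<noteq> {}} \<subseteq> {-n..n} \<times> {-n..n}"
  proof
    fix q assume "q \<in> {q. gridsq d q \<inter> K \<noteq> {}}"
    then obtain i j z where q: "q = (i, j)" and z: "z \<in> gridsq d (i, j)" "z \<in> K"
      by (cases q) auto
    have *: "m \<in> {-n..n}" if "d * of_int m \<le> x" "x \<le> d * of_int (m + 1)" "\<bar>x\<bar> \<le> B" for m x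
    proof -
      have "d * of_int m \<le> B" "- B \<le> d * of_int (m + 1)"
        using that by linarith+
      then have "of_int m \<le> B / d" "- (B / d) \<le> of_int (m + 1)"
        using assms(1) by (auto simp: field_simps)
      moreover have "B / d \<le> of_int \<lceil>B / d\<rceil>"
        by linarith
      ultimately show ?thesis
        unfolding n_def by simp linarith
    qed
    have "\<bar>Re z\<bar> \<le> B" "\<bar>Im z\<bar> \<le> B"
      using B[OF z(2)] abs_Re_le_cmod[of z] abs_Im_le_cmod[of z] by linarith+
    then show "q \<in> {-n..n} \<times> {-n..n}"
      using z(1) * unfolding q mem_Sigma_iff mem_gridsq_iff by blast
  qed
  then show ?thesis
    by (rule finite_subset) simp
qed

section \<open>Integrals over chains of segments and Cauchy's formula for one grid square\<close>

definition chain_integral :: "(complex \<times> complex) list \<Rightarrow> (complex \<Rightarrow> complex) \<Rightarrow> complex"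
  where "chain_integral es f = (\<Sum>(p, q)\<leftarrow>es. contour_integral (linepath p q) f)"

lemma chain_integral_sum_nth:
  "chain_integral es f = (\<Sum>i<length es. contour_integral (linepath (fst (es ! i)) (snd (es ! i))) f)"
  by (simp add: chain_integral_def sum_list_sum_nth case_prod_unfold atLeast0LessThan)

text \<open>A horizontal edge is indexed by its left end, a vertical one by its lower end. The top
  edge of a square and the bottom edge of the square above it thus carry the same index with
  opposite signs, and likewise for left and right, which is the form that
  \<open>sum_diff_image\<close> cancels.\<close>

lemma contour_integral_gridsq_edges:
  assumes "continuous_on (path_image (rectpath (gridpt d i j) (gridpt d (i + 1) (j + 1)))) h" "d > 0"
  defines "H \<equiv> \<lambda>(i, j). contour_integral (linepath (gridpt d i j) (gridpt d (i + 1) j)) h"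
  defines "V \<equiv> \<lambda>(i, j). contour_integral (linepath (gridpt d i j) (gridpt d i (j + 1))) h"
  shows "contour_integral (rectpath (gridpt d i j) (gridpt d (i + 1) (j + 1))) h =
     H (i, j) + V (i + 1, j) - H (i, j + 1) - V (i, j)"
proof -
  have cs: "continuous_on (closed_segment (gridpt d i j) (gridpt d (i + 1) j)) h"
    "continuous_on (closed_segment (gridpt d (i + 1) j) (gridpt d (i + 1) (j + 1))) h"
    "continuous_on (closed_segment (gridpt d (i + 1) (j + 1)) (gridpt d i (j + 1))) h"
    "continuous_on (closed_segment (gridpt d i (j + 1)) (gridpt d i j)) h"
    using assms(1) by (auto simp: rectpath_def gridpt_def path_image_join Let_def
        elim!: continuous_on_subset)
  have rev: "contour_integral (linepath (gridpt d (i + 1) (j + 1)) (gridpt d i (j + 1))) h = - H (i, j + 1)"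
    "contour_integral (linepath (gridpt d i (j + 1)) (gridpt d i j)) h = - V (i, j)"
    unfolding H_def V_def using cs by (auto intro!: contour_integral_reverse_linepath)
  have "contour_integral (rectpath (gridpt d i j) (gridpt d (i + 1) (j + 1))) h =
    contour_integral (linepath (gridpt d i j) (gridpt d (i + 1) j)) h +
    (contour_integral (linepath (gridpt d (i + 1) j) (gridpt d (i + 1) (j + 1))) h +
    (contour_integral (linepath (gridpt d (i + 1) (j + 1)) (gridpt d i (j + 1))) h +
    contour_integral (linepath (gridpt d i (j + 1)) (gridpt d i j)) h))"
    using cs[THEN contour_integrable_continuous_linepath]
    by (simp add: rectpath_def gridpt_def Let_def)
  then show ?thesis
    unfolding rev by (simp add: H_def V_def)
qed

lemma contour_integral_gridsq:
  assumes d: "d > 0" and f: "f holomorphic_on gridsq d (i, j)" and a: "a \<in> gridint d (k, l)"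
  shows "contour_integral (rectpath (gridpt d i j) (gridpt d (i + 1) (j + 1))) (\<lambda>z. f z / (z - a)) =
    (if (i, j) = (k, l) then 2 * pi * \<i> * f a else 0)"
proof -
  let ?g = "rectpath (gridpt d i j) (gridpt d (i + 1) (j + 1))"
  have le: "Re (gridpt d i j) < Re (gridpt d (i + 1) (j + 1))"
    "Im (gridpt d i j) < Im (gridpt d (i + 1) (j + 1))"
    using d by (auto simp: gridpt_def distrib_left)
  have img: "path_image ?g \<subseteq> gridsq d (i, j)"
    unfolding gridsq_def using path_image_rectpath_subset_cbox le by simp
  show ?thesis
  proof (cases "(i, j) = (k, l)")
    case True
    then have a': "a \<in> box (gridpt d i j) (gridpt d (i + 1) (j + 1))"
      using a by (simp add: gridint_def)
    have "a \<in> interior (gridsq d (i, j))"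
      using a' by (simp add: gridsq_def interior_cbox)
    moreover have "path_image ?g \<subseteq> gridsq d (i, j) - {a}"
      using img path_image_rectpath_inter_box[of "gridpt d i j" "gridpt d (i + 1) (j + 1)"] le a' by auto
    ultimately have "((\<lambda>w. f w / (w - a)) has_contour_integral
        (2 * pi * \<i> * winding_number ?g a * f a)) ?g"
      by (intro Cauchy_integral_formula_convex_simple[OF _ f])
        (auto simp: gridsq_def)
    moreover have "winding_number ?g a = 1"
      using a' by (rule winding_number_rectpath)
    ultimately show ?thesis
      using True by (simp add: contour_integral_unique)
  next
    case False
    then have "a \<notin> gridsq d (i, j)"
      using gridint_eq[OF d a] by auto
    then have "(\<lambda>z. f z / (z - a)) holomorphic_on gridsq d (i, j)"
      by (auto intro!: holomorphic_intros f)
    then have "((\<lambda>z. f z / (z - a)) has_contour_integral 0) ?g"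
      by (rule Cauchy_theorem_convex_simple) (use img in \<open>auto simp: gridsq_def\<close>)
    then show ?thesis
      using False by (simp only: contour_integral_unique if_False)
  qed
qed

text \<open>Differentiation of a Cauchy-type integral under the integral sign. The density is merely
  continuous, so the rule also covers the inner integral of a double Cauchy integral, which is not
  known to be holomorphic when it is used.\<close>

lemma contour_integral_linepath_deriv:
  assumes f: "continuous_on (closed_segment p q) f" and w: "w \<notin> closed_segment p q"
  shows "((\<lambda>w. contour_integral (linepath p q) (\<lambda>u. f u / (u - w) ^ Suc k)) has_field_derivative
           of_nat (Suc k) * contour_integral (linepath p q) (\<lambda>u. f u / (u - w) ^ Suc (Suc k))) (at w)"
proof (rule Cauchy_next_derivative(2)[where S = UNIV and k = "Suc k" and B = "norm (q - p)"])
  fix w assume "w \<in> UNIV - path_image (linepath p q)"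
  then have "continuous_on (closed_segment p q) (\<lambda>u. f u / (u - w) ^ Suc k)"
    using f by (auto intro!: continuous_intros)
  then show "((\<lambda>u. f u / (u - w) ^ Suc k) has_contour_integral
      contour_integral (linepath p q) (\<lambda>u. f u / (u - w) ^ Suc k)) (linepath p q)"
    by (intro has_contour_integral_integral contour_integrable_continuous_linepath)
qed (use assms in auto)

text \<open>A horizontal edge lies in the square above it and in the one below. If exactly one of
  them meets \<open>K\<close>, the edge itself cannot meet \<open>K\<close>.\<close>

lemma closed_segment_gridsq:
  assumes "d > 0" "z \<in> closed_segment (gridpt d i j) (gridpt d (i + 1) j)"
  shows "z \<in> gridsq d (i, j)" "z \<in> gridsq d (i, j - 1)"
proof -
  have "convex (gridsq d (i, j))" "convex (gridsq d (i, j - 1))"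
    by (simp_all add: gridsq_def)
  moreover have "{gridpt d i j, gridpt d (i + 1) j} \<subseteq> gridsq d (i, j) \<inter> gridsq d (i, j - 1)"
    using assms(1) by (auto simp: mem_gridsq_iff, auto simp: gridpt_def algebra_simps)
  ultimately show "z \<in> gridsq d (i, j)" "z \<in> gridsq d (i, j - 1)"
    using assms(2) closed_segment_subset[of "gridpt d i j" _ "gridpt d (i + 1) j"] by blast+
qed

lemma closed_segment_gridsq':
  assumes "d > 0" "z \<in> closed_segment (gridpt d i j) (gridpt d i (j + 1))"
  shows "z \<in> gridsq d (i, j)" "z \<in> gridsq d (i - 1, j)"
proof -
  have "convex (gridsq d (i, j))" "convex (gridsq d (i - 1, j))"
    by (simp_all add: gridsq_def)
  moreover have "{gridpt d i j, gridpt d i (j + 1)} \<subseteq> gridsq d (i, j) \<inter> gridsq d (i - 1, j)"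
    using assms(1) by (auto simp: mem_gridsq_iff, auto simp: gridpt_def algebra_simps)
  ultimately show "z \<in> gridsq d (i, j)" "z \<in> gridsq d (i - 1, j)"
    using assms(2) closed_segment_subset[of "gridpt d i j" _ "gridpt d i (j + 1)"] by blast+
qed

text \<open>The part common to \<open>Q\<close> and its image cancels. With \<open>s\<close> the
  shift to a neighbouring square, what cancels are the edges shared by two squares of
  \<open>Q\<close>, and the remaining sums run over boundary edges.\<close>

lemma sum_diff_image:
  fixes h :: "'b \<Rightarrow> 'c::ab_group_add"
  assumes "finite Q" "inj s"
  shows "(\<Sum>q\<in>Q. h q - h (s q)) = (\<Sum>q\<in>Q - s ` Q. h q) - (\<Sum>q\<in>s ` Q - Q. h q)"
proof -
  have "(\<Sum>q\<in>Q. h (s q)) = sum h (s ` Q)"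
    using assms(2) by (simp add: sum.reindex inj_on_subset)
  moreover have "sum h Q = sum h (Q \<inter> s ` Q) + sum h (Q - s ` Q)"
    "sum h (s ` Q) = sum h (s ` Q \<inter> Q) + sum h (s ` Q - Q)"
    using assms(1) by (auto intro!: sum.Int_Diff)
  ultimately show ?thesis
    by (simp add: sum_subtractf Int_commute)
qed

text \<open>
  The chain consists of the boundary edges of the union of the grid squares meeting \<open>K\<close>; an edge
  that meets \<open>K\<close> belongs to two such squares and cancels. The formula is clear at interior points of
  the squares and extends to points of \<open>K\<close> on grid lines by continuity.
\<close>

lemma cauchy_chain_exists:
  assumes K: "compact K" and U: "open U" and KU: "K \<subseteq> U"
  shows "\<exists>es. (\<forall>(p, q)\<in>set es. closed_segment p q \<subseteq> U - K) \<and>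
    (\<forall>f a. f holomorphic_on U \<longrightarrow> a \<in> K \<longrightarrow>
       chain_integral es (\<lambda>z. f z / (z - a)) = 2 * pi * \<i> * f a)"
proof -
  obtain e where e: "e > 0" "(\<Union>x\<in>K. ball x e) \<subseteq> U"
    using compact_subset_open_imp_ball_epsilon_subset[OF K U KU] by blast
  \<comment> \<open>Two points of a closed square are at distance at most \<open>2 * d < e\<close>,
    so a square that meets \<open>K\<close> stays inside \<open>U\<close>.\<close>
  define d where "d = e / 4"
  have d: "d > 0" "2 * d < e"
    using e(1) by (auto simp: d_def)
  define Q where "Q = {q. gridsq d q \<inter> K \<noteq> {}}"
  have fin: "finite Q"
    unfolding Q_def using finite_gridsq_meeting[OF d(1)] K compact_imp_bounded by blast
  have QU: "gridsq d q \<subseteq> U" if qQ: "q \<in> Q" for q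
  proof
    fix z assume z: "z \<in> gridsq d q"
    obtain x where "x \<in> K" "x \<in> gridsq d q"
      using qQ unfolding Q_def by blast
    moreover obtain i j where "q = (i, j)" by fastforce
    ultimately have "dist x z < e"
      using gridsq_dist[of x d i j z] z d(2) by simp
    then show "z \<in> U"
      using e(2) \<open>x \<in> K\<close> mem_ball by blast
  qed
  define up :: "int \<times> int \<Rightarrow> int \<times> int" where "up = (\<lambda>(i, j). (i, j + 1))"
  define rt :: "int \<times> int \<Rightarrow> int \<times> int" where "rt = (\<lambda>(i, j). (i + 1, j))"
  have inj: "inj up" "inj rt"
    by (auto simp: inj_def up_def rt_def)
  define hor where "hor = (\<lambda>(i, j). (gridpt d i j, gridpt d (i + 1) j))"
  define ver where "ver = (\<lambda>(i, j). (gridpt d i j, gridpt d i (j + 1)))"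
  \<comment> \<open>Bottom, top, right and left boundary edges, in this order. A top edge carries
    the index of the unselected square above it, a right edge that of the unselected square to its
    right. Top and left edges are reversed by \<open>prod.swap\<close>, so the boundary is traversed
    counterclockwise.\<close>
  obtain l1 l2 l3 l4 where l:
    "set l1 = Q - up ` Q" "distinct l1" "set l2 = up ` Q - Q" "distinct l2"
    "set l3 = rt ` Q - Q" "distinct l3" "set l4 = Q - rt ` Q" "distinct l4"
    using fin finite_distinct_list by (metis finite_Diff finite_imageI)
  define es where "es = map hor l1 @ map (prod.swap \<circ> hor) l2 @ map ver l3 @ map (prod.swap \<circ> ver) l4"
  have hseg: "closed_segment (fst (hor q)) (snd (hor q)) \<subseteq> U - K" if "q \<in> (Q - up ` Q) \<union> (up ` Q - Q)" for q
  proof -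
    obtain i j where q: "q = (i, j)" by fastforce
    have "(i, j - 1) \<in> Q \<longleftrightarrow> (i, j) \<in> up ` Q"
      by (force simp: up_def)
    then have "(i, j) \<in> Q \<and> (i, j - 1) \<notin> Q \<or> (i, j - 1) \<in> Q \<and> (i, j) \<notin> Q"
      using that q by auto
    then show ?thesis
      using closed_segment_gridsq[OF d(1), of _ i j] QU
      by (fastforce simp: q hor_def Q_def)
  qed
  have vseg: "closed_segment (fst (ver q)) (snd (ver q)) \<subseteq> U - K" if "q \<in> (Q - rt ` Q) \<union> (rt ` Q - Q)" for q
  proof -
    obtain i j where q: "q = (i, j)" by fastforce
    have "(i - 1, j) \<in> Q \<longleftrightarrow> (i, j) \<in> rt ` Q"
      by (force simp: rt_def)
    then have "(i, j) \<in> Q \<and> (i - 1, j) \<notin> Q \<or> (i - 1, j) \<in> Q \<and> (i, j) \<notin> Q"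
      using that q by auto
    then show ?thesis
      using closed_segment_gridsq'[OF d(1), of _ i j] QU
      by (fastforce simp: q ver_def Q_def)
  qed
  have seg: "closed_segment p q \<subseteq> U - K" if "(p, q) \<in> set es" for p q
  proof -
    from that consider x where "x \<in> set l1" "(p, q) = hor x" | x where "x \<in> set l2" "(p, q) = prod.swap (hor x)"
      | x where "x \<in> set l3" "(p, q) = ver x" | x where "x \<in> set l4" "(p, q) = prod.swap (ver x)"
      unfolding es_def set_append set_map Un_iff image_iff o_def by blast
    then show ?thesis
    proof cases
      case (1 x)
      then show ?thesis using hseg[of x] l(1) by (metis UnI1 fst_conv snd_conv)
    next
      case (2 x)
      then have "p = snd (hor x)" "q = fst (hor x)" by (simp_all add: prod.swap_def)
      then show ?thesis using hseg[of x] l(3) 2(1) closed_segment_commute by (metis UnI2)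
    next
      case (3 x)
      then show ?thesis using vseg[of x] l(5) by (metis UnI2 fst_conv snd_conv)
    next
      case (4 x)
      then have "p = snd (ver x)" "q = fst (ver x)" by (simp_all add: prod.swap_def)
      then show ?thesis using vseg[of x] l(7) 4(1) closed_segment_commute by (metis UnI1)
    qed
  qed
  have segs: "open (- (\<Union>(p, q)\<in>set es. closed_segment p q))"
    by (intro open_Compl closed_UN) auto
  have interior: "chain_integral es (\<lambda>z. f z / (z - a)) = 2 * pi * \<i> * f a"
    if f: "f holomorphic_on U" and q0: "q0 \<in> Q" and a: "a \<in> gridint d q0"
      and off: "\<And>p q. (p, q) \<in> set es \<Longrightarrow> a \<notin> closed_segment p q" for f a q0
  proof -
    define h where "h z = f z / (z - a)" for z
    define H where "H q = contour_integral (linepath (fst (hor q)) (snd (hor q))) h" for q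
    define V where "V q = contour_integral (linepath (fst (ver q)) (snd (ver q))) h" for q
    \<comment> \<open>The right side is the integral over the boundary of \<open>q\<close>,
      regrouped into differences between an index and its shift; it is nonzero at most for the
      square that contains \<open>a\<close>.\<close>
    have sq: "(if q = q0 then 2 * pi * \<i> * f a else 0) = (H q - H (up q)) - (V q - V (rt q))"
      if "q \<in> Q" for q
    proof -
      obtain i j where q: "q = (i, j)" by fastforce
      obtain k l where k: "q0 = (k, l)" by fastforce
      have hol: "f holomorphic_on gridsq d (i, j)"
        using f QU[OF \<open>q \<in> Q\<close>] q holomorphic_on_subset by blast
      have le: "Re (gridpt d i j) \<le> Re (gridpt d (i + 1) (j + 1))"
        "Im (gridpt d i j) \<le> Im (gridpt d (i + 1) (j + 1))"
        using d by (auto simp: gridpt_def distrib_left)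
      have img: "path_image (rectpath (gridpt d i j) (gridpt d (i + 1) (j + 1))) \<subseteq> gridsq d (i, j) - {a}"
      proof -
        have "a \<notin> path_image (rectpath (gridpt d i j) (gridpt d (i + 1) (j + 1)))"
        proof (cases "a \<in> gridsq d (i, j)")
          case True
          then have "(i, j) = (k, l)"
            using gridint_eq d(1) a k by blast
          then have "a \<in> box (gridpt d i j) (gridpt d (i + 1) (j + 1))"
            using a k by (simp add: gridint_def)
          then show ?thesis
            using path_image_rectpath_inter_box[OF le] by blast
        next
          case False
          then show ?thesis
            using path_image_rectpath_subset_cbox[OF le] by (auto simp: gridsq_def)
        qed
        then show ?thesis
          using path_image_rectpath_subset_cbox[OF le] by (auto simp: gridsq_def)
      qed
      have "continuous_on (gridsq d (i, j) - {a}) h"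
        unfolding h_def using holomorphic_on_imp_continuous_on[OF hol]
        by (auto intro!: continuous_intros elim: continuous_on_subset)
      then have "continuous_on (path_image (rectpath (gridpt d i j) (gridpt d (i + 1) (j + 1)))) h"
        using img continuous_on_subset by blast
      from contour_integral_gridsq_edges[OF this d(1)]
        contour_integral_gridsq[OF d(1) hol a[unfolded k], folded h_def]
      show ?thesis
        by (simp add: H_def V_def hor_def ver_def up_def rt_def q k)
    qed
    have h: "continuous_on (closed_segment p q) h" if "closed_segment p q \<subseteq> U - K" "a \<notin> closed_segment p q" for p q
      unfolding h_def using holomorphic_on_imp_continuous_on[OF f] that
      by (auto intro!: continuous_intros elim: continuous_on_subset)
    have mem2: "prod.swap (hor q) \<in> set es" if "q \<in> set l2" for q using that by (auto simp: es_def)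
    have mem4: "prod.swap (ver q) \<in> set es" if "q \<in> set l4" for q using that by (auto simp: es_def)
    have swap2: "contour_integral (linepath (snd (hor q)) (fst (hor q))) h = - H q" if "q \<in> set l2" for q
    proof -
      have "(snd (hor q), fst (hor q)) \<in> set es"
        using mem2[OF that] by (simp add: prod.swap_def)
      then show ?thesis
        unfolding H_def using contour_integral_reverse_linepath h off seg by blast
    qed
    have swap4: "contour_integral (linepath (snd (ver q)) (fst (ver q))) h = - V q" if "q \<in> set l4" for q
    proof -
      have "(snd (ver q), fst (ver q)) \<in> set es"
        using mem4[OF that] by (simp add: prod.swap_def)
      then show ?thesis
        unfolding V_def using contour_integral_reverse_linepath h off seg by blast
    qed
    have "chain_integral es h = (\<Sum>q\<in>set l1. H q) + (\<Sum>q\<in>set l2. - H q) + ((\<Sum>q\<in>set l3. V q) + (\<Sum>q\<in>set l4. - V q))"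
      unfolding chain_integral_def es_def
      by (simp add: o_def case_prod_unfold sum_list_distinct_conv_sum_set l(2,4,6,8) swap2 swap4
          H_def[symmetric] V_def[symmetric] cong: sum.cong)
    also have "\<dots> = (\<Sum>q\<in>Q. H q - H (up q)) - (\<Sum>q\<in>Q. V q - V (rt q))"
      unfolding sum_diff_image[OF fin inj(1)] sum_diff_image[OF fin inj(2)] l
      by (simp add: sum_negf)
    also have "\<dots> = (\<Sum>q\<in>Q. if q = q0 then 2 * pi * \<i> * f a else 0)"
      by (simp add: sq sum_subtractf cong: sum.cong)
    also have "\<dots> = 2 * pi * \<i> * f a"
      using fin q0 by simp
    finally show ?thesis
      unfolding h_def[abs_def] .
  qed
  have "chain_integral es (\<lambda>z. f z / (z - a)) = 2 * pi * \<i> * f a"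
    if f: "f holomorphic_on U" and a: "a \<in> K" for f a
  proof -
    \<comment> \<open>The defect in Cauchy's formula. It is continuous at \<open>a\<close>, since
      \<open>a\<close> lies off the chain, and it vanishes along a sequence in an open cell that
      converges to \<open>a\<close>.\<close>
    define G where "G w = chain_integral es (\<lambda>z. f z / (z - w)) - 2 * pi * \<i> * f w" for w
    obtain i j where ij: "a \<in> gridsq d (i, j)" "(i, j) \<in> Q"
      using in_gridsq_floor[OF d(1), of a] a by (auto simp: Q_def)
    have aseg: "a \<notin> closed_segment p q" if "(p, q) \<in> set es" for p q
      using seg[OF that] a by blast
    have "isCont (\<lambda>w. contour_integral (linepath p q) (\<lambda>z. f z / (z - w))) a" if "(p, q) \<in> set es" for p q
    proof -
      have "continuous_on (closed_segment p q) f"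
        using seg[OF that] holomorphic_on_imp_continuous_on[OF f] continuous_on_subset by blast
      from contour_integral_linepath_deriv[OF this aseg[OF that], of 0] show ?thesis
        using DERIV_isCont by fastforce
    qed
    then have "isCont (\<lambda>w. chain_integral es (\<lambda>z. f z / (z - w))) a"
      unfolding chain_integral_sum_nth by (intro continuous_intros) auto
    moreover have "isCont f a"
      using f U KU a holomorphic_on_imp_continuous_on continuous_on_eq_continuous_at by blast
    ultimately have G: "isCont G a"
      unfolding G_def by (intro continuous_intros)
    have "a \<in> closure (gridint d (i, j))"
      using ij(1) closure_gridint[OF d(1)] by simp
    then obtain x where x: "\<And>n. x n \<in> gridint d (i, j)" "x \<longlonglongrightarrow> a"
      unfolding closure_sequential by blast
    have "\<forall>\<^sub>F n in sequentially. x n \<in> - (\<Union>(p, q)\<in>set es. closed_segment p q)"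
      using topological_tendstoD[OF x(2) segs] aseg by auto
    then have "\<forall>\<^sub>F n in sequentially. G (x n) = 0"
    proof eventually_elim
      case (elim n)
      then show ?case
        using interior[OF f ij(2) x(1)[of n]] by (auto simp: G_def)
    qed
    moreover have "(\<lambda>n. G (x n)) \<longlonglongrightarrow> G a"
      using isCont_tendsto_compose[OF G x(2)] .
    ultimately have "G a = 0"
      using LIMSEQ_unique[OF _ tendsto_eventually] by blast
    then show ?thesis
      by (simp add: G_def)
  qed
  then show ?thesis
    using seg by blast
qed

section \<open>Cauchy kernels in two variables\<close>

lemma chain_integral_mult_right:
  assumes "\<And>p q. (p, q) \<in> set es \<Longrightarrow> continuous_on (closed_segment p q) f"
  shows "chain_integral es (\<lambda>z. c * f z) = c * chain_integral es f"
proof -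
  have "contour_integral (linepath p q) (\<lambda>z. c * f z) = c * contour_integral (linepath p q) f"
    if "(p, q) \<in> set es" for p q
    using contour_integrable_continuous_linepath[OF assms[OF that]]
    by (rule contour_integral_lmul)
  then show ?thesis
    unfolding chain_integral_def sum_list_const_mult[symmetric]
    by (intro arg_cong[of _ _ sum_list] map_cong) auto
qed

lemma chain_integral_cong:
  assumes "\<And>p q z. (p, q) \<in> set es \<Longrightarrow> z \<in> closed_segment p q \<Longrightarrow> f z = g z"
  shows "chain_integral es f = chain_integral es g"
  unfolding chain_integral_def
  by (intro arg_cong[of _ _ sum_list] map_cong) (auto intro!: contour_integral_cong assms)

lemma continuous_on_linepath_compose [continuous_intros]:
  "continuous_on S f \<Longrightarrow> continuous_on S (\<lambda>x. linepath p q (f x))"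
  unfolding linepath_def by (intro continuous_intros)

lemma continuous_on_contour_integral_param:
  assumes "continuous_on (S \<times> closed_segment p q) (\<lambda>(z, w). h z w)"
  shows "continuous_on S (\<lambda>z. contour_integral (linepath p q) (h z))"
proof -
  have "continuous_on (S \<times> cbox 0 1) (\<lambda>x. (\<lambda>(z, w). h z w) (fst x, linepath p q (snd x)))"
    by (rule continuous_on_compose2[OF assms])
      (auto intro!: continuous_intros simp: linepath_in_path)
  then have "continuous_on S (\<lambda>z. integral (cbox 0 1) (\<lambda>t. h z (linepath p q t) * (q - p)))"
    by (intro integral_continuous_on_param) (auto intro!: continuous_intros simp: case_prod_unfold)
  then show ?thesis
    by (simp add: contour_integral_integral)
qed

lemma chain_integral_swap:
  assumes "\<And>p q r s. (p, q) \<in> set es1 \<Longrightarrow> (r, s) \<in> set es2 \<Longrightarrow>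
    continuous_on (closed_segment p q \<times> closed_segment r s) (\<lambda>(z, w). h z w)"
  shows "chain_integral es1 (\<lambda>z. chain_integral es2 (h z)) =
    chain_integral es2 (\<lambda>w. chain_integral es1 (\<lambda>z. h z w))"
proof -
  have nth: "(fst (es ! i), snd (es ! i)) \<in> set es" if "i < length es" for es :: "(complex \<times> complex) list" and i
    using that by simp
  note cont = assms[OF nth nth]
  have swap: "contour_integral (linepath (fst (es1 ! i)) (snd (es1 ! i)))
        (\<lambda>z. contour_integral (linepath (fst (es2 ! j)) (snd (es2 ! j))) (h z)) =
      contour_integral (linepath (fst (es2 ! j)) (snd (es2 ! j)))
        (\<lambda>w. contour_integral (linepath (fst (es1 ! i)) (snd (es1 ! i))) (\<lambda>z. h z w))"
    if "i < length es1" "j < length es2" for i j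
    by (rule contour_integral_swap) (use cont that in auto)
  have int1: "(\<lambda>z. contour_integral (linepath (fst (es2 ! j)) (snd (es2 ! j))) (h z)) contour_integrable_on
      linepath (fst (es1 ! i)) (snd (es1 ! i))"
    if "i < length es1" "j < length es2" for i j
    by (intro contour_integrable_continuous_linepath continuous_on_contour_integral_param cont that)
  have int2: "(\<lambda>w. contour_integral (linepath (fst (es1 ! i)) (snd (es1 ! i))) (\<lambda>z. h z w)) contour_integrable_on
      linepath (fst (es2 ! j)) (snd (es2 ! j))"
    if "i < length es1" "j < length es2" for i j
  proof (intro contour_integrable_continuous_linepath continuous_on_contour_integral_param)
    have "continuous_on (closed_segment (fst (es2 ! j)) (snd (es2 ! j)) \<times> closed_segment (fst (es1 ! i)) (snd (es1 ! i)))
        (\<lambda>x. (\<lambda>(z, w). h z w) (snd x, fst x))"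
      by (rule continuous_on_compose2[OF cont[OF that]]) (auto intro!: continuous_intros)
    then show "continuous_on (closed_segment (fst (es2 ! j)) (snd (es2 ! j)) \<times> closed_segment (fst (es1 ! i)) (snd (es1 ! i)))
        (\<lambda>(w, z). h z w)"
      by (simp add: case_prod_unfold)
  qed
  have "chain_integral es1 (\<lambda>z. chain_integral es2 (h z)) = (\<Sum>i<length es1. \<Sum>j<length es2.
      contour_integral (linepath (fst (es1 ! i)) (snd (es1 ! i)))
        (\<lambda>z. contour_integral (linepath (fst (es2 ! j)) (snd (es2 ! j))) (h z)))"
    unfolding chain_integral_sum_nth by (intro sum.cong refl contour_integral_sum) (auto intro: int1)
  also have "\<dots> = (\<Sum>j<length es2. \<Sum>i<length es1. contour_integral (linepath (fst (es2 ! j)) (snd (es2 ! j)))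
        (\<lambda>w. contour_integral (linepath (fst (es1 ! i)) (snd (es1 ! i))) (\<lambda>z. h z w)))"
    by (subst sum.swap) (auto simp: swap intro!: sum.cong)
  also have "\<dots> = chain_integral es2 (\<lambda>w. chain_integral es1 (\<lambda>z. h z w))"
    unfolding chain_integral_sum_nth
    by (intro sum.cong refl contour_integral_sum[symmetric]) (auto intro: int2)
  finally show ?thesis .
qed

text \<open>Induction on the order. The formula for \<open>g\<close> is assumed on an open set so
  that the derivative of order \<open>k\<close> is known near \<open>b\<close>, not just at
  \<open>b\<close>, and can be differentiated again.\<close>

lemma higher_deriv_chain_integral:
  assumes f: "\<And>p q. (p, q) \<in> set es \<Longrightarrow> continuous_on (closed_segment p q) f"
    and V: "open V" "\<And>p q. (p, q) \<in> set es \<Longrightarrow> closed_segment p q \<inter> V = {}"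
    and g: "\<And>w. w \<in> V \<Longrightarrow> g w = c * chain_integral es (\<lambda>u. f u / (u - w))"
    and b: "b \<in> V"
  shows "(deriv ^^ q) g b = c * fact q * chain_integral es (\<lambda>u. f u / (u - b) ^ Suc q)"
  using b
proof (induction q arbitrary: b)
  case 0
  then show ?case
    by (simp add: g)
next
  case (Suc k)
  have "((\<lambda>w. chain_integral es (\<lambda>u. f u / (u - w) ^ Suc k)) has_field_derivative
      of_nat (Suc k) * chain_integral es (\<lambda>u. f u / (u - b) ^ Suc (Suc k))) (at b)"
  proof -
    have "((\<lambda>w. contour_integral (linepath (fst e) (snd e)) (\<lambda>u. f u / (u - w) ^ Suc k)) has_field_derivative
        of_nat (Suc k) * contour_integral (linepath (fst e) (snd e)) (\<lambda>u. f u / (u - b) ^ Suc (Suc k))) (at b)"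
      if "e \<in> set es" for e
      using contour_integral_linepath_deriv[of "fst e" "snd e" f b k] f[of "fst e" "snd e"] V(2)[of "fst e" "snd e"] Suc.prems that
      by (auto simp del: power_Suc)
    then show ?thesis
      unfolding chain_integral_sum_nth sum_distrib_left
      by (intro DERIV_sum) (auto simp del: power_Suc)
  qed
  then have "((\<lambda>w. c * fact k * chain_integral es (\<lambda>u. f u / (u - w) ^ Suc k)) has_field_derivative
      c * fact k * (of_nat (Suc k) * chain_integral es (\<lambda>u. f u / (u - b) ^ Suc (Suc k)))) (at b)"
    by (rule DERIV_cmult)
  moreover have "\<forall>\<^sub>F w in nhds b. (deriv ^^ k) g w = c * fact k * chain_integral es (\<lambda>u. f u / (u - w) ^ Suc k)"
    using eventually_nhds_in_open[OF V(1) Suc.prems] by eventually_elim (rule Suc.IH)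
  ultimately have "deriv ((deriv ^^ k) g) b =
      c * fact k * (of_nat (Suc k) * chain_integral es (\<lambda>u. f u / (u - b) ^ Suc (Suc k)))"
    by (subst deriv_cong_ev[OF _ refl]) (auto intro!: DERIV_imp_deriv simp del: power_Suc)
  then show ?case
    by (simp add: algebra_simps)
qed

text \<open>One finite family of paths and weights yields the Taylor coefficients of
  \<open>\<beta>\<close> of all orders at all points of \<open>V1 \<times> V2\<close>; this matters
  because the summation bounds \<open>m\<close> vary with the point. The weight \<open>g\<close>
  absorbs \<open>\<beta>\<close>, the velocities of the paths and \<open>(2\<pi>\<i>)^-2\<close>.
  Integration over the unit square makes the formula usable for operator-valued integrands.\<close>

definition cauchy_kernel ::
  "'i set \<Rightarrow> ('i \<Rightarrow> real \<Rightarrow> complex) \<Rightarrow> ('i \<Rightarrow> real \<Rightarrow> complex) \<Rightarrow> ('i \<Rightarrow> real \<times> real \<Rightarrow> complex) \<Rightarrow>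
    complex set \<Rightarrow> complex set \<Rightarrow> (complex \<times> complex \<Rightarrow> complex) \<Rightarrow> bool"
  where "cauchy_kernel I p r g V1 V2 \<beta> \<longleftrightarrow> finite I \<and>
    (\<forall>i\<in>I. continuous_on {0..1} (p i) \<and> continuous_on {0..1} (r i) \<and>
       continuous_on (cbox (0, 0) (1, 1)) (g i) \<and>
       p i ` {0..1} \<inter> V1 = {} \<and> r i ` {0..1} \<inter> V2 = {}) \<and>
    (\<forall>a\<in>V1. \<forall>b\<in>V2. \<forall>q1 q2. partial_deriv q1 q2 \<beta> (a, b) / (fact q1 * fact q2) =
       (\<Sum>i\<in>I. integral (cbox (0, 0) (1, 1))
          (\<lambda>x. g i x / ((p i (fst x) - a) ^ Suc q1 * (r i (snd x) - b) ^ Suc q2))))"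

text \<open>Fubini on the unit square; \<open>q - p\<close> and \<open>s - r\<close> are the
  constant velocities of the two segments.\<close>

lemma contour_integral_iterated_box:
  assumes "continuous_on (closed_segment p q \<times> closed_segment r s) (\<lambda>(z, w). h z w)"
  shows "contour_integral (linepath p q) (\<lambda>z. contour_integral (linepath r s) (h z)) =
    integral (cbox (0, 0) (1, 1))
      (\<lambda>x. (q - p) * (s - r) * h (linepath p q (fst x)) (linepath r s (snd x)))"
proof -
  have "continuous_on (cbox (0, 0) (1::real, 1::real)) (\<lambda>x. (\<lambda>(z, w). h z w) (linepath p q (fst x), linepath r s (snd x)))"
    by (rule continuous_on_compose2[OF assms])
      (auto intro!: continuous_intros simp: linepath_in_path)
  then have "continuous_on (cbox (0, 0) (1::real, 1::real)) (\<lambda>x. (q - p) * (s - r) * h (linepath p q (fst x)) (linepath r s (snd x)))"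
    by (auto intro!: continuous_intros)
  from integral_prod_continuous[OF this] show ?thesis
    by (simp add: contour_integral_integral mult.assoc mult.left_commute
        flip: integral_mult_right integral_mult_left) (simp add: mult_ac)
qed

text \<open>Cauchy's formula is applied in each variable, along cycles in \<open>U1 - K1\<close> and
  \<open>U2 - K2\<close>. The compact sets keep the cycles away from \<open>V1\<close> and
  \<open>V2\<close>, which are open so that derivatives can be taken there.\<close>

lemma cauchy_kernel_exists:
  assumes K: "compact K1" "compact K2" and V: "open V1" "open V2" "V1 \<subseteq> K1" "V2 \<subseteq> K2"
    and U: "open U1" "open U2" "K1 \<subseteq> U1" "K2 \<subseteq> U2"
    and cont: "continuous_on (U1 \<times> U2) \<beta>"
    and hol1: "\<And>w. w \<in> U2 \<Longrightarrow> (\<lambda>z. \<beta> (z, w)) holomorphic_on U1"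
    and hol2: "\<And>z. z \<in> U1 \<Longrightarrow> (\<lambda>w. \<beta> (z, w)) holomorphic_on U2"
  shows "\<exists>(I :: (nat \<times> nat) set) p r g. cauchy_kernel I p r g V1 V2 \<beta>"
proof -
  obtain es1 where es1: "\<And>p q. (p, q) \<in> set es1 \<Longrightarrow> closed_segment p q \<subseteq> U1 - K1"
    and cauchy1: "\<And>f a. f holomorphic_on U1 \<Longrightarrow> a \<in> K1 \<Longrightarrow>
       chain_integral es1 (\<lambda>z. f z / (z - a)) = 2 * pi * \<i> * f a"
    using cauchy_chain_exists[OF K(1) U(1,3)] by blast
  obtain es2 where es2: "\<And>p q. (p, q) \<in> set es2 \<Longrightarrow> closed_segment p q \<subseteq> U2 - K2"
    and cauchy2: "\<And>f a. f holomorphic_on U2 \<Longrightarrow> a \<in> K2 \<Longrightarrow>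
       chain_integral es2 (\<lambda>z. f z / (z - a)) = 2 * pi * \<i> * f a"
    using cauchy_chain_exists[OF K(2) U(2,4)] by blast
  define c where "c = 1 / (2 * complex_of_real pi * \<i>)"
  have c: "c * (2 * complex_of_real pi * \<i>) = 1"
    by (simp add: c_def)
  have formula: "partial_deriv q1 q2 \<beta> (a, b) / (fact q1 * fact q2) =
      c * c * chain_integral es1 (\<lambda>z. chain_integral es2 (\<lambda>w. \<beta> (z, w) / ((z - a) ^ Suc q1 * (w - b) ^ Suc q2)))"
    if a: "a \<in> V1" and b: "b \<in> V2" for a b q1 q2
  proof -
    \<comment> \<open>Up to the factor \<open>c * fact q2\<close>, this is the derivative of order
      \<open>q2\<close> in the second variable at \<open>b\<close>, as a function of the first
      variable on \<open>U1\<close>.\<close>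
    define \<Phi> where "\<Phi> z = chain_integral es2 (\<lambda>w. \<beta> (z, w) / (w - b) ^ Suc q2)" for z
    have bseg: "w - b \<noteq> 0" if "w \<in> closed_segment r s" "(r, s) \<in> set es2" for w r s
      using es2[OF that(2)] that(1) b V by auto
    have contb: "continuous_on (U1 \<times> closed_segment r s) (\<lambda>(z, w). \<beta> (z, w) / (w - b) ^ Suc q2)"
      if "(r, s) \<in> set es2" for r s
    proof -
      have "continuous_on (U1 \<times> closed_segment r s) \<beta>"
        using es2[OF that] by (intro continuous_on_subset[OF cont]) auto
      then show ?thesis
        using bseg[OF _ that] by (auto simp: case_prod_unfold intro!: continuous_intros)
    qed
    have \<Phi>cont: "continuous_on U1 \<Phi>"
      unfolding \<Phi>_def chain_integral_sum_nth
      by (intro continuous_on_sum continuous_on_contour_integral_param contb) auto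
    have inner: "(deriv ^^ q2) (\<lambda>w2. \<beta> (w1, w2)) b = c * fact q2 * \<Phi> w1" if w1: "w1 \<in> U1" for w1
      unfolding \<Phi>_def
    proof (rule higher_deriv_chain_integral[OF _ V(2) _ _ b])
      show "continuous_on (closed_segment p q) (\<lambda>w. \<beta> (w1, w))" if "(p, q) \<in> set es2" for p q
        using holomorphic_on_imp_continuous_on[OF hol2[OF w1]] es2[OF that] continuous_on_subset by blast
      show "\<beta> (w1, w) = c * chain_integral es2 (\<lambda>u. \<beta> (w1, u) / (u - w))" if "w \<in> V2" for w
      proof -
        have "w \<in> K2" using that V(4) by blast
        from cauchy2[OF hol2[OF w1] this] show ?thesis
          using c by (simp add: mult.assoc[symmetric])
      qed
    qed (use es2 V(4) in blast)
    \<comment> \<open>Cauchy's formula for \<open>\<Phi>\<close>, reached without holomorphy of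
      \<open>\<Phi>\<close>: for each \<open>w\<close> on \<open>es2\<close>,
      \<open>\<beta> (w1, w)\<close> is represented along \<open>es1\<close>, and then the two
      chains are exchanged.\<close>
    have swapped: "\<Phi> w1 = c * chain_integral es1 (\<lambda>z. \<Phi> z / (z - w1))" if w1: "w1 \<in> V1" for w1
    proof -
      have w1seg: "z - w1 \<noteq> 0" if "z \<in> closed_segment p q" "(p, q) \<in> set es1" for z p q
        using es1[OF that(2)] that(1) w1 V by auto
      have cont2: "continuous_on (closed_segment p q \<times> closed_segment r s)
          (\<lambda>(z, w). \<beta> (z, w) / (z - w1) / (w - b) ^ Suc q2)"
        if "(p, q) \<in> set es1" "(r, s) \<in> set es2" for p q r s
      proof -
        have "continuous_on (closed_segment p q \<times> closed_segment r s) \<beta>"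
          using es1[OF that(1)] es2[OF that(2)] by (intro continuous_on_subset[OF cont]) auto
        then show ?thesis
          using bseg[OF _ that(2)] w1seg[OF _ that(1)]
          by (auto simp: case_prod_unfold intro!: continuous_intros)
      qed
      have "\<beta> (w1, w) = c * chain_integral es1 (\<lambda>z. \<beta> (z, w) / (z - w1))" if "w \<in> U2" for w
      proof -
        have "w1 \<in> K1" using w1 V(3) by blast
        from cauchy1[OF hol1[OF that] this] show ?thesis
          using c by (simp add: mult.assoc[symmetric])
      qed
      then have "\<Phi> w1 = chain_integral es2 (\<lambda>w. c * (chain_integral es1 (\<lambda>z. \<beta> (z, w) / (z - w1)) / (w - b) ^ Suc q2))"
        unfolding \<Phi>_def using es2 by (intro chain_integral_cong) force
      also have "\<dots> = chain_integral es2 (\<lambda>w. c * chain_integral es1 (\<lambda>z. \<beta> (z, w) / (z - w1) / (w - b) ^ Suc q2))"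
      proof (intro chain_integral_cong arg_cong[of _ _ "\<lambda>x. c * x"])
        fix r s w assume rs: "(r, s) \<in> set es2" "w \<in> closed_segment r s"
        have "chain_integral es1 (\<lambda>z. 1 / (w - b) ^ Suc q2 * (\<beta> (z, w) / (z - w1))) =
            1 / (w - b) ^ Suc q2 * chain_integral es1 (\<lambda>z. \<beta> (z, w) / (z - w1))"
        proof (rule chain_integral_mult_right)
          fix p q assume pq: "(p, q) \<in> set es1"
          have "w \<in> U2" using es2 rs by blast
          then have "continuous_on (closed_segment p q) (\<lambda>z. \<beta> (z, w))"
            using holomorphic_on_imp_continuous_on[OF hol1] es1[OF pq] continuous_on_subset by blast
          then show "continuous_on (closed_segment p q) (\<lambda>z. \<beta> (z, w) / (z - w1))"
            using w1seg[OF _ pq] by (auto intro!: continuous_intros)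
        qed
        then show "chain_integral es1 (\<lambda>z. \<beta> (z, w) / (z - w1)) / (w - b) ^ Suc q2 =
            chain_integral es1 (\<lambda>z. \<beta> (z, w) / (z - w1) / (w - b) ^ Suc q2)"
          by (simp add: mult_ac)
      qed
      also have "\<dots> = c * chain_integral es2 (\<lambda>w. chain_integral es1 (\<lambda>z. \<beta> (z, w) / (z - w1) / (w - b) ^ Suc q2))"
      proof (rule chain_integral_mult_right)
        fix r s assume rs: "(r, s) \<in> set es2"
        have "continuous_on (closed_segment r s \<times> closed_segment p q)
            (\<lambda>(w, z). \<beta> (z, w) / (z - w1) / (w - b) ^ Suc q2)" if "(p, q) \<in> set es1" for p q
        proof -
          have "continuous_on (closed_segment r s \<times> closed_segment p q)
            (\<lambda>x. (\<lambda>(z, w). \<beta> (z, w) / (z - w1) / (w - b) ^ Suc q2) (snd x, fst x))"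
            by (rule continuous_on_compose2[OF cont2[OF that rs]]) (auto intro!: continuous_intros)
          then show ?thesis by (simp add: case_prod_unfold)
        qed
        then show "continuous_on (closed_segment r s) (\<lambda>w. chain_integral es1 (\<lambda>z. \<beta> (z, w) / (z - w1) / (w - b) ^ Suc q2))"
          unfolding chain_integral_sum_nth
          by (intro continuous_on_sum continuous_on_contour_integral_param) auto
      qed
      also have "\<dots> = c * chain_integral es1 (\<lambda>z. chain_integral es2 (\<lambda>w. \<beta> (z, w) / (z - w1) / (w - b) ^ Suc q2))"
        using chain_integral_swap[of es1 es2 "\<lambda>z w. \<beta> (z, w) / (z - w1) / (w - b) ^ Suc q2"] cont2 by simp
      also have "\<dots> = c * chain_integral es1 (\<lambda>z. \<Phi> z / (z - w1))"
      proof (intro chain_integral_cong arg_cong[of _ _ "\<lambda>x. c * x"])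
        fix p q z assume pq: "(p, q) \<in> set es1" "z \<in> closed_segment p q"
        have "z \<in> U1" using es1 pq by blast
        have "chain_integral es2 (\<lambda>w. 1 / (z - w1) * (\<beta> (z, w) / (w - b) ^ Suc q2)) = 1 / (z - w1) * \<Phi> z"
          unfolding \<Phi>_def
        proof (rule chain_integral_mult_right)
          fix r s assume rs: "(r, s) \<in> set es2"
          then have "continuous_on (closed_segment r s) (\<lambda>w. \<beta> (z, w))"
            using holomorphic_on_imp_continuous_on[OF hol2[OF \<open>z \<in> U1\<close>]] es2[OF rs] continuous_on_subset by blast
          then show "continuous_on (closed_segment r s) (\<lambda>w. \<beta> (z, w) / (w - b) ^ Suc q2)"
            using bseg[OF _ rs] by (auto intro!: continuous_intros)
        qed
        then show "chain_integral es2 (\<lambda>w. \<beta> (z, w) / (z - w1) / (w - b) ^ Suc q2) = \<Phi> z / (z - w1)"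
          by (simp add: mult.commute)
      qed
      finally show ?thesis .
    qed
    have "(deriv ^^ q1) (\<lambda>w1. (deriv ^^ q2) (\<lambda>w2. \<beta> (w1, w2)) b) a =
        (c * c * fact q2) * fact q1 * chain_integral es1 (\<lambda>z. \<Phi> z / (z - a) ^ Suc q1)"
    proof (rule higher_deriv_chain_integral[OF _ V(1) _ _ a])
      show "continuous_on (closed_segment p q) \<Phi>" if "(p, q) \<in> set es1" for p q
        using \<Phi>cont es1[OF that] continuous_on_subset by blast
      show "(deriv ^^ q2) (\<lambda>w2. \<beta> (w1, w2)) b = c * c * fact q2 * chain_integral es1 (\<lambda>u. \<Phi> u / (u - w1))"
        if "w1 \<in> V1" for w1
      proof -
        have "w1 \<in> U1" using that V(3) U(3) by blast
        then show ?thesis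
          unfolding inner[OF \<open>w1 \<in> U1\<close>] using swapped[OF that] by simp
      qed
    qed (use es1 V(3) in blast)
    moreover have "chain_integral es1 (\<lambda>z. \<Phi> z / (z - a) ^ Suc q1) =
      chain_integral es1 (\<lambda>z. chain_integral es2 (\<lambda>w. \<beta> (z, w) / ((z - a) ^ Suc q1 * (w - b) ^ Suc q2)))"
    proof (rule chain_integral_cong)
      fix p q z assume pq: "(p, q) \<in> set es1" "z \<in> closed_segment p q"
      have "z \<in> U1" using es1 pq by blast
      have "chain_integral es2 (\<lambda>w. 1 / (z - a) ^ Suc q1 * (\<beta> (z, w) / (w - b) ^ Suc q2)) = 1 / (z - a) ^ Suc q1 * \<Phi> z"
        unfolding \<Phi>_def
      proof (rule chain_integral_mult_right)
        fix r s assume rs: "(r, s) \<in> set es2"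
        then have "continuous_on (closed_segment r s) (\<lambda>w. \<beta> (z, w))"
          using holomorphic_on_imp_continuous_on[OF hol2[OF \<open>z \<in> U1\<close>]] es2[OF rs] continuous_on_subset by blast
        then show "continuous_on (closed_segment r s) (\<lambda>w. \<beta> (z, w) / (w - b) ^ Suc q2)"
          using bseg[OF _ rs] by (auto intro!: continuous_intros)
      qed
      then show "\<Phi> z / (z - a) ^ Suc q1 = chain_integral es2 (\<lambda>w. \<beta> (z, w) / ((z - a) ^ Suc q1 * (w - b) ^ Suc q2))"
        by simp
    qed
    ultimately show ?thesis
      by (simp add: partial_deriv_def)
  qed
  define I where "I = {..<length es1} \<times> {..<length es2}"
  define P where "P i = linepath (fst (es1 ! fst i)) (snd (es1 ! fst i))" for i :: "nat \<times> nat"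
  define R where "R i = linepath (fst (es2 ! snd i)) (snd (es2 ! snd i))" for i :: "nat \<times> nat"
  define g where "g i x = c * c * (snd (es1 ! fst i) - fst (es1 ! fst i)) * (snd (es2 ! snd i) - fst (es2 ! snd i)) *
    \<beta> (P i (fst x), R i (snd x))" for i and x :: "real \<times> real"
  have P: "P i t \<in> U1 - K1" if "i \<in> I" "t \<in> {0..1}" for i t
  proof -
    have "P i t \<in> closed_segment (fst (es1 ! fst i)) (snd (es1 ! fst i))"
      unfolding P_def using that(2) by (simp add: linepath_in_path)
    then show ?thesis
      using es1[of "fst (es1 ! fst i)" "snd (es1 ! fst i)"] that(1) by (auto simp: I_def)
  qed
  have R: "R i t \<in> U2 - K2" if "i \<in> I" "t \<in> {0..1}" for i t
  proof -
    have "R i t \<in> closed_segment (fst (es2 ! snd i)) (snd (es2 ! snd i))"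
      unfolding R_def using that(2) by (simp add: linepath_in_path)
    then show ?thesis
      using es2[of "fst (es2 ! snd i)" "snd (es2 ! snd i)"] that(1) by (auto simp: I_def)
  qed
  have "continuous_on (cbox (0, 0) (1, 1)) (g i)" if "i \<in> I" for i
  proof -
    have "continuous_on (cbox (0, 0) (1, 1)) (\<lambda>x. \<beta> (P i (fst x), R i (snd x)))"
      by (rule continuous_on_compose2[OF cont])
        (use P[OF that] R[OF that] in \<open>auto simp: P_def R_def intro!: continuous_intros\<close>)
    then show ?thesis
      unfolding g_def by (intro continuous_intros)
  qed
  moreover have "partial_deriv q1 q2 \<beta> (a, b) / (fact q1 * fact q2) =
       (\<Sum>i\<in>I. integral (cbox (0, 0) (1, 1))
          (\<lambda>x. g i x / ((P i (fst x) - a) ^ Suc q1 * (R i (snd x) - b) ^ Suc q2)))"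
    if a: "a \<in> V1" and b: "b \<in> V2" for a b q1 q2
  proof -
    define h where "h z w = \<beta> (z, w) / ((z - a) ^ Suc q1 * (w - b) ^ Suc q2)" for z w
    have hcont: "continuous_on ((U1 - K1) \<times> (U2 - K2)) (\<lambda>(z, w). h z w)"
    proof -
      have "continuous_on ((U1 - K1) \<times> (U2 - K2)) \<beta>"
        by (rule continuous_on_subset[OF cont]) auto
      then show ?thesis
        unfolding h_def using a b V by (auto simp: case_prod_unfold intro!: continuous_intros)
    qed
    have hseg: "continuous_on (closed_segment (fst (es1 ! i)) (snd (es1 ! i)) \<times>
        closed_segment (fst (es2 ! j)) (snd (es2 ! j))) (\<lambda>(z, w). h z w)"
      if "i < length es1" "j < length es2" for i j
      using es1[of "fst (es1 ! i)" "snd (es1 ! i)"] es2[of "fst (es2 ! j)" "snd (es2 ! j)"] that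
      by (intro continuous_on_subset[OF hcont]) auto
    have "partial_deriv q1 q2 \<beta> (a, b) / (fact q1 * fact q2) =
        c * c * (\<Sum>i<length es1. contour_integral (linepath (fst (es1 ! i)) (snd (es1 ! i)))
          (\<lambda>z. \<Sum>j<length es2. contour_integral (linepath (fst (es2 ! j)) (snd (es2 ! j))) (h z)))"
      unfolding formula[OF a b] chain_integral_sum_nth h_def ..
    also have "\<dots> = c * c * (\<Sum>i<length es1. \<Sum>j<length es2. contour_integral (linepath (fst (es1 ! i)) (snd (es1 ! i)))
          (\<lambda>z. contour_integral (linepath (fst (es2 ! j)) (snd (es2 ! j))) (h z)))"
      by (intro arg_cong[of _ _ "\<lambda>x. c * c * x"] sum.cong refl contour_integral_sum
          contour_integrable_continuous_linepath continuous_on_contour_integral_param hseg) auto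
    also have "\<dots> = (\<Sum>(i, j)\<in>I. c * c * contour_integral (linepath (fst (es1 ! i)) (snd (es1 ! i)))
          (\<lambda>z. contour_integral (linepath (fst (es2 ! j)) (snd (es2 ! j))) (h z)))"
      unfolding I_def sum.cartesian_product[symmetric] sum_distrib_left ..
    also have "\<dots> = (\<Sum>i\<in>I. integral (cbox (0, 0) (1, 1))
          (\<lambda>x. g i x / ((P i (fst x) - a) ^ Suc q1 * (R i (snd x) - b) ^ Suc q2)))"
    proof (rule sum.cong[OF refl], clarify)
      fix i j assume "(i, j) \<in> I"
      then have "i < length es1" "j < length es2" by (auto simp: I_def)
      note box = contour_integral_iterated_box[OF hseg[OF this]]
      have "g (i, j) x / ((P (i, j) (fst x) - a) ^ Suc q1 * (R (i, j) (snd x) - b) ^ Suc q2) =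
          c * c * ((snd (es1 ! i) - fst (es1 ! i)) * (snd (es2 ! j) - fst (es2 ! j)) *
            h (linepath (fst (es1 ! i)) (snd (es1 ! i)) (fst x)) (linepath (fst (es2 ! j)) (snd (es2 ! j)) (snd x)))" for x
        by (simp add: g_def P_def R_def h_def mult.assoc)
      then show "c * c * contour_integral (linepath (fst (es1 ! i)) (snd (es1 ! i)))
          (\<lambda>z. contour_integral (linepath (fst (es2 ! j)) (snd (es2 ! j))) (h z)) =
         integral (cbox (0, 0) (1, 1)) (\<lambda>x. g (i, j) x / ((P (i, j) (fst x) - a) ^ Suc q1 * (R (i, j) (snd x) - b) ^ Suc q2))"
        unfolding box by (simp only: integral_mult_right)
    qed
    finally show ?thesis .
  qed
  ultimately have "cauchy_kernel I P R g V1 V2 \<beta>"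
    unfolding cauchy_kernel_def using P R V(3,4)
    by (auto simp: I_def P_def R_def)
  then show ?thesis by blast
qed

section \<open>Resolvents\<close>

lemma blinfun_eq_iff: "f = g \<longleftrightarrow> (\<forall>x. blinfun_apply f x = blinfun_apply g x)"
  by (auto intro: blinfun_eqI)

interpretation blinfun_comp: bounded_bilinear "(o\<^sub>L) :: ('a::real_normed_vector \<Rightarrow>\<^sub>L 'b::real_normed_vector) \<Rightarrow> ('c::real_normed_vector \<Rightarrow>\<^sub>L 'a) \<Rightarrow> _"
  by (rule bounded_bilinear_blinfun_compose)

interpretation scaleC: bounded_bilinear "scaleC :: complex \<Rightarrow> 'a::complex_hilbert \<Rightarrow> 'a"
proof
  show "(r *\<^sub>R c) *\<^sub>C x = r *\<^sub>R (c *\<^sub>C x)" for r c and x :: 'a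
    by (metis scaleC_of_real scaleC_scaleC scaleR_conv_of_real)
  show "c *\<^sub>C (r *\<^sub>R x) = r *\<^sub>R (c *\<^sub>C x)" for r c and x :: 'a
    by (metis mult.commute scaleC_of_real scaleC_scaleC)
  show "\<exists>K. \<forall>c x. norm (c *\<^sub>C (x::'a)) \<le> cmod c * norm x * K"
    by (rule exI[of _ 1]) (simp add: norm_scaleC)
qed (simp_all add: scaleC_add_left scaleC_add_right)

lemma norm_scalar_op_le: "norm (scalar_op c :: 'a::complex_hilbert \<Rightarrow>\<^sub>L 'a) \<le> cmod c"
  by (rule norm_blinfun_bound) (simp_all add: scalar_op_apply norm_scaleC)

lemma bounded_linear_scalar_op: "bounded_linear (scalar_op :: complex \<Rightarrow> 'a::complex_hilbert \<Rightarrow>\<^sub>L 'a)"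
  by (rule bounded_linear_intro[where K = 1])
    (auto intro!: blinfun_eqI simp: scalar_op_apply scaleC.bilinear_simps blinfun.bilinear_simps norm_scalar_op_le)

lemmas scalar_op_diff = linear_diff[OF bounded_linear.linear[OF bounded_linear_scalar_op]]

lemma op_pow_0: "op_pow A 0 = id_blinfun"
  by (simp add: op_pow_def)

lemma op_pow_Suc: "op_pow A (Suc n) = A o\<^sub>L op_pow A n"
  by (simp add: op_pow_def)

lemma op_pow_Suc_right: "op_pow A (Suc n) = op_pow A n o\<^sub>L A"
  by (induction n) (auto simp: op_pow_0 op_pow_Suc blinfun_eq_iff)

lemma norm_op_pow_le: "norm (op_pow A n) \<le> norm A ^ n"
proof (induction n)
  case 0
  then show ?case
    by (simp add: op_pow_0 norm_blinfun_id_le)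
next
  case (Suc n)
  have "norm (A o\<^sub>L op_pow A n) \<le> norm A * norm (op_pow A n)"
    by (rule norm_blinfun_compose)
  also have "\<dots> \<le> norm A * norm A ^ n"
    using Suc.IH by (rule mult_left_mono) simp
  finally show ?case
    by (simp add: op_pow_Suc)
qed

lemma tendsto_op_pow: "(f \<longlongrightarrow> A) F \<Longrightarrow> ((\<lambda>x. op_pow (f x) n) \<longlongrightarrow> op_pow A n) F"
  by (induction n) (simp_all add: op_pow_0 op_pow_Suc blinfun_comp.tendsto)

text \<open>Banach-Steinhaus through Baire category: the closed sets \<open>F k\<close> cover a
  complete space, so one of them contains a ball, and every vector of length \<open>e\<close> is a
  difference of two points of that ball.\<close>

lemma uniform_boundedness:
  fixes f :: "nat \<Rightarrow> 'a::banach \<Rightarrow>\<^sub>L 'b::real_normed_vector"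
  assumes "\<And>x. \<exists>M. \<forall>n. norm (f n x) \<le> M"
  shows "\<exists>M. \<forall>n. norm (f n) \<le> M"
proof -
  define F where "F k = {x. \<forall>n. norm (f n x) \<le> real k}" for k
  have closed: "closed (F k)" for k
    unfolding F_def by (intro closed_Collect_all closed_Collect_le continuous_intros)
  have "x \<in> \<Union>(range F)" for x
  proof -
    obtain M where M: "\<And>n. norm (f n x) \<le> M" using assms by blast
    obtain k where "M \<le> real k" using real_arch_simple by blast
    then have "x \<in> F k" unfolding F_def using M order_trans by blast
    then show ?thesis by blast
  qed
  then have U: "\<Union>(range F) = UNIV" by blast
  have "\<exists>k. interior (F k) \<noteq> {}"
  proof (rule ccontr)
    assume "\<nexists>k. interior (F k) \<noteq> {}"
    then have "Met_TC.mtopology interior_of \<Union>(range F) = {}"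
      by (intro Met_TC.metric_Baire_category_alt) (auto simp: closed complete_UNIV)
    then show False
      unfolding U by simp
  qed
  then obtain k x where "x \<in> interior (F k)" by blast
  then obtain e where e: "e > 0" "cball x e \<subseteq> F k"
    using mem_interior_cball by blast
  have "norm (f n) \<le> 2 * real k / e" for n
  proof (rule norm_blinfun_bound)
    fix y
    show "norm (f n y) \<le> 2 * real k / e * norm y"
    proof (cases "y = 0")
      case False
      define u where "u = (e / norm y) *\<^sub>R y"
      have "x + u \<in> cball x e" "x \<in> cball x e"
        using e(1) False by (auto simp: u_def dist_norm)
      then have "norm (f n (x + u)) \<le> k" "norm (f n x) \<le> k"
        using e(2) unfolding F_def by blast+
      moreover have "f n u = f n (x + u) - f n x"
        by (simp add: blinfun.bilinear_simps)
      ultimately have "norm (f n u) \<le> 2 * real k"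
        using norm_triangle_ineq4[of "f n (x + u)" "f n x"] by simp
      then show ?thesis
        using e(1) False by (simp add: u_def blinfun.bilinear_simps field_simps)
    qed (simp add: blinfun.bilinear_simps)
  qed (use e(1) in auto)
  then show ?thesis by blast
qed

section \<open>Inverses and their stability under perturbation\<close>

definition op_inverse :: "('a::real_normed_vector \<Rightarrow>\<^sub>L 'a) \<Rightarrow> ('a \<Rightarrow>\<^sub>L 'a) \<Rightarrow> bool"
  where "op_inverse A B \<longleftrightarrow> A o\<^sub>L B = id_blinfun \<and> B o\<^sub>L A = id_blinfun"

lemma op_inverse_unique: "op_inverse A B \<Longrightarrow> op_inverse A C \<Longrightarrow> B = C"
  unfolding op_inverse_def blinfun_eq_iff by auto metis

text \<open>The powers of \<open>A\<close> are dominated by the geometric series of ratio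
  \<open>1 / 2\<close>, whose sum is the bound \<open>2\<close>.\<close>

lemma neumann_series:
  fixes A :: "'a::banach \<Rightarrow>\<^sub>L 'a"
  assumes "norm A \<le> 1 / 2"
  shows "\<exists>B. op_inverse (id_blinfun - A) B \<and> norm B \<le> 2"
proof -
  have bound: "norm (op_pow A n) \<le> (1 / 2) ^ n" for n
    using norm_op_pow_le[of A n] power_mono[OF assms, of n] by simp
  have geo: "summable (\<lambda>n. (1 / 2 :: real) ^ n)" "(\<Sum>n. (1 / 2 :: real) ^ n) = 2"
    using suminf_geometric[of "1 / 2 :: real"] by (auto intro!: summable_geometric)
  have summable: "summable (\<lambda>n. norm (op_pow A n))"
    by (rule summable_comparison_test'[OF geo(1)]) (use bound in auto)
  note sums = summable_sums[OF summable_norm_cancel[OF summable]]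
  define B where "B = (\<Sum>n. op_pow A n)"
  have "norm B \<le> (\<Sum>n. norm (op_pow A n))"
    unfolding B_def by (rule summable_norm[OF summable])
  also have "\<dots> \<le> 2"
    using suminf_le[OF bound summable geo(1)] geo(2) by simp
  finally have "norm B \<le> 2" .
  have split: "B = id_blinfun + (\<Sum>n. op_pow A (Suc n))"
    unfolding B_def using suminf_split_head[OF summable_norm_cancel[OF summable]] by (simp add: op_pow_0)
  have "(\<lambda>n. A o\<^sub>L op_pow A n) sums (A o\<^sub>L B)"
    unfolding B_def using bounded_linear.sums[OF blinfun_comp.bounded_linear_right sums] .
  then have "A o\<^sub>L B = B - id_blinfun"
    using split by (simp add: op_pow_Suc sums_iff)
  moreover have "(\<lambda>n. op_pow A n o\<^sub>L A) sums (B o\<^sub>L A)"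
    unfolding B_def using bounded_linear.sums[OF blinfun_comp.bounded_linear_left sums] .
  then have "B o\<^sub>L A = B - id_blinfun"
    using split by (simp add: op_pow_Suc_right sums_iff)
  ultimately have "op_inverse (id_blinfun - A) B"
    unfolding op_inverse_def by (auto simp: blinfun_eq_iff blinfun.bilinear_simps)
  with \<open>norm B \<le> 2\<close> show ?thesis by blast
qed

text \<open>With \<open>A = R (T - T')\<close>, of norm at most \<open>1 / 2\<close>, one has
  \<open>T' = T (I - A)\<close>, so \<open>R' = B R\<close> for the inverse \<open>B\<close> of
  \<open>I - A\<close>. The estimate follows from \<open>R' - R = R' (T - T') R\<close> together
  with \<open>norm R' \<le> 2 * C\<close> and \<open>norm R \<le> C\<close>.\<close>

lemma op_inverse_perturb:
  fixes T T' R :: "'a::banach \<Rightarrow>\<^sub>L 'a"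
  assumes R: "op_inverse T R" and C: "norm R \<le> C" and T': "C * norm (T' - T) \<le> 1 / 2"
  shows "\<exists>R'. op_inverse T' R' \<and> norm (R' - R) \<le> 2 * C\<^sup>2 * norm (T' - T)"
proof -
  have C0: "0 \<le> C" using C norm_ge_zero order_trans by blast
  define A where "A = R o\<^sub>L (T - T')"
  have "norm A \<le> norm R * norm (T - T')"
    unfolding A_def by (rule norm_blinfun_compose)
  also have "\<dots> \<le> C * norm (T' - T)"
    using C by (simp add: norm_minus_commute mult_right_mono)
  finally have "norm A \<le> 1 / 2" using T' by simp
  then obtain B where B: "op_inverse (id_blinfun - A) B" "norm B \<le> 2"
    using neumann_series by blast
  define R' where "R' = B o\<^sub>L R"
  have RT: "R (T x) = x" "T (R x) = x" for x
    using R unfolding op_inverse_def blinfun_eq_iff by simp_all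
  have BA: "B x - B (A x) = x" "B x - A (B x) = x" for x
    using B(1) unfolding op_inverse_def blinfun_eq_iff by (simp_all add: blinfun.bilinear_simps)
  have A: "A x = x - R (T' x)" for x
    unfolding A_def by (simp add: blinfun.bilinear_simps RT)
  have T'A: "T' x = T (x - A x)" for x
    unfolding A by (simp add: RT)
  have inv: "op_inverse T' R'"
    unfolding op_inverse_def R'_def blinfun_eq_iff
  proof (intro conjI allI)
    show "(T' o\<^sub>L (B o\<^sub>L R)) x = id_blinfun x" for x
      by (simp add: T'A BA RT)
    show "(B o\<^sub>L R o\<^sub>L T') x = id_blinfun x" for x
      using BA(1)[of x] by (simp add: T'A RT blinfun.bilinear_simps)
  qed
  have "R' x - R x = R' (T (R x) - T' (R x))" for x
    using inv unfolding op_inverse_def blinfun_eq_iff by (simp add: blinfun.bilinear_simps RT)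
  then have "R' - R = R' o\<^sub>L ((T - T') o\<^sub>L R)"
    by (auto intro!: blinfun_eqI simp: blinfun.bilinear_simps)
  also have "norm \<dots> \<le> norm R' * (norm (T - T') * norm R)"
    by (meson mult_left_mono norm_blinfun_compose norm_ge_zero order_trans)
  also have "\<dots> \<le> (2 * C) * (norm (T' - T) * C)"
  proof (rule mult_mono)
    have "norm R' \<le> norm B * norm R"
      unfolding R'_def by (rule norm_blinfun_compose)
    also have "\<dots> \<le> 2 * C"
      using B(2) C by (intro mult_mono) auto
    finally show "norm R' \<le> 2 * C" .
    show "norm (T - T') * norm R \<le> norm (T' - T) * C"
      using C by (simp add: norm_minus_commute mult_left_mono)
  qed (use C0 in auto)
  finally show ?thesis
    using inv by (auto simp: power2_eq_square mult_ac)
qed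

text \<open>The sign is that of Cauchy's formula, \<open>z - X\<close>, whereas
  \<open>spectrum\<close> is phrased with \<open>X - z\<close>. On the spectrum the value is
  unspecified.\<close>

definition resolvent :: "('a::complex_hilbert \<Rightarrow>\<^sub>L 'a) \<Rightarrow> complex \<Rightarrow> 'a \<Rightarrow>\<^sub>L 'a"
  where "resolvent X z = (THE R. op_inverse (scalar_op z - X) R)"

lemma not_in_spectrum_iff: "z \<notin> spectrum X \<longleftrightarrow> (\<exists>R. op_inverse (scalar_op z - X) R)"
proof -
  have "op_inverse (X - scalar_op z) B \<longleftrightarrow> op_inverse (scalar_op z - X) (- B)" for B
    unfolding op_inverse_def blinfun_eq_iff by (simp add: blinfun.bilinear_simps)
  moreover have "B = - (- B)" for B :: "'a \<Rightarrow>\<^sub>L 'a" by simp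
  ultimately have "(\<exists>B. op_inverse (X - scalar_op z) B) \<longleftrightarrow> (\<exists>R. op_inverse (scalar_op z - X) R)"
    by metis
  then show ?thesis
    unfolding spectrum_def op_inverse_def[symmetric] by simp
qed

lemma resolvent_eqI: "op_inverse (scalar_op z - X) R \<Longrightarrow> resolvent X z = R"
  unfolding resolvent_def using op_inverse_unique by blast

lemma op_inverse_resolvent: "z \<notin> spectrum X \<Longrightarrow> op_inverse (scalar_op z - X) (resolvent X z)"
  using not_in_spectrum_iff resolvent_eqI by metis

text \<open>Point and operator vary together, so the same estimate yields continuity in
  \<open>z\<close> and convergence along a norm-convergent sequence of operators.\<close>

lemma resolvent_perturb:
  assumes z: "z \<notin> spectrum X" and C: "norm (resolvent X z) \<le> C"
    and small: "C * norm ((scalar_op z' - X') - (scalar_op z - X)) \<le> 1 / 2"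
  shows "z' \<notin> spectrum X'"
    and "norm (resolvent X' z' - resolvent X z) \<le> 2 * C\<^sup>2 * norm ((scalar_op z' - X') - (scalar_op z - X))"
  using op_inverse_perturb[OF op_inverse_resolvent[OF z] C small] resolvent_eqI not_in_spectrum_iff by metis+

lemma resolvent_shift:
  assumes z: "z \<notin> spectrum X" and C: "norm (resolvent X z) \<le> C"
    and small: "C * dist z' z \<le> 1 / 2"
  shows "z' \<notin> spectrum X" and "norm (resolvent X z' - resolvent X z) \<le> 2 * C\<^sup>2 * dist z' z"
proof -
  have C0: "0 \<le> C" using C norm_ge_zero order_trans by blast
  have "(scalar_op z' - X) - (scalar_op z - X) = scalar_op (z' - z)"
    by (simp add: scalar_op_diff)
  then have le: "norm ((scalar_op z' - X) - (scalar_op z - X)) \<le> dist z' z"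
    by (simp add: norm_scalar_op_le dist_norm)
  then have "C * norm ((scalar_op z' - X) - (scalar_op z - X)) \<le> 1 / 2"
    using small mult_left_mono[OF le C0] by linarith
  note * = resolvent_perturb[OF z C this]
  show "z' \<notin> spectrum X" by (rule *(1))
  show "norm (resolvent X z' - resolvent X z) \<le> 2 * C\<^sup>2 * dist z' z"
    using *(2) mult_left_mono[OF le, of "2 * C\<^sup>2"] by simp
qed

lemma closed_spectrum: "closed (spectrum X)"
proof -
  have "open (- spectrum X)"
    unfolding open_dist
  proof
    fix z assume "z \<in> - spectrum X"
    define C where "C = norm (resolvent X z) + 1"
    have C: "C > 0" "norm (resolvent X z) \<le> C"
      by (auto simp: C_def add_nonneg_pos)
    have "z' \<in> - spectrum X" if "dist z' z < 1 / (2 * C)" for z'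
    proof -
      have "C * dist z' z \<le> 1 / 2"
        using that C(1) by (simp add: field_simps)
      then show ?thesis
        using resolvent_shift(1) C(2) \<open>z \<in> - spectrum X\<close> by blast
    qed
    then show "\<exists>e>0. \<forall>z'. dist z' z < e \<longrightarrow> z' \<in> - spectrum X"
      using C(1) by (intro exI[of _ "1 / (2 * C)"]) auto
  qed
  then show ?thesis by (simp add: closed_def)
qed

lemma continuous_on_resolvent: "continuous_on (- spectrum X) (resolvent X)"
proof -
  have "isCont (resolvent X) z" if z: "z \<notin> spectrum X" for z
  proof -
    define C where "C = norm (resolvent X z) + 1"
    have C: "C > 0" "norm (resolvent X z) \<le> C"
      by (auto simp: C_def add_nonneg_pos)
    have "\<forall>\<^sub>F z' in at z. C * dist z' z < 1 / 2"
      by (rule order_tendstoD(2)[of _ 0]) (auto intro!: tendsto_eq_intros)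
    then have "\<forall>\<^sub>F z' in at z. norm (resolvent X z' - resolvent X z) \<le> 2 * C\<^sup>2 * dist z' z"
      by eventually_elim (use resolvent_shift(2)[OF z C(2)] in auto)
    moreover have "((\<lambda>z'. 2 * C\<^sup>2 * dist z' z) \<longlongrightarrow> 0) (at z)"
      by (auto intro!: tendsto_eq_intros)
    ultimately have "((\<lambda>z'. resolvent X z' - resolvent X z) \<longlongrightarrow> 0) (at z)"
      by (rule Lim_null_comparison)
    then show ?thesis
      unfolding isCont_def by (simp add: LIM_zero_iff)
  qed
  then show ?thesis
    by (intro continuous_at_imp_continuous_on) auto
qed

lemma resolvent_bounded_on_compact:
  assumes "compact Z" "Z \<inter> spectrum X = {}"
  obtains C where "C > 0" "\<And>z. z \<in> Z \<Longrightarrow> norm (resolvent X z) \<le> C"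
proof -
  have "compact (resolvent X ` Z)"
    using assms by (intro compact_continuous_image continuous_on_subset[OF continuous_on_resolvent]) auto
  then have "bounded (resolvent X ` Z)" by (rule compact_imp_bounded)
  then show ?thesis
    using that unfolding bounded_pos by auto
qed

text \<open>The difference of \<open>z - Xs l\<close> and \<open>z - X\<close> does not depend on
  \<open>z\<close>, so one bound for the resolvent of \<open>X\<close> on \<open>Z\<close> makes the
  perturbation estimate uniform. The first claim is upper semicontinuity of the spectrum.\<close>

lemma resolvent_uniform_limit:
  assumes lim: "Xs \<longlonglongrightarrow> X" and Z: "compact Z" "Z \<inter> spectrum X = {}"
  shows "\<forall>\<^sub>F l in sequentially. \<forall>z\<in>Z. z \<notin> spectrum (Xs l)"
    and "uniform_limit Z (\<lambda>l. resolvent (Xs l)) (resolvent X) sequentially"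
proof -
  obtain C where C: "C > 0" "\<And>z. z \<in> Z \<Longrightarrow> norm (resolvent X z) \<le> C"
    using resolvent_bounded_on_compact[OF Z] by blast
  have eq: "norm ((scalar_op z - Xs l) - (scalar_op z - X)) = norm (Xs l - X)" for z l
    by (simp add: norm_minus_commute)
  have "(\<lambda>l. Xs l - X) \<longlonglongrightarrow> 0"
    using lim by (simp add: LIM_zero)
  from tendsto_norm[OF this] have d: "(\<lambda>l. norm (Xs l - X)) \<longlonglongrightarrow> 0"
    by simp
  have "(\<lambda>l. C * norm (Xs l - X)) \<longlonglongrightarrow> 0"
    using tendsto_mult_left[OF d, of C] by simp
  then have small: "\<forall>\<^sub>F l in sequentially. C * norm (Xs l - X) < 1 / 2"
    by (rule order_tendstoD) simp
  show "\<forall>\<^sub>F l in sequentially. \<forall>z\<in>Z. z \<notin> spectrum (Xs l)"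
    using small
  proof eventually_elim
    case (elim l)
    show ?case
    proof
      fix z assume "z \<in> Z"
      then show "z \<notin> spectrum (Xs l)"
        using resolvent_perturb(1)[of z X C z "Xs l"] C(2) Z(2) elim eq by auto
    qed
  qed
  show "uniform_limit Z (\<lambda>l. resolvent (Xs l)) (resolvent X) sequentially"
  proof (rule uniform_limitI)
    fix e :: real assume "e > 0"
    have "(\<lambda>l. 2 * C\<^sup>2 * norm (Xs l - X)) \<longlonglongrightarrow> 0"
      using tendsto_mult_left[OF d, of "2 * C\<^sup>2"] by simp
    then have "\<forall>\<^sub>F l in sequentially. 2 * C\<^sup>2 * norm (Xs l - X) < e"
      using \<open>e > 0\<close> by (rule order_tendstoD)
    with small show "\<forall>\<^sub>F l in sequentially. \<forall>z\<in>Z. dist (resolvent (Xs l) z) (resolvent X z) < e"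
    proof eventually_elim
      case (elim l)
      show ?case
      proof
        fix z assume "z \<in> Z"
        then have "z \<notin> spectrum X" using Z(2) by blast
        with \<open>z \<in> Z\<close> show "dist (resolvent (Xs l) z) (resolvent X z) < e"
          using resolvent_perturb(2)[of z X C z "Xs l"] C(2) Z(2) elim eq by (auto simp: dist_norm)
      qed
    qed
  qed
qed

section \<open>Boundedness of spectral measures\<close>

lemma borel_subsets_Int: "B \<in> borel_subsets S \<Longrightarrow> C \<in> borel_subsets S \<Longrightarrow> B \<inter> C \<in> borel_subsets S"
  and borel_subsets_Diff: "B \<in> borel_subsets S \<Longrightarrow> C \<in> borel_subsets S \<Longrightarrow> B - C \<in> borel_subsets S"
  and borel_subsets_Un: "B \<in> borel_subsets S \<Longrightarrow> C \<in> borel_subsets S \<Longrightarrow> B \<union> C \<in> borel_subsets S"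
  and borel_subsets_empty: "{} \<in> borel_subsets S"
  by (auto simp: borel_subsets_def)

text \<open>Reduces complex coefficients to two real functionals, the real and imaginary parts of
  \<open>cinner v\<close>, to which an argument by signs applies.\<close>

lemma cinner_bound_real_imag:
  fixes v w :: "'a::complex_hilbert"
  shows "\<bar>inner v (c *\<^sub>C w)\<bar> \<le> cmod c * (\<bar>inner v w\<bar> + \<bar>inner v ((- \<i>) *\<^sub>C w)\<bar>)"
proof -
  have "inner v (c *\<^sub>C w) = Re (c * cinner v w)"
    by (simp add: inner_eq_Re_cinner cinner_scaleC_right)
  then have "\<bar>inner v (c *\<^sub>C w)\<bar> \<le> cmod c * cmod (cinner v w)"
    using abs_Re_le_cmod[of "c * cinner v w"] by (simp add: norm_mult)
  also have "\<dots> \<le> cmod c * (\<bar>Re (cinner v w)\<bar> + \<bar>Im (cinner v w)\<bar>)"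
    by (intro mult_left_mono cmod_le) auto
  also have "Im (cinner v w) = inner v ((- \<i>) *\<^sub>C w)"
    by (simp add: inner_eq_Re_cinner cinner_scaleC_right)
  finally show ?thesis
    by (simp add: inner_eq_Re_cinner)
qed

locale spectral_meas =
  fixes S :: "complex set" and E :: "complex set \<Rightarrow> 'a::complex_hilbert \<Rightarrow>\<^sub>L 'a"
  assumes spectral_measure: "spectral_measure S E"
begin

lemma S_borel: "S \<in> sets borel"
  using spectral_measure by (simp add: spectral_measure_def)

lemma S_subset: "S \<in> borel_subsets S"
  using S_borel by (simp add: borel_subsets_def)

lemma E_linear: "B \<in> borel_subsets S \<Longrightarrow> complex_linear (E B)"
  using spectral_measure by (simp add: spectral_measure_def)

lemma E_comp: "B \<in> borel_subsets S \<Longrightarrow> C \<in> borel_subsets S \<Longrightarrow> E B o\<^sub>L E C = E (B \<inter> C)"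
  using spectral_measure by (simp add: spectral_measure_def)

lemma E_apply: "B \<in> borel_subsets S \<Longrightarrow> C \<in> borel_subsets S \<Longrightarrow> E B (E C x) = E (B \<inter> C) x"
  using E_comp[of B C] by (metis blinfun_apply_blinfun_compose)

lemma E_S: "E S = id_blinfun"
  using spectral_measure by (simp add: spectral_measure_def)

lemma E_sums:
  assumes "\<And>n. A n \<in> borel_subsets S" "disjoint_family (A :: nat \<Rightarrow> _)"
  shows "(\<lambda>n. E (A n) x) sums E (\<Union>n. A n) x"
  using spectral_measure assms by (simp add: spectral_measure_def image_subset_iff)

text \<open>Countable additivity for the constant sequence \<open>{}\<close>: a convergent series
  with equal terms has zero terms.\<close>

lemma E_empty: "E {} = 0"
proof (rule blinfun_eqI)
  fix x
  have "(\<lambda>n::nat. E {} x) sums E (\<Union>n::nat. {}) x"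
    by (rule E_sums) (auto simp: borel_subsets_empty disjoint_family_on_def)
  then have "(\<lambda>n::nat. E {} x) \<longlonglongrightarrow> 0"
    using summable_LIMSEQ_zero sums_summable by blast
  then show "E {} x = blinfun_apply 0 x"
    by (simp add: LIMSEQ_const_iff)
qed

lemma E_Un_disjoint:
  assumes "B \<in> borel_subsets S" "C \<in> borel_subsets S" "B \<inter> C = {}"
  shows "E (B \<union> C) = E B + E C"
proof (rule blinfun_eqI)
  fix x
  define A where "A = (\<lambda>n::nat. if n = 0 then B else if n = 1 then C else {})"
  have "(\<lambda>n. E (A n) x) sums E (\<Union>n. A n) x"
    by (rule E_sums) (use assms in \<open>auto simp: A_def borel_subsets_empty disjoint_family_on_def\<close>)
  moreover have "(\<Union>n. A n) = B \<union> C"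
    by (auto simp: A_def split: if_splits intro: exI[of _ 0] exI[of _ 1])
  moreover have "(\<lambda>n. E (A n) x) sums (\<Sum>n\<in>{0, 1}. E (A n) x)"
    by (rule sums_finite) (auto simp: A_def E_empty)
  ultimately show "E (B \<union> C) x = (E B + E C) x"
    using sums_unique2 by (fastforce simp: A_def blinfun.bilinear_simps)
qed

lemma E_Diff:
  assumes "B \<in> borel_subsets S" "C \<in> borel_subsets S" "C \<subseteq> B"
  shows "E (B - C) = E B - E C"
proof -
  have "C \<union> (B - C) = B" using assms(3) by blast
  then show ?thesis
    using E_Un_disjoint[of C "B - C"] assms by (simp add: borel_subsets_Diff)
qed

lemma E_UN:
  assumes "finite J" "\<And>j. j \<in> J \<Longrightarrow> A j \<in> borel_subsets S" "disjoint_family_on A J"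
  shows "(\<Union>j\<in>J. A j) \<in> borel_subsets S \<and> E (\<Union>j\<in>J. A j) = (\<Sum>j\<in>J. E (A j))"
  using assms
proof (induction J)
  case empty
  then show ?case by (simp add: borel_subsets_empty E_empty)
next
  case (insert j J)
  have IH: "(\<Union>j\<in>J. A j) \<in> borel_subsets S" "E (\<Union>j\<in>J. A j) = (\<Sum>j\<in>J. E (A j))"
    using insert by (auto simp: disjoint_family_on_def)
  have "A j \<inter> (\<Union>j\<in>J. A j) = {}"
    using insert by (auto simp: disjoint_family_on_def)
  then show ?case
    using insert IH E_Un_disjoint[of "A j" "\<Union>j\<in>J. A j"] by (simp add: borel_subsets_Un)
qed

text \<open>
  Gliding hump: if \<open>E\<close> were unbounded, repeatedly splitting off a large piece would give disjoint sets
  \<open>A n\<close> with \<open>norm (E (A n)) \<ge> n\<close>, although \<open>E (A n) x \<longlonglongrightarrow> 0\<close> for every \<open>x\<close>.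
\<close>

lemma E_bounded: "\<exists>M. \<forall>B\<in>borel_subsets S. norm (E B) \<le> M"
proof (rule ccontr)
  define unb where "unb F \<longleftrightarrow> F \<in> borel_subsets S \<and> (\<forall>M. \<exists>B\<in>borel_subsets S. B \<subseteq> F \<and> M < norm (E B))" for F
  assume "\<nexists>M. \<forall>B\<in>borel_subsets S. norm (E B) \<le> M"
  then have unbS: "unb S"
    unfolding unb_def using S_subset by (auto simp: not_le borel_subsets_def)
  have step: "\<exists>F'. unb F' \<and> F' \<subseteq> F \<and> real n \<le> norm (E (F - F'))" if F: "unb F" for F n
  proof -
    have FS: "F \<in> borel_subsets S" using F by (simp add: unb_def)
    \<comment> \<open>The excess over \<open>norm (E F)\<close> forces both \<open>E B\<close> and
      \<open>E (F - B)\<close> to have norm at least \<open>n\<close>. Whichever of the two sets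
      remains unbounded is kept, and the other is split off.\<close>
    obtain B where B: "B \<in> borel_subsets S" "B \<subseteq> F" "norm (E F) + real n < norm (E B)"
      using F unfolding unb_def by blast
    show ?thesis
    proof (cases "unb B")
      case True
      have "norm (E B) \<le> norm (E F) + norm (E (F - B))"
        using norm_triangle_ineq4[of "E F" "E (F - B)"] E_Diff[OF FS B(1,2)] by simp
      then show ?thesis
        using True B by (intro exI[of _ B]) auto
    next
      case False
      then obtain M where M: "\<And>C. C \<in> borel_subsets S \<Longrightarrow> C \<subseteq> B \<Longrightarrow> norm (E C) \<le> M"
        using B(1) unfolding unb_def by (meson not_le)
      have "unb (F - B)"
        unfolding unb_def
      proof (intro conjI allI)
        fix K
        obtain A where A: "A \<in> borel_subsets S" "A \<subseteq> F" "K + M < norm (E A)"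
          using F unfolding unb_def by blast
        have "A = (A - B) \<union> (A \<inter> B)" by blast
        then have "E A = E (A - B) + E (A \<inter> B)"
          using E_Un_disjoint[of "A - B" "A \<inter> B"] A(1) B(1)
          by (metis Diff_disjoint Int_Diff Int_commute borel_subsets_Diff borel_subsets_Int Diff_Int_distrib2 Diff_cancel)
        then have "norm (E A) \<le> norm (E (A - B)) + norm (E (A \<inter> B))"
          by (simp add: norm_triangle_ineq)
        moreover have "norm (E (A \<inter> B)) \<le> M"
          using M A(1) B(1) by (simp add: borel_subsets_Int)
        ultimately show "\<exists>C\<in>borel_subsets S. C \<subseteq> F - B \<and> K < norm (E C)"
          using A B(1) by (intro bexI[of _ "A - B"]) (auto simp: borel_subsets_Diff)
      qed (use FS B(1) in \<open>simp add: borel_subsets_Diff\<close>)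
      moreover have "F - (F - B) = B" using B(2) by blast
      moreover have "real n \<le> norm (E B)"
        using B(3) norm_ge_zero[of "E F"] by linarith
      ultimately show ?thesis by (intro exI[of _ "F - B"]) auto
    qed
  qed
  obtain F where F: "\<And>n. unb (F n)" "\<And>n. F (Suc n) \<subseteq> F n \<and> real n \<le> norm (E (F n - F (Suc n)))"
    using dependent_nat_choice[of "\<lambda>_. unb" "\<lambda>n F F'. F' \<subseteq> F \<and> real n \<le> norm (E (F - F'))"]
      unbS step by metis
  define A where "A n = F n - F (Suc n)" for n
  have AS: "A n \<in> borel_subsets S" for n
    unfolding A_def using F(1) by (simp add: unb_def borel_subsets_Diff)
  have mono: "F n \<subseteq> F m" if "m \<le> n" for m n
    using F(2) lift_Suc_antimono_le[of F m n] that by blast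
  have "A m \<inter> A n = {}" if "m < n" for m n
    using mono[of "Suc m" n] that by (auto simp: A_def)
  then have "disjoint_family A"
    by (auto simp: disjoint_family_on_def) (metis disjoint_iff nat_neq_iff)
  have "\<exists>M. \<forall>n. norm (E (A n) x) \<le> M" for x
  proof -
    have "(\<lambda>n. E (A n) x) \<longlonglongrightarrow> 0"
      using E_sums[OF AS \<open>disjoint_family A\<close>] summable_LIMSEQ_zero sums_summable by blast
    then have "Bseq (\<lambda>n. E (A n) x)"
      using convergentI convergent_imp_Bseq by blast
    then show ?thesis by (auto simp: Bseq_def)
  qed
  from uniform_boundedness[of "\<lambda>n. E (A n)", OF this] obtain M where M: "\<And>n. norm (E (A n)) \<le> M" by blast
  obtain n where "M < real n" using reals_Archimedean2 by blast
  then show False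
    using M[of n] F(2)[of n] by (simp add: A_def)
qed

text \<open>Chosen positive because the mesh of a partition is later obtained by dividing by
  it.\<close>

definition E_bound :: real
  where "E_bound = (SOME M. 0 < M \<and> (\<forall>B\<in>borel_subsets S. norm (E B) \<le> M))"

lemma E_bound: "0 < E_bound" "B \<in> borel_subsets S \<Longrightarrow> norm (E B) \<le> E_bound"
proof -
  obtain M where M: "\<And>B. B \<in> borel_subsets S \<Longrightarrow> norm (E B) \<le> M"
    using E_bounded by blast
  then have "norm (E B) \<le> \<bar>M\<bar> + 1" if "B \<in> borel_subsets S" for B
    using that by fastforce
  then have "0 < \<bar>M\<bar> + 1 \<and> (\<forall>B\<in>borel_subsets S. norm (E B) \<le> \<bar>M\<bar> + 1)"
    by auto
  then have "0 < E_bound \<and> (\<forall>B\<in>borel_subsets S. norm (E B) \<le> E_bound)"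
    unfolding E_bound_def by (rule someI)
  then show "0 < E_bound" "B \<in> borel_subsets S \<Longrightarrow> norm (E B) \<le> E_bound" by auto
qed

text \<open>Projections of disjoint sets add up to the projection of the union, so every partial sum
  of the values \<open>\<phi> (E (A j) x)\<close> is at most \<open>E_bound * K * norm x\<close> in
  modulus. Separating nonnegative from negative values gives the sum of absolute values and the
  factor \<open>2\<close>.\<close>

lemma sum_abs_E_le:
  assumes J: "finite J" "\<And>j. j \<in> J \<Longrightarrow> A j \<in> borel_subsets S" "disjoint_family_on A J"
    and \<phi>: "bounded_linear \<phi>" "\<And>w. \<bar>\<phi> w\<bar> \<le> K * norm w" and K: "K \<ge> 0"
  shows "(\<Sum>j\<in>J. \<bar>\<phi> (E (A j) x)\<bar>) \<le> 2 * E_bound * K * norm x"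
proof -
  interpret \<phi>: bounded_linear \<phi> by (rule \<phi>(1))
  have part: "\<bar>\<Sum>j\<in>J'. \<phi> (E (A j) x)\<bar> \<le> E_bound * K * norm x" if "J' \<subseteq> J" for J'
  proof -
    have J': "finite J'" "\<And>j. j \<in> J' \<Longrightarrow> A j \<in> borel_subsets S" "disjoint_family_on A J'"
      using J that finite_subset disjoint_family_on_mono by blast+
    note U = E_UN[OF J']
    have "(\<Sum>j\<in>J'. \<phi> (E (A j) x)) = \<phi> (E (\<Union>j\<in>J'. A j) x)"
      using U by (simp add: \<phi>.sum blinfun.bilinear_simps)
    also have "\<bar>\<dots>\<bar> \<le> K * norm (E (\<Union>j\<in>J'. A j) x)" by (rule \<phi>(2))
    also have "\<dots> \<le> K * (E_bound * norm x)"
      using U norm_blinfun[of "E (\<Union>j\<in>J'. A j)" x] E_bound(2)[of "\<Union>j\<in>J'. A j"] K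
      by (meson mult_left_mono mult_right_mono norm_ge_zero order_trans)
    finally show ?thesis by (simp add: mult_ac)
  qed
  define P where "P = {j\<in>J. \<phi> (E (A j) x) \<ge> 0}"
  have "(\<Sum>j\<in>J. \<bar>\<phi> (E (A j) x)\<bar>) = (\<Sum>j\<in>P. \<bar>\<phi> (E (A j) x)\<bar>) + (\<Sum>j\<in>J - P. \<bar>\<phi> (E (A j) x)\<bar>)"
    using J(1) sum.subset_diff[of P J "\<lambda>j. \<bar>\<phi> (E (A j) x)\<bar>"] by (simp add: P_def)
  also have "(\<Sum>j\<in>P. \<bar>\<phi> (E (A j) x)\<bar>) = (\<Sum>j\<in>P. \<phi> (E (A j) x))"
    by (rule sum.cong) (auto simp: P_def)
  also have "(\<Sum>j\<in>J - P. \<bar>\<phi> (E (A j) x)\<bar>) = - (\<Sum>j\<in>J - P. \<phi> (E (A j) x))"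
    unfolding sum_negf[symmetric] by (rule sum.cong) (auto simp: P_def)
  finally show ?thesis
    using part[of P] part[of "J - P"] by (auto simp: P_def)
qed

text \<open>The bound is independent of the number of parts, which the triangle inequality alone
  would not give. The factor \<open>4\<close> is \<open>2\<close> from the signs in
  \<open>sum_abs_E_le\<close> times \<open>2\<close> from real and imaginary parts.\<close>

lemma norm_weighted_E_sum_le:
  assumes J: "finite J" "\<And>j. j \<in> J \<Longrightarrow> A j \<in> borel_subsets S" "disjoint_family_on A J"
    and c: "\<And>j. j \<in> J \<Longrightarrow> cmod (c j) \<le> k" and k: "k \<ge> 0"
  shows "norm (\<Sum>j\<in>J. scalar_op (c j) o\<^sub>L E (A j)) \<le> 4 * E_bound * k"
proof (rule norm_blinfun_bound)
  fix x
  define v where "v = (\<Sum>j\<in>J. scalar_op (c j) o\<^sub>L E (A j)) x"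
  have v: "v = (\<Sum>j\<in>J. c j *\<^sub>C E (A j) x)"
    by (simp add: v_def blinfun.bilinear_simps scalar_op_apply)
  have u: "bounded_linear (\<lambda>w. inner v (u *\<^sub>C w))" "\<bar>inner v (u *\<^sub>C w)\<bar> \<le> norm v * norm w"
    if "cmod u = 1" for u and w :: 'a
  proof -
    show "bounded_linear (\<lambda>w. inner v (u *\<^sub>C w))"
      by (rule bounded_linear_compose[OF bounded_linear_inner_right bounded_linear_scaleC])
    show "\<bar>inner v (u *\<^sub>C w)\<bar> \<le> norm v * norm w"
      using Cauchy_Schwarz_ineq2[of v "u *\<^sub>C w"] that by (simp add: norm_scaleC)
  qed
  have s1: "(\<Sum>j\<in>J. \<bar>inner v (E (A j) x)\<bar>) \<le> 2 * E_bound * norm v * norm x"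
    using sum_abs_E_le[OF J u[of 1]] by (simp add: scaleC_one)
  have s2: "(\<Sum>j\<in>J. \<bar>inner v ((- \<i>) *\<^sub>C E (A j) x)\<bar>) \<le> 2 * E_bound * norm v * norm x"
    using sum_abs_E_le[OF J u[of "- \<i>"]] by simp
  \<comment> \<open>The value \<open>v\<close> is tested against itself: the two real functionals
    built from \<open>inner v\<close> have norm at most \<open>norm v\<close>, and one factor
    \<open>norm v\<close> cancels at the end.\<close>
  have "norm v * norm v = inner v v"
    by (simp add: dot_square_norm power2_eq_square)
  also have "\<dots> = (\<Sum>j\<in>J. inner v (c j *\<^sub>C E (A j) x))"
    by (subst (2) v) (simp add: inner_sum_right)
  also have "\<dots> \<le> (\<Sum>j\<in>J. k * (\<bar>inner v (E (A j) x)\<bar> + \<bar>inner v ((- \<i>) *\<^sub>C E (A j) x)\<bar>))"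
  proof (rule sum_mono)
    fix j assume "j \<in> J"
    have "inner v (c j *\<^sub>C E (A j) x) \<le> cmod (c j) * (\<bar>inner v (E (A j) x)\<bar> + \<bar>inner v ((- \<i>) *\<^sub>C E (A j) x)\<bar>)"
      using cinner_bound_real_imag[of v "c j" "E (A j) x"] by linarith
    also have "\<dots> \<le> k * (\<bar>inner v (E (A j) x)\<bar> + \<bar>inner v ((- \<i>) *\<^sub>C E (A j) x)\<bar>)"
      by (intro mult_right_mono c \<open>j \<in> J\<close>) auto
    finally show "inner v (c j *\<^sub>C E (A j) x) \<le> k * (\<bar>inner v (E (A j) x)\<bar> + \<bar>inner v ((- \<i>) *\<^sub>C E (A j) x)\<bar>)" .
  qed
  also have "\<dots> = k * ((\<Sum>j\<in>J. \<bar>inner v (E (A j) x)\<bar>) + (\<Sum>j\<in>J. \<bar>inner v ((- \<i>) *\<^sub>C E (A j) x)\<bar>))"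
    by (simp add: sum_distrib_left sum.distrib distrib_left)
  also have "\<dots> \<le> k * (2 * E_bound * norm v * norm x + 2 * E_bound * norm v * norm x)"
    by (intro mult_left_mono add_mono s1 s2 k)
  finally have "norm v * norm v \<le> norm v * (4 * E_bound * k * norm x)"
    by (simp add: algebra_simps)
  then have "norm v \<le> 4 * E_bound * k * norm x"
    using E_bound(1) k by (cases "norm v = 0") (auto simp: mult_le_cancel_left_pos)
  then show "norm ((\<Sum>j\<in>J. scalar_op (c j) o\<^sub>L E (A j)) x) \<le> 4 * E_bound * k * norm x"
    by (simp add: v_def)
qed (use E_bound(1) k in simp)

end

section \<open>Riemann sums of the resolvent\<close>

text \<open>The floors of \<open>2 * Re z / d\<close> and \<open>2 * Im z / d\<close> label squares
  of side \<open>d / 2\<close>, whose diameter is below \<open>d\<close>; membership in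
  \<open>C\<close> as a third label cuts them along \<open>C\<close>. Since \<open>S\<close> is
  bounded, finitely many labels occur.\<close>

lemma fine_partition_exists:
  assumes S: "S \<in> sets borel" "bounded S" and C: "C \<in> sets borel" and d: "d > 0"
  shows "\<exists>Q. finite_borel_partition S Q \<and> (\<forall>A\<in>Q. (A \<subseteq> C \<or> A \<inter> C = {}) \<and> (\<forall>a\<in>A. \<forall>b\<in>A. dist a b \<le> d))"
proof -
  define fl where "fl x = \<lfloor>x * 2 / d\<rfloor>" for x
  define f where "f z = (z \<in> C, fl (Re z), fl (Im z))" for z
  obtain B where B: "\<And>z. z \<in> S \<Longrightarrow> cmod z \<le> B"
    using S(2) by (auto simp: bounded_iff)
  have flB: "fl x \<in> {fl (- B)..fl B}" if "\<bar>x\<bar> \<le> B" for x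
  proof -
    have "- B * 2 / d \<le> x * 2 / d" "x * 2 / d \<le> B * 2 / d"
      by (intro divide_right_mono mult_right_mono; use that d in linarith)+
    then show ?thesis
      unfolding fl_def by (auto intro!: floor_mono)
  qed
  have "f ` S \<subseteq> UNIV \<times> {fl (- B)..fl B} \<times> {fl (- B)..fl B}"
  proof
    fix y assume "y \<in> f ` S"
    then obtain z where z: "z \<in> S" "y = f z" by blast
    then show "y \<in> UNIV \<times> {fl (- B)..fl B} \<times> {fl (- B)..fl B}"
      using flB[of "Re z"] flB[of "Im z"] B[OF z(1)] abs_Re_le_cmod[of z] abs_Im_le_cmod[of z]
      by (simp add: f_def)
  qed
  then have fin: "finite (f ` S)"
    by (rule finite_subset) simp
  have fl_borel: "fl \<in> borel \<rightarrow>\<^sub>M count_space UNIV"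
    unfolding fl_def by measurable
  have level: "f -` {k} \<in> sets borel" for k
  proof -
    obtain b i j where k: "k = (b, i, j)" by (cases k)
    have "f -` {k} = (if b then C else - C) \<inter> ((\<lambda>z. fl (Re z)) -` {i} \<inter> space borel) \<inter> ((\<lambda>z. fl (Im z)) -` {j} \<inter> space borel)"
      by (auto simp: f_def k)
    moreover have meas: "(\<lambda>z. fl (Re z)) \<in> borel \<rightarrow>\<^sub>M count_space UNIV" "(\<lambda>z. fl (Im z)) \<in> borel \<rightarrow>\<^sub>M count_space UNIV"
      by (auto intro!: measurable_compose[OF _ fl_borel] borel_measurable_continuous_onI continuous_intros)
    ultimately show ?thesis
      using C measurable_sets[OF meas(1), of "{i}"] measurable_sets[OF meas(2), of "{j}"]
      by (auto intro!: sets.Int borel_comp)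
  qed
  define Q where "Q = (\<lambda>k. S \<inter> f -` {k}) ` f ` S"
  have "partition_on S Q"
    by (rule partition_onI) (auto simp: Q_def disjnt_def)
  then have "finite_borel_partition S Q"
    using fin S(1) level by (auto simp: finite_borel_partition_def Q_def)
  moreover have "A \<subseteq> C \<or> A \<inter> C = {}" "dist a b \<le> d" if A: "A \<in> Q" "a \<in> A" "b \<in> A" for A a b
  proof -
    obtain k where k: "A = S \<inter> f -` {k}" using A(1) by (auto simp: Q_def)
    show "A \<subseteq> C \<or> A \<inter> C = {}" by (auto simp: k f_def)
    have flb: "\<bar>x - y\<bar> \<le> d / 2" if "fl x = fl y" for x y
    proof -
      have le: "x * 2 / d - y * 2 / d \<le> 1" "y * 2 / d - x * 2 / d \<le> 1"
        using that unfolding fl_def by linarith+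
      have "x * 2 - y * 2 \<le> d" "y * 2 - x * 2 \<le> d"
        using le d unfolding diff_divide_distrib[symmetric] pos_divide_le_eq[OF d] by simp_all
      then show ?thesis by linarith
    qed
    have "f a = f b" using A(2,3) k by auto
    then have "\<bar>Re (a - b)\<bar> \<le> d / 2" "\<bar>Im (a - b)\<bar> \<le> d / 2"
      using flb by (auto simp: f_def)
    then show "dist a b \<le> d"
      using cmod_le[of "a - b"] by (simp add: dist_norm)
  qed
  ultimately show ?thesis by (intro exI[of _ Q]) blast
qed

lemma eventually_refinement_filter:
  assumes "finite_borel_partition S Q"
  shows "\<forall>\<^sub>F P in refinement_filter S. tagged_partition S P \<and> refines S (snd ` P) Q"
proof -
  have "refinement_filter S \<le> principal {P. tagged_partition S P \<and> refines S (snd ` P) Q}"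
    unfolding refinement_filter_def using assms by (intro INF_lower) simp
  then show ?thesis
    by (auto simp: le_principal)
qed

lemma tagged_partitionD:
  assumes "tagged_partition S P"
  shows "finite P" "disjoint_family_on snd P" "(\<Union>x\<in>P. snd x) = S"
    "\<And>x. x \<in> P \<Longrightarrow> fst x \<in> snd x" "\<And>x. x \<in> P \<Longrightarrow> snd x \<in> borel_subsets S"
proof -
  have *: "finite (snd ` P)" "snd ` P \<subseteq> sets borel" "partition_on S (snd ` P)" "inj_on snd P"
    "\<forall>(a, A)\<in>P. a \<in> A"
    using assms by (auto simp: tagged_partition_def finite_borel_partition_def)
  show "finite P" using *(1,4) finite_imageD by blast
  show U: "(\<Union>x\<in>P. snd x) = S" using *(3) by (auto simp: partition_on_def)
  show "fst x \<in> snd x" if "x \<in> P" for x using *(5) that by auto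
  show "snd x \<in> borel_subsets S" if "x \<in> P" for x
    using *(2) U that by (auto simp: borel_subsets_def)
  show "disjoint_family_on snd P"
    unfolding disjoint_family_on_def
  proof (intro ballI impI)
    fix x y assume "x \<in> P" "y \<in> P" "x \<noteq> y"
    then show "snd x \<inter> snd y = {}"
      using disjointD[OF partition_onD2[OF *(3)], of "snd x" "snd y"] inj_onD[OF *(4), of x y] by blast
  qed
qed

lemma complex_linear_comp: "complex_linear A \<Longrightarrow> complex_linear B \<Longrightarrow> complex_linear (A o\<^sub>L B)"
  and complex_linear_diff: "complex_linear A \<Longrightarrow> complex_linear B \<Longrightarrow> complex_linear (A - B)"
  and complex_linear_id: "complex_linear id_blinfun"
  and complex_linear_scalar_op: "complex_linear (scalar_op c)"
  by (auto simp: complex_linear_def blinfun.bilinear_simps scaleC.bilinear_simps scalar_op_apply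
      scaleC_scaleC mult.commute)

lemma complex_linear_op_pow: "complex_linear A \<Longrightarrow> complex_linear (op_pow A n)"
  by (induction n) (auto simp: op_pow_0 op_pow_Suc complex_linear_id complex_linear_comp)

lemma complex_linear_apply: "complex_linear A \<Longrightarrow> A (c *\<^sub>C x) = c *\<^sub>C A x"
  by (simp add: complex_linear_def)

lemma op_pow_commute:
  "A o\<^sub>L B = B o\<^sub>L A \<Longrightarrow> op_pow A n o\<^sub>L B = B o\<^sub>L op_pow A n"
  by (induction n) (auto simp: op_pow_0 op_pow_Suc blinfun_eq_iff)

text \<open>
  The Taylor polynomial of \<open>x \<mapsto> 1 / (z - x)\<close> at \<open>a\<close>, evaluated at \<open>X\<close>.
\<close>

definition resolvent_jet :: "('a::complex_hilbert \<Rightarrow>\<^sub>L 'a) \<Rightarrow> nat \<Rightarrow> complex \<Rightarrow> complex \<Rightarrow> 'a \<Rightarrow>\<^sub>L 'a"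
  where "resolvent_jet X n z a = (\<Sum>q<n. scalar_op (1 / (z - a) ^ Suc q) o\<^sub>L op_pow (X - scalar_op a) q)"

text \<open>A finite geometric sum: with \<open>B = X - a\<close> one has
  \<open>z - X = (z - a) - B\<close>, and the product telescopes to the identity minus
  \<open>(B / (z - a)) ^ n\<close>.\<close>

lemma resolvent_jet_geometric:
  assumes X: "complex_linear X" and za: "z \<noteq> a"
  shows "resolvent_jet X n z a o\<^sub>L (scalar_op z - X) =
    id_blinfun - (scalar_op (1 / (z - a) ^ n) o\<^sub>L op_pow (X - scalar_op a) n)"
proof (induction n)
  case 0
  then show ?case
    by (auto simp: resolvent_jet_def op_pow_0 blinfun_eq_iff blinfun.bilinear_simps scalar_op_apply scaleC_one)
next
  case (Suc n)
  define B where "B = X - scalar_op a"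
  define c where "c = 1 / (z - a)"
  have c: "c * (z - a) = 1" using za by (simp add: c_def)
  have B: "complex_linear (op_pow B n)"
    unfolding B_def using X by (intro complex_linear_op_pow complex_linear_diff complex_linear_scalar_op)
  show ?case
  proof (rule blinfun_eqI)
    fix x
    have zX: "(scalar_op z - X) x = (z - a) *\<^sub>C x - B x"
      by (simp add: B_def blinfun.bilinear_simps scalar_op_apply scaleC.bilinear_simps)
    have "resolvent_jet X (Suc n) z a ((scalar_op z - X) x) =
        resolvent_jet X n z a ((scalar_op z - X) x) + c ^ Suc n *\<^sub>C op_pow B n ((scalar_op z - X) x)"
      by (simp add: resolvent_jet_def blinfun.bilinear_simps scalar_op_apply B_def[symmetric] c_def power_one_over)
    also have "resolvent_jet X n z a ((scalar_op z - X) x) = x - c ^ n *\<^sub>C op_pow B n x"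
      using arg_cong[OF Suc.IH, of "\<lambda>T. T x"]
      by (simp add: blinfun.bilinear_simps scalar_op_apply B_def c_def power_one_over)
    also have "op_pow B n ((scalar_op z - X) x) = (z - a) *\<^sub>C op_pow B n x - op_pow B (Suc n) x"
      unfolding zX op_pow_Suc_right by (simp add: blinfun.bilinear_simps complex_linear_apply[OF B])
    also have "c ^ Suc n *\<^sub>C ((z - a) *\<^sub>C op_pow B n x - op_pow B (Suc n) x) =
        (c ^ n * (c * (z - a))) *\<^sub>C op_pow B n x - c ^ Suc n *\<^sub>C op_pow B (Suc n) x"
      by (simp add: scaleC.diff_right scaleC_scaleC mult_ac)
    finally show "(resolvent_jet X (Suc n) z a o\<^sub>L (scalar_op z - X)) x =
        (id_blinfun - (scalar_op (1 / (z - a) ^ Suc n) o\<^sub>L op_pow (X - scalar_op a) (Suc n))) x"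
      unfolding c by (simp add: blinfun.bilinear_simps scalar_op_apply B_def[symmetric] c_def power_one_over
          del: power_Suc)
  qed
qed

section \<open>Commutation of an operator and its resolvent with the spectral projections\<close>

locale spectral_op =
  fixes X :: "'a::complex_hilbert \<Rightarrow>\<^sub>L 'a" and E m
  assumes decomposition: "spectral_decomposition X E m"
    and bounded_spectrum: "bounded (spectrum X)"
begin

abbreviation "S \<equiv> spectrum X"

abbreviation N :: "complex set \<Rightarrow> 'a \<Rightarrow>\<^sub>L 'a"
  where "N B \<equiv> spectral_integral E B (\<lambda>z. op_pow (X - scalar_op z) 1)"

sublocale spectral_meas S E
  using decomposition by unfold_locales (simp add: spectral_decomposition_def Let_def)

lemma X_linear: "complex_linear X"
  using decomposition by (simp add: spectral_decomposition_def Let_def)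

lemma N_comp:
  assumes "B \<in> borel_subsets S" "C \<in> borel_subsets S"
  shows "E C o\<^sub>L N B = N (B \<inter> C)" "N B o\<^sub>L E C = N (B \<inter> C)"
  using decomposition assms unfolding spectral_decomposition_def Let_def by blast+

lemma N_has_integral:
  assumes "B \<in> borel_subsets S"
  shows "has_spectral_integral E B (\<lambda>z. op_pow (X - scalar_op z) 1) (N B)"
proof -
  have "spectral_integrable E B (\<lambda>z. op_pow (X - scalar_op z) 1)"
    using decomposition assms unfolding spectral_decomposition_def Let_def by blast
  then show ?thesis
    unfolding spectral_integrable_def using spectral_integral_unique by blast
qed

lemma N_nilpotent:
  assumes "B \<in> borel_subsets S" "l \<ge> 1" "\<And>z. z \<in> B \<Longrightarrow> m z = l"
  shows "op_pow (N B) l = 0"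
proof -
  have "\<forall>l\<ge>1. \<forall>B\<in>borel_subsets S. (\<forall>z\<in>B. m z \<le> l) \<longrightarrow> op_pow (N B) l = 0"
    using decomposition unfolding spectral_decomposition_def Let_def by blast
  then show ?thesis using assms by simp
qed

lemma level_set_borel: "{z\<in>S. m z = j} \<in> borel_subsets S"
proof -
  have le: "{z\<in>S. m z \<le> l} \<in> sets borel" for l
    using decomposition unfolding spectral_decomposition_def Let_def by blast
  \<comment> \<open>The case \<open>j = 0\<close> is separate because subtraction of naturals is
    truncated.\<close>
  have "{z\<in>S. m z = j} = {z\<in>S. m z \<le> j} - (if j = 0 then {} else {z\<in>S. m z \<le> j - 1})"
    by auto
  then show ?thesis
    using le[of j] le[of "j - 1"] by (auto simp: borel_subsets_def)
qed

lemma level_set_0: "{z\<in>S. m z = 0} = {}"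
proof -
  have "\<forall>z\<in>S. 1 \<le> m z"
    using decomposition unfolding spectral_decomposition_def Let_def by blast
  then show ?thesis by fastforce
qed

lemma E_scalar: "B \<in> borel_subsets S \<Longrightarrow> E B (c *\<^sub>C x) = c *\<^sub>C E B x"
  using E_linear complex_linear_apply by blast

text \<open>The decomposition states commutation with \<open>E C\<close> for the part
  \<open>N S\<close> of \<open>X\<close>. The scalar part is a strong limit of combinations of
  projections, each commuting with \<open>E C\<close>, and commutation passes to the limit.\<close>

lemma X_E_commute:
  assumes C: "C \<in> borel_subsets S"
  shows "X o\<^sub>L E C = E C o\<^sub>L X"
proof -
  define L where "L = spectral_integral E S scalar_op"
  have X: "X = L + N S"
    using decomposition unfolding spectral_decomposition_def Let_def L_def by blast
  have "spectral_integrable E S scalar_op"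
    using decomposition S_subset unfolding spectral_decomposition_def Let_def by blast
  then have "has_spectral_integral E S scalar_op L"
    unfolding spectral_integrable_def L_def using spectral_integral_unique by blast
  then have L: "((\<lambda>P. (\<Sum>(a, A)\<in>P. scalar_op a o\<^sub>L E A) x) \<longlongrightarrow> L x) (refinement_filter S)" for x
    by (simp add: has_spectral_integral_def)
  have LC: "L (E C x) = E C (L x)" for x
  proof -
    \<comment> \<open>The coarsest partition serves to know that the filter eventually consists of
      tagged partitions. If \<open>S\<close> is empty, it has no blocks, since blocks are
      nonempty.\<close>
    have "finite_borel_partition S (if S = {} then {} else {S})"
      using S_borel by (auto simp: finite_borel_partition_def partition_on_def disjoint_def)
    from eventually_refinement_filter[OF this]
    have "\<forall>\<^sub>F P in refinement_filter S. (\<Sum>(a, A)\<in>P. scalar_op a o\<^sub>L E A) (E C x) = E C ((\<Sum>(a, A)\<in>P. scalar_op a o\<^sub>L E A) x)"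
    proof eventually_elim
      case (elim P)
      then have P: "snd y \<in> borel_subsets S" if "y \<in> P" for y
        using tagged_partitionD(5) that by blast
      show ?case
        unfolding blinfun.sum_left blinfun.sum_right case_prod_unfold
        by (intro sum.cong refl) (simp add: scalar_op_apply P E_apply C E_scalar Int_commute)
    qed
    moreover have "((\<lambda>P. E C ((\<Sum>(a, A)\<in>P. scalar_op a o\<^sub>L E A) x)) \<longlongrightarrow> E C (L x)) (refinement_filter S)"
      by (intro tendsto_intros L)
    ultimately have "((\<lambda>P. (\<Sum>(a, A)\<in>P. scalar_op a o\<^sub>L E A) (E C x)) \<longlongrightarrow> E C (L x)) (refinement_filter S)"
      by (simp add: tendsto_cong)
    then show ?thesis
      using tendsto_unique[OF refinement_filter_neq_bot L] by blast
  qed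
  have "N S (E C x) = E C (N S x)" for x
    using N_comp[OF S_subset C] by (metis blinfun_apply_blinfun_compose)
  then show ?thesis
    unfolding blinfun_eq_iff by (subst (1 2) X) (simp add: blinfun.bilinear_simps LC)
qed

lemma X_E_apply: "C \<in> borel_subsets S \<Longrightarrow> E C (X x) = X (E C x)"
  using X_E_commute by (metis blinfun_apply_blinfun_compose)

lemma shift_E_commute:
  "C \<in> borel_subsets S \<Longrightarrow> op_pow (X - scalar_op a) q o\<^sub>L E C = E C o\<^sub>L op_pow (X - scalar_op a) q"
  by (rule op_pow_commute)
    (simp add: blinfun_eq_iff blinfun.bilinear_simps X_E_apply scalar_op_apply E_scalar)

lemma shift_E_apply:
  "C \<in> borel_subsets S \<Longrightarrow> E C (op_pow (X - scalar_op a) q x) = op_pow (X - scalar_op a) q (E C x)"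
  using shift_E_commute by (metis blinfun_apply_blinfun_compose)

lemma resolvent_E_commute:
  assumes C: "C \<in> borel_subsets S" and z: "z \<notin> S"
  shows "resolvent X z o\<^sub>L E C = E C o\<^sub>L resolvent X z"
proof (rule blinfun_eqI)
  fix x
  have inv: "resolvent X z ((scalar_op z - X) y) = y" "(scalar_op z - X) (resolvent X z y) = y" for y
    using op_inverse_resolvent[OF z] unfolding op_inverse_def blinfun_eq_iff by simp_all
  have "E C x = E C ((scalar_op z - X) (resolvent X z x))"
    by (simp add: inv)
  also have "\<dots> = (scalar_op z - X) (E C (resolvent X z x))"
    using C by (simp add: blinfun.bilinear_simps X_E_apply scalar_op_apply E_scalar)
  finally show "(resolvent X z o\<^sub>L E C) x = (E C o\<^sub>L resolvent X z) x"
    by (simp add: inv)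
qed

text \<open>The Riemann sum that Cauchy's formula leaves in one variable. It should approximate
  \<open>resolvent X z\<close>; the number of Taylor terms is read off at the tag.\<close>

definition rsum :: "complex \<Rightarrow> (complex \<times> complex set) set \<Rightarrow> 'a \<Rightarrow>\<^sub>L 'a"
  where "rsum z P = (\<Sum>(a, A)\<in>P. resolvent_jet X (m a) z a o\<^sub>L E A)"

lemma jet_E_apply:
  "C \<in> borel_subsets S \<Longrightarrow> E C (resolvent_jet X n z a x) = resolvent_jet X n z a (E C x)"
  by (simp add: resolvent_jet_def blinfun.bilinear_simps scalar_op_apply E_scalar shift_E_apply)

lemma rsum_E_commute:
  assumes P: "tagged_partition S P" and C: "C \<in> borel_subsets S"
  shows "rsum z P o\<^sub>L E C = E C o\<^sub>L rsum z P"
proof (rule blinfun_eqI)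
  fix x
  have "resolvent_jet X (m (fst y)) z (fst y) (E (snd y) (E C x)) =
      E C (resolvent_jet X (m (fst y)) z (fst y) (E (snd y) x))" if "y \<in> P" for y
    using tagged_partitionD(5)[OF P that] C by (simp add: jet_E_apply E_apply Int_commute)
  then show "(rsum z P o\<^sub>L E C) x = (E C o\<^sub>L rsum z P) x"
    by (simp add: rsum_def case_prod_unfold blinfun.bilinear_simps)
qed

end

section \<open>Norm approximation of the nilpotent part and convergence of the Riemann sums on level
  sets\<close>

context spectral_op
begin

definition parts_in :: "complex set \<Rightarrow> (complex \<times> complex set) set \<Rightarrow> (complex \<times> complex set) set"
  where "parts_in C P = {y\<in>P. snd y \<subseteq> C}"

text \<open>A Riemann sum for \<open>N C\<close> when \<open>P\<close> is a partition of
  \<open>C\<close>: a single operator whose powers encode the powers of \<open>X - a\<close> on all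
  parts at once.\<close>

definition shift_sum :: "(complex \<times> complex set) set \<Rightarrow> 'a \<Rightarrow>\<^sub>L 'a"
  where "shift_sum P = (\<Sum>y\<in>P. (X - scalar_op (fst y)) o\<^sub>L E (snd y))"

lemma tagged_partition_parts_in:
  assumes P: "tagged_partition S P" and C: "C \<subseteq> S"
    and split: "\<And>y. y \<in> P \<Longrightarrow> snd y \<subseteq> C \<or> snd y \<inter> C = {}"
  shows "tagged_partition C (parts_in C P)"
proof -
  note P' = tagged_partitionD[OF P]
  have "partition_on C (snd ` parts_in C P)"
  proof (rule partition_onI)
    show "\<Union> (snd ` parts_in C P) = C"
    proof
      show "C \<subseteq> \<Union> (snd ` parts_in C P)"
      proof
        fix z assume z: "z \<in> C"
        then obtain y where "y \<in> P" "z \<in> snd y" using P'(3) C by blast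
        then show "z \<in> \<Union> (snd ` parts_in C P)"
          using z split[of y] unfolding parts_in_def by blast
      qed
    qed (auto simp: parts_in_def)
    show "disjnt p q" if pq: "p \<in> snd ` parts_in C P" "q \<in> snd ` parts_in C P" "p \<noteq> q" for p q
    proof -
      obtain y y' where "y \<in> P" "y' \<in> P" "p = snd y" "q = snd y'"
        using pq(1,2) unfolding parts_in_def by blast
      then show ?thesis
        using disjoint_family_onD[OF P'(2), of y y'] pq(3) by (auto simp: disjnt_def)
    qed
    show "{} \<notin> snd ` parts_in C P"
      using P'(4) by (force simp: parts_in_def)
  qed
  moreover have "inj_on snd (parts_in C P)"
    using P unfolding tagged_partition_def by (auto simp: parts_in_def inj_on_def)
  ultimately show ?thesis
    using P P'(1,4,5) unfolding tagged_partition_def finite_borel_partition_def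
    by (auto simp: parts_in_def borel_subsets_def)
qed

lemma sum_E_parts:
  assumes "tagged_partition C P" "C \<subseteq> S"
  shows "(\<Sum>y\<in>P. E (snd y)) = E C"
proof -
  note P' = tagged_partitionD[OF assms(1)]
  have "\<And>y. y \<in> P \<Longrightarrow> snd y \<in> borel_subsets S"
    using P'(5) assms(2) by (auto simp: borel_subsets_def)
  from E_UN[OF P'(1) this P'(2)] show ?thesis
    by (simp add: P'(3))
qed

text \<open>Both sums contain the same \<open>X E(C)\<close>, so only the tags matter. Over the
  common refinement the difference is a sum of projections weighted by differences of tags, and
  these are at most \<open>d\<close> because the tag of a part of \<open>P'\<close> lies in the part
  of \<open>P\<close> that contains it.\<close>

lemma shift_sum_diff_le:
  assumes P: "tagged_partition C P" and P': "tagged_partition C P'" and C: "C \<in> borel_subsets S"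
    and ref: "refines C (snd ` P') (snd ` P)"
    and mesh: "\<And>y a b. y \<in> P \<Longrightarrow> a \<in> snd y \<Longrightarrow> b \<in> snd y \<Longrightarrow> dist a b \<le> d" and d: "d \<ge> 0"
  shows "norm (shift_sum P - shift_sum P') \<le> 4 * E_bound * d"
proof -
  have CS: "C \<subseteq> S" using C by (simp add: borel_subsets_def)
  note p = tagged_partitionD[OF P] and p' = tagged_partitionD[OF P']
  have b: "snd y \<in> borel_subsets S" if "y \<in> P" for y
    using p(5)[OF that] CS by (auto simp: borel_subsets_def)
  have b': "snd y \<in> borel_subsets S" if "y \<in> P'" for y
    using p'(5)[OF that] CS by (auto simp: borel_subsets_def)
  have eC: "E C x = (\<Sum>y\<in>P. E (snd y) x)" "E C x = (\<Sum>y\<in>P'. E (snd y) x)" for x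
    using arg_cong[OF sum_E_parts[OF P CS], of "\<lambda>T. T x"] arg_cong[OF sum_E_parts[OF P' CS], of "\<lambda>T. T x"]
    by (simp_all add: blinfun.sum_left)
  have sub: "E (snd y) x = E C (E (snd y) x)" if "snd y \<in> borel_subsets S" "snd y \<subseteq> C" for y :: "complex \<times> complex set" and x
    using E_apply[OF C that(1)] that(2) by (simp add: Int_absorb1)
  \<comment> \<open>On empty intersections the projection vanishes, while the tags are unrelated and
    may be far apart; the coefficient is therefore set to zero there.\<close>
  define c where "c y = (if snd (fst y) \<inter> snd (snd y) = {} then 0 else fst (fst y) - fst (snd y))"
    for y :: "(complex \<times> complex set) \<times> (complex \<times> complex set)"
  have eq: "shift_sum P - shift_sum P' =
      (\<Sum>y\<in>P' \<times> P. scalar_op (c y) o\<^sub>L E (snd (fst y) \<inter> snd (snd y)))"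
  proof (rule blinfun_eqI)
    fix x
    have 1: "shift_sum P x = X (E C x) - (\<Sum>y\<in>P. fst y *\<^sub>C E (snd y) x)"
      unfolding eC(1) by (simp add: shift_sum_def blinfun.bilinear_simps scalar_op_apply sum_subtractf)
    have 2: "shift_sum P' x = X (E C x) - (\<Sum>y\<in>P'. fst y *\<^sub>C E (snd y) x)"
      unfolding eC(2) by (simp add: shift_sum_def blinfun.bilinear_simps scalar_op_apply sum_subtractf)
    have 3: "(\<Sum>y\<in>P. fst y *\<^sub>C E (snd y) x) = (\<Sum>y'\<in>P'. \<Sum>y\<in>P. fst y *\<^sub>C E (snd y' \<inter> snd y) x)"
    proof (subst sum.swap, rule sum.cong[OF refl])
      fix y assume y: "y \<in> P"
      have "E (snd y) x = E C (E (snd y) x)"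
        using sub[OF b[OF y]] p(3) y by blast
      also have "\<dots> = (\<Sum>y'\<in>P'. E (snd y' \<inter> snd y) x)"
        unfolding eC(2) using b[OF y] b' by (simp add: E_apply)
      finally show "fst y *\<^sub>C E (snd y) x = (\<Sum>y'\<in>P'. fst y *\<^sub>C E (snd y' \<inter> snd y) x)"
        by (simp add: scaleC.sum_right)
    qed
    have 4: "(\<Sum>y'\<in>P'. fst y' *\<^sub>C E (snd y') x) = (\<Sum>y'\<in>P'. \<Sum>y\<in>P. fst y' *\<^sub>C E (snd y' \<inter> snd y) x)"
    proof (rule sum.cong[OF refl])
      fix y' assume y': "y' \<in> P'"
      have "E (snd y') x = E C (E (snd y') x)"
        using sub[OF b'[OF y']] p'(3) y' by blast
      also have "\<dots> = (\<Sum>y\<in>P. E (snd y' \<inter> snd y) x)"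
        unfolding eC(1) using b'[OF y'] b by (simp add: E_apply Int_commute)
      finally show "fst y' *\<^sub>C E (snd y') x = (\<Sum>y\<in>P. fst y' *\<^sub>C E (snd y' \<inter> snd y) x)"
        by (simp add: scaleC.sum_right)
    qed
    have "(shift_sum P - shift_sum P') x = (\<Sum>y'\<in>P'. \<Sum>y\<in>P. (fst y' - fst y) *\<^sub>C E (snd y' \<inter> snd y) x)"
      by (simp add: blinfun.diff_left 1 2 3 4 sum_subtractf scaleC.diff_left)
    also have "\<dots> = (\<Sum>y\<in>P' \<times> P. c y *\<^sub>C E (snd (fst y) \<inter> snd (snd y)) x)"
      unfolding sum.cartesian_product case_prod_unfold
      by (rule sum.cong) (auto simp: c_def E_empty scaleC.bilinear_simps)
    finally show "(shift_sum P - shift_sum P') x = (\<Sum>y\<in>P' \<times> P. scalar_op (c y) o\<^sub>L E (snd (fst y) \<inter> snd (snd y))) x"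
      by (simp add: blinfun.bilinear_simps scalar_op_apply)
  qed
  show ?thesis
    unfolding eq
  proof (rule norm_weighted_E_sum_le)
    show "finite (P' \<times> P)" using p(1) p'(1) by simp
    show "disjoint_family_on (\<lambda>y. snd (fst y) \<inter> snd (snd y)) (P' \<times> P)"
      unfolding disjoint_family_on_def
    proof (intro ballI impI)
      fix y y' assume "y \<in> P' \<times> P" "y' \<in> P' \<times> P" "y \<noteq> y'"
      then have "snd (fst y) \<inter> snd (fst y') = {} \<or> snd (snd y) \<inter> snd (snd y') = {}"
        using disjoint_family_onD[OF p(2), of "snd y" "snd y'"] disjoint_family_onD[OF p'(2), of "fst y" "fst y'"]
        by (auto simp: mem_Times_iff prod_eq_iff)
      then show "snd (fst y) \<inter> snd (snd y) \<inter> (snd (fst y') \<inter> snd (snd y')) = {}" by blast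
    qed
    show "cmod (c y) \<le> d" if "y \<in> P' \<times> P" for y
    proof (cases "snd (fst y) \<inter> snd (snd y) = {}")
      case False
      have y: "fst y \<in> P'" "snd y \<in> P" using that by auto
      obtain v where v: "v \<in> P" "snd (fst y) \<subseteq> snd v"
        using ref y(1) unfolding refines_def by blast
      have "snd v \<inter> snd (snd y) \<noteq> {}"
        using False v(2) by blast
      then have "v = snd y"
        using disjoint_family_onD[OF p(2) v(1) y(2)] by blast
      then have "fst (fst y) \<in> snd (snd y)" "fst (snd y) \<in> snd (snd y)"
        using v(2) p'(4)[OF y(1)] p(4)[OF y(2)] by auto
      then show ?thesis
        using mesh[OF y(2)] by (simp add: c_def False dist_norm)
    qed (simp add: c_def d)
    show "snd (fst y) \<inter> snd (snd y) \<in> borel_subsets S" if "y \<in> P' \<times> P" for y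
      using that b[of "snd y"] b'[of "fst y"] by (auto intro: borel_subsets_Int)
  qed (rule d)
qed

text \<open>\<open>N C\<close> is a strong limit of sums over refinements of \<open>P\<close>. The
  distance of these from \<open>shift_sum P\<close> is bounded in norm uniformly over the
  refinements, and such a bound survives a strong limit.\<close>

lemma shift_sum_near_N:
  assumes P: "tagged_partition C P" and C: "C \<in> borel_subsets S"
    and mesh: "\<And>y a b. y \<in> P \<Longrightarrow> a \<in> snd y \<Longrightarrow> b \<in> snd y \<Longrightarrow> dist a b \<le> d" and d: "d \<ge> 0"
  shows "norm (shift_sum P - N C) \<le> 4 * E_bound * d"
proof (rule norm_blinfun_bound)
  fix x
  have "((\<lambda>P'. (\<Sum>(a, A)\<in>P'. op_pow (X - scalar_op a) 1 o\<^sub>L E A) x) \<longlongrightarrow> N C x) (refinement_filter C)"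
    using N_has_integral[OF C] by (simp add: has_spectral_integral_def)
  then have "((\<lambda>P'. shift_sum P' x) \<longlongrightarrow> N C x) (refinement_filter C)"
    by (simp add: shift_sum_def case_prod_unfold op_pow_Suc op_pow_0 blinfun.sum_left)
  then have lim: "((\<lambda>P'. shift_sum P x - shift_sum P' x) \<longlongrightarrow> shift_sum P x - N C x) (refinement_filter C)"
    by (rule tendsto_diff[OF tendsto_const])
  have "finite_borel_partition C (snd ` P)"
    using P by (simp add: tagged_partition_def)
  from eventually_refinement_filter[OF this]
  have "\<forall>\<^sub>F P' in refinement_filter C. norm (shift_sum P x - shift_sum P' x) \<le> 4 * E_bound * d * norm x"
  proof eventually_elim
    case (elim P')
    have "norm (shift_sum P - shift_sum P') \<le> 4 * E_bound * d"
      by (rule shift_sum_diff_le[OF P _ C]) (use elim mesh d in blast)+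
    then have "norm ((shift_sum P - shift_sum P') x) \<le> 4 * E_bound * d * norm x"
      using norm_blinfun mult_right_mono norm_ge_zero order_trans by metis
    then show ?case by (simp add: blinfun.diff_left)
  qed
  from Lim_norm_ubound[OF refinement_filter_neq_bot lim this]
  show "norm ((shift_sum P - N C) x) \<le> 4 * E_bound * d * norm x"
    by (simp add: blinfun.diff_left)
qed (use E_bound(1) d in simp)

text \<open>Disjointness removes all terms but that of \<open>snd y\<close>, on whose range
  \<open>shift_sum P\<close> acts as \<open>X - a\<close> with \<open>a\<close> the tag. The powers
  of \<open>X - a\<close> for the various tags thus all come from one operator.\<close>

lemma E_shift_sum_pow:
  assumes P: "tagged_partition C P" and C: "C \<in> borel_subsets S" and y: "y \<in> P"
  shows "E (snd y) o\<^sub>L op_pow (shift_sum P) n = op_pow (X - scalar_op (fst y)) n o\<^sub>L E (snd y)"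
proof (induction n)
  case 0
  then show ?case by (simp add: op_pow_0 blinfun_eq_iff)
next
  case (Suc n)
  have CS: "C \<subseteq> S" using C by (simp add: borel_subsets_def)
  note p = tagged_partitionD[OF P]
  have b: "snd y \<in> borel_subsets S" if "y \<in> P" for y
    using p(5)[OF that] CS by (auto simp: borel_subsets_def)
  have one: "E (snd y) (shift_sum P x) = (X - scalar_op (fst y)) (E (snd y) x)" for x
  proof -
    have "E (snd y) (shift_sum P x) = (\<Sum>y'\<in>P. (X - scalar_op (fst y')) (E (snd y \<inter> snd y') x))"
      using b y by (simp add: shift_sum_def blinfun.bilinear_simps scalar_op_apply X_E_apply E_scalar E_apply)
    also have "\<dots> = (\<Sum>y'\<in>P. if y' = y then (X - scalar_op (fst y)) (E (snd y) x) else 0)"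
    proof (rule sum.cong[OF refl])
      fix y' assume "y' \<in> P"
      then have "snd y \<inter> snd y' = {}" if "y' \<noteq> y"
        using p(2) y that unfolding disjoint_family_on_def by blast
      then show "(X - scalar_op (fst y')) (E (snd y \<inter> snd y') x) = (if y' = y then (X - scalar_op (fst y)) (E (snd y) x) else 0)"
        by (auto simp: E_empty blinfun.bilinear_simps)
    qed
    also have "\<dots> = (X - scalar_op (fst y)) (E (snd y) x)"
      using p(1) y by simp
    finally show ?thesis .
  qed
  have IH: "E (snd y) (op_pow (shift_sum P) n x) = op_pow (X - scalar_op (fst y)) n (E (snd y) x)" for x
    using Suc by (metis blinfun_apply_blinfun_compose)
  show ?case
    unfolding op_pow_Suc by (rule blinfun_eqI) (simp add: one IH)
qed

text \<open>On each part inside \<open>C\<close> the geometric identity leaves the remainder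
  \<open>((X - a) / (z - a)) ^ j\<close>. As \<open>m\<close> is constant on \<open>C\<close>, the
  exponent is the same for all parts, and the power of the shift sum factors out.\<close>

lemma E_rsum_diff:
  assumes P: "tagged_partition S P" and C: "C \<in> borel_subsets S"
    and mC: "\<And>z. z \<in> C \<Longrightarrow> m z = j"
    and split: "\<And>y. y \<in> P \<Longrightarrow> snd y \<subseteq> C \<or> snd y \<inter> C = {}"
    and z: "z \<notin> S"
  shows "(E C o\<^sub>L resolvent X z) - (E C o\<^sub>L rsum z P) =
    (\<Sum>y\<in>parts_in C P. scalar_op (1 / (z - fst y) ^ j) o\<^sub>L E (snd y)) o\<^sub>L
      op_pow (shift_sum (parts_in C P)) j o\<^sub>L resolvent X z"
proof (rule blinfun_eqI)
  fix x
  have CS: "C \<subseteq> S" using C by (simp add: borel_subsets_def)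
  note p = tagged_partitionD[OF P]
  define Q where "Q = parts_in C P"
  have Q: "tagged_partition C Q"
    unfolding Q_def by (rule tagged_partition_parts_in[OF P CS]) (rule split)
  note q = tagged_partitionD[OF Q]
  have qb: "snd y \<in> borel_subsets S" if "y \<in> Q" for y
    using q(5)[OF that] CS by (auto simp: borel_subsets_def)
  \<comment> \<open>Writing \<open>x\<close> as \<open>(z - X) w\<close> makes the jets act on
    exactly the product that \<open>resolvent_jet_geometric\<close> computes.\<close>
  define w where "w = resolvent X z x"
  have x: "x = (scalar_op z - X) w"
    using op_inverse_resolvent[OF z] unfolding op_inverse_def blinfun_eq_iff w_def by simp
  have QP: "Q \<subseteq> P" by (auto simp: Q_def parts_in_def)
  have "E C (rsum z P x) = (\<Sum>y\<in>P. resolvent_jet X (m (fst y)) z (fst y) (E (snd y \<inter> C) x))"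
    using p(5) C by (simp add: rsum_def case_prod_unfold blinfun.bilinear_simps jet_E_apply E_apply Int_commute)
  also have "\<dots> = (\<Sum>y\<in>Q. resolvent_jet X (m (fst y)) z (fst y) (E (snd y \<inter> C) x))"
  proof (rule sum.mono_neutral_right[OF p(1) QP], rule ballI)
    fix y assume "y \<in> P - Q"
    then have "snd y \<inter> C = {}" using split[of y] unfolding Q_def parts_in_def by blast
    then show "resolvent_jet X (m (fst y)) z (fst y) (E (snd y \<inter> C) x) = 0"
      by (simp add: E_empty blinfun.bilinear_simps)
  qed
  also have "\<dots> = (\<Sum>y\<in>Q. E (snd y) w - (1 / (z - fst y) ^ j) *\<^sub>C E (snd y) (op_pow (shift_sum Q) j w))"
  proof (rule sum.cong[OF refl])
    fix y assume y: "y \<in> Q"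
    have sub: "snd y \<subseteq> C" using y by (auto simp: Q_def parts_in_def)
    have ma: "m (fst y) = j" using mC q(4)[OF y] sub by blast
    have "fst y \<in> S" using q(4)[OF y] sub CS by blast
    then have za: "z \<noteq> fst y" using z by blast
    have "E (snd y) x = (scalar_op z - X) (E (snd y) w)"
      unfolding x using qb[OF y] by (simp add: blinfun.bilinear_simps X_E_apply scalar_op_apply E_scalar)
    then have "resolvent_jet X j z (fst y) (E (snd y) x) =
        (resolvent_jet X j z (fst y) o\<^sub>L (scalar_op z - X)) (E (snd y) w)"
      by simp
    also have "\<dots> = E (snd y) w - (1 / (z - fst y) ^ j) *\<^sub>C op_pow (X - scalar_op (fst y)) j (E (snd y) w)"
      unfolding resolvent_jet_geometric[OF X_linear za] by (simp add: blinfun.diff_left scalar_op_apply)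
    also have "op_pow (X - scalar_op (fst y)) j (E (snd y) w) = E (snd y) (op_pow (shift_sum Q) j w)"
      using E_shift_sum_pow[OF Q C y, of j] by (metis blinfun_apply_blinfun_compose)
    finally show "resolvent_jet X (m (fst y)) z (fst y) (E (snd y \<inter> C) x) =
        E (snd y) w - (1 / (z - fst y) ^ j) *\<^sub>C E (snd y) (op_pow (shift_sum Q) j w)"
      using sub by (simp add: ma Int_absorb2)
  qed
  also have "\<dots> = E C w - (\<Sum>y\<in>Q. (1 / (z - fst y) ^ j) *\<^sub>C E (snd y) (op_pow (shift_sum Q) j w))"
    unfolding sum_E_parts[OF Q CS, symmetric] by (simp add: sum_subtractf blinfun.sum_left)
  finally show "((E C o\<^sub>L resolvent X z) - (E C o\<^sub>L rsum z P)) x =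
    ((\<Sum>y\<in>parts_in C P. scalar_op (1 / (z - fst y) ^ j) o\<^sub>L E (snd y)) o\<^sub>L
      op_pow (shift_sum (parts_in C P)) j o\<^sub>L resolvent X z) x"
    by (simp add: w_def Q_def blinfun.diff_left blinfun.sum_left scalar_op_apply)
qed

text \<open>In the product of \<open>E_rsum_diff\<close> the weighted sum is bounded by
  \<open>k\<close> and the resolvent by \<open>K\<close>, for all \<open>z\<close> in
  \<open>Z\<close> and all fine partitions. Only the power of the shift sum has to be small; it
  involves no \<open>z\<close>, and it is close to the vanishing power of \<open>N C\<close> once
  the mesh is small.\<close>

lemma rsum_uniform_limit:
  assumes Z: "compact Z" "Z \<inter> S = {}" and C: "C \<in> borel_subsets S"
    and mC: "\<And>z. z \<in> C \<Longrightarrow> m z = j" and j: "j \<ge> 1" and e: "e > 0"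
  shows "\<forall>\<^sub>F P in refinement_filter S. tagged_partition S P \<and>
    (\<forall>z\<in>Z. norm ((E C o\<^sub>L rsum z P) - (E C o\<^sub>L resolvent X z)) \<le> e)"
proof -
  obtain K where K: "K > 0" "\<And>z. z \<in> Z \<Longrightarrow> norm (resolvent X z) \<le> K"
    using resolvent_bounded_on_compact[OF Z] by blast
  obtain \<delta> where \<delta>: "\<delta> > 0" "\<And>z a. z \<in> Z \<Longrightarrow> a \<in> S \<Longrightarrow> \<delta> \<le> dist z a"
    using separate_compact_closed[OF Z(1) closed_spectrum Z(2)] by blast
  \<comment> \<open>The points of \<open>Z\<close> keep distance \<open>\<delta>\<close> from the
    spectrum, so the weights are at most \<open>1 / \<delta> ^ j\<close>.\<close>
  define k where "k = 4 * E_bound * (1 / \<delta> ^ j)"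
  have k: "k > 0" using E_bound(1) \<delta>(1) by (simp add: k_def)
  have "((\<lambda>U. op_pow U j) \<longlongrightarrow> op_pow (N C) j) (nhds (N C))"
    by (rule tendsto_op_pow) (simp add: filterlim_ident)
  then have "((\<lambda>U. op_pow U j) \<longlongrightarrow> 0) (nhds (N C))"
    by (subst (asm) N_nilpotent[OF C j]) (use mC in blast)+
  then have "\<forall>\<^sub>F U in nhds (N C). dist (op_pow U j) 0 < e / (k * K)"
    using e k K(1) by (intro tendstoD) simp_all
  then obtain \<eta> where \<eta>: "\<eta> > 0" "\<And>U. dist U (N C) < \<eta> \<Longrightarrow> norm (op_pow U j) < e / (k * K)"
    unfolding eventually_nhds_metric by auto
  \<comment> \<open>Makes the error \<open>4 * E_bound * d\<close> of
    \<open>shift_sum_near_N\<close> equal to \<open>\<eta> / 2\<close>.\<close>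
  define d where "d = \<eta> / (8 * E_bound)"
  have d: "d > 0" "4 * E_bound * d < \<eta>"
    using \<eta>(1) E_bound(1) by (auto simp: d_def)
  have CS: "C \<subseteq> S" "C \<in> sets borel" using C by (auto simp: borel_subsets_def)
  obtain Q where Q: "finite_borel_partition S Q"
    and fine: "\<forall>A\<in>Q. (A \<subseteq> C \<or> A \<inter> C = {}) \<and> (\<forall>a\<in>A. \<forall>b\<in>A. dist a b \<le> d)"
    using fine_partition_exists[OF S_borel bounded_spectrum CS(2) d(1)] by (elim exE conjE)
  show ?thesis
    using eventually_refinement_filter[OF Q]
  proof eventually_elim
    case (elim P)
    then have P: "tagged_partition S P" and ref: "\<And>y. y \<in> P \<Longrightarrow> \<exists>A\<in>Q. snd y \<subseteq> A"
      unfolding refines_def by blast+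
    have split: "snd y \<subseteq> C \<or> snd y \<inter> C = {}" if y: "y \<in> P" for y
    proof -
      obtain A where "A \<in> Q" "snd y \<subseteq> A" using ref[OF y] by blast
      then show ?thesis using bspec[OF fine, of A] by auto
    qed
    have mesh: "dist a b \<le> d" if "y \<in> parts_in C P" "a \<in> snd y" "b \<in> snd y" for y a b
    proof -
      have "y \<in> P" using that(1) by (simp add: parts_in_def)
      then obtain A where "A \<in> Q" "snd y \<subseteq> A" using ref by blast
      then show ?thesis using bspec[OF fine, of A] that(2,3) by (simp add: subset_iff)
    qed
    have PC: "tagged_partition C (parts_in C P)"
      by (rule tagged_partition_parts_in[OF P CS(1)]) (rule split)
    note pc = tagged_partitionD[OF PC]
    have pb: "snd y \<in> borel_subsets S" if "y \<in> parts_in C P" for y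
      using pc(5)[OF that] CS by (auto simp: borel_subsets_def)
    have "norm (shift_sum (parts_in C P) - N C) \<le> 4 * E_bound * d"
      by (rule shift_sum_near_N[OF PC C]) (use mesh d(1) in auto)
    then have "dist (shift_sum (parts_in C P)) (N C) < \<eta>"
      using d(2) by (simp only: dist_norm)
    then have U: "norm (op_pow (shift_sum (parts_in C P)) j) < e / (k * K)"
      by (rule \<eta>(2))
    have "norm ((E C o\<^sub>L rsum z P) - (E C o\<^sub>L resolvent X z)) \<le> e" if z: "z \<in> Z" for z
    proof -
      have zS: "z \<notin> S" using z Z(2) by blast
      have V: "norm (\<Sum>y\<in>parts_in C P. scalar_op (1 / (z - fst y) ^ j) o\<^sub>L E (snd y)) \<le> k"
        unfolding k_def
      proof (rule norm_weighted_E_sum_le[OF pc(1) _ pc(2)])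
        fix y assume y: "y \<in> parts_in C P"
        have "fst y \<in> S" using pc(4)[OF y] pb[OF y] by (auto simp: borel_subsets_def)
        then have "\<delta> ^ j \<le> cmod (z - fst y) ^ j"
          using \<delta>(2)[OF z, of "fst y"] \<delta>(1) by (intro power_mono) (auto simp: dist_norm)
        then show "cmod (1 / (z - fst y) ^ j) \<le> 1 / \<delta> ^ j"
          using \<delta>(1) by (simp add: norm_divide norm_power frac_le)
      qed (use \<delta>(1) pb in auto)
      have diff: "(E C o\<^sub>L resolvent X z) - (E C o\<^sub>L rsum z P) =
          (\<Sum>y\<in>parts_in C P. scalar_op (1 / (z - fst y) ^ j) o\<^sub>L E (snd y)) o\<^sub>L
          op_pow (shift_sum (parts_in C P)) j o\<^sub>L resolvent X z"
        by (rule E_rsum_diff[OF P C]) (use mC split zS in blast)+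
      have "norm ((E C o\<^sub>L rsum z P) - (E C o\<^sub>L resolvent X z)) =
          norm ((E C o\<^sub>L resolvent X z) - (E C o\<^sub>L rsum z P))"
        by (rule norm_minus_commute)
      also have "\<dots> \<le> norm (\<Sum>y\<in>parts_in C P. scalar_op (1 / (z - fst y) ^ j) o\<^sub>L E (snd y)) *
          norm (op_pow (shift_sum (parts_in C P)) j) * norm (resolvent X z)"
        unfolding diff
        by (meson mult_right_mono norm_blinfun_compose norm_ge_zero order_trans)
      also have "\<dots> \<le> k * (e / (k * K)) * K"
        using V U K(2)[OF z] k K(1) e by (intro mult_mono) auto
      also have "\<dots> = e"
        using k K(1) by simp
      finally show ?thesis .
    qed
    then show ?case using P by blast
  qed
qed

end

section \<open>The Cauchy representation of double operator integrals\<close>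

locale kernel =
  fixes I :: "'i set" and p r :: "'i \<Rightarrow> real \<Rightarrow> complex" and g :: "'i \<Rightarrow> real \<times> real \<Rightarrow> complex"
    and V1 V2 \<beta>
  assumes kernel: "cauchy_kernel I p r g V1 V2 \<beta>"
begin

abbreviation "usq \<equiv> cbox (0::real, 0::real) (1, 1)"

definition "Z1 = (\<Union>i\<in>I. p i ` {0..1})"
definition "Z2 = (\<Union>i\<in>I. r i ` {0..1})"

lemma finite_I: "finite I"
  and cont_p: "i \<in> I \<Longrightarrow> continuous_on {0..1} (p i)"
  and cont_r: "i \<in> I \<Longrightarrow> continuous_on {0..1} (r i)"
  and cont_g: "i \<in> I \<Longrightarrow> continuous_on usq (g i)"
  and Z1_V1: "Z1 \<inter> V1 = {}" and Z2_V2: "Z2 \<inter> V2 = {}"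
  using kernel by (auto simp: cauchy_kernel_def Z1_def Z2_def)

lemma compact_Z: "compact Z1" "compact Z2"
  unfolding Z1_def Z2_def
  by (auto intro!: compact_UN finite_I compact_continuous_image cont_p cont_r)

lemma in_Z: "i \<in> I \<Longrightarrow> x \<in> usq \<Longrightarrow> p i (fst x) \<in> Z1" "i \<in> I \<Longrightarrow> x \<in> usq \<Longrightarrow> r i (snd x) \<in> Z2"
  by (cases x; force simp: Z1_def Z2_def)+

lemma cont_compose:
  assumes "i \<in> I"
  shows "continuous_on Z1 F \<Longrightarrow> continuous_on usq (\<lambda>x. F (p i (fst x)))"
    and "continuous_on Z2 F' \<Longrightarrow> continuous_on usq (\<lambda>x. F' (r i (snd x)))"
proof -
  have p: "continuous_on usq (\<lambda>x. p i (fst x))"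
    by (rule continuous_on_compose2[OF cont_p[OF assms]]) (auto intro!: continuous_intros)
  show "continuous_on Z1 F \<Longrightarrow> continuous_on usq (\<lambda>x. F (p i (fst x)))"
    by (rule continuous_on_compose2[OF _ p]) (use in_Z assms in auto)
  have r: "continuous_on usq (\<lambda>x. r i (snd x))"
    by (rule continuous_on_compose2[OF cont_r[OF assms]]) (auto intro!: continuous_intros)
  show "continuous_on Z2 F' \<Longrightarrow> continuous_on usq (\<lambda>x. F' (r i (snd x)))"
    by (rule continuous_on_compose2[OF _ r]) (use in_Z assms in auto)
qed

lemma partial_deriv_has_integral:
  assumes a: "a \<in> V1" and b: "b \<in> V2"
  shows "((\<lambda>x. \<Sum>i\<in>I. g i x / ((p i (fst x) - a) ^ Suc q1 * (r i (snd x) - b) ^ Suc q2))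
    has_integral partial_deriv q1 q2 \<beta> (a, b) / (fact q1 * fact q2)) usq"
proof -
  have eq: "partial_deriv q1 q2 \<beta> (a, b) / (fact q1 * fact q2) = (\<Sum>i\<in>I. integral usq
      (\<lambda>x. g i x / ((p i (fst x) - a) ^ Suc q1 * (r i (snd x) - b) ^ Suc q2)))"
    using kernel a b unfolding cauchy_kernel_def by blast
  have "continuous_on usq (\<lambda>x. g i x / ((p i (fst x) - a) ^ Suc q1 * (r i (snd x) - b) ^ Suc q2))"
    if i: "i \<in> I" for i
  proof -
    have "continuous_on Z1 (\<lambda>z. 1 / (z - a) ^ Suc q1)" "continuous_on Z2 (\<lambda>z. 1 / (z - b) ^ Suc q2)"
      using a b Z1_V1 Z2_V2 by (auto intro!: continuous_intros)
    from continuous_on_mult[OF continuous_on_mult[OF cont_g[OF i] cont_compose(1)[OF i this(1)]] cont_compose(2)[OF i this(2)]]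
    show ?thesis by simp
  qed
  then show ?thesis
    unfolding eq by (intro has_integral_sum finite_I integrable_integral integrable_continuous)
qed

text \<open>\<open>F\<close> and \<open>G\<close> are either resolvents or the finite sums
  \<open>rsum\<close>, so both sides of every comparison come from one construction. The cycles
  belong to the kernel and do not change with the operators.\<close>

definition cauchy_integrand ::
  "(complex \<Rightarrow> 'a::complex_hilbert \<Rightarrow>\<^sub>L 'a) \<Rightarrow> ('a \<Rightarrow>\<^sub>L 'a) \<Rightarrow> (complex \<Rightarrow> 'a \<Rightarrow>\<^sub>L 'a) \<Rightarrow> real \<times> real \<Rightarrow> 'a \<Rightarrow>\<^sub>L 'a"
  where "cauchy_integrand F Y G x =
    (\<Sum>i\<in>I. scalar_op (g i x) o\<^sub>L (F (p i (fst x)) o\<^sub>L Y o\<^sub>L G (r i (snd x))))"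

definition cauchy_op ::
  "(complex \<Rightarrow> 'a::complex_hilbert \<Rightarrow>\<^sub>L 'a) \<Rightarrow> ('a \<Rightarrow>\<^sub>L 'a) \<Rightarrow> (complex \<Rightarrow> 'a \<Rightarrow>\<^sub>L 'a) \<Rightarrow> 'a \<Rightarrow>\<^sub>L 'a"
  where "cauchy_op F Y G = integral usq (cauchy_integrand F Y G)"

lemma cauchy_integrand_integrable:
  assumes F: "continuous_on Z1 F" and G: "continuous_on Z2 G"
  shows "cauchy_integrand F Y G integrable_on usq"
proof -
  have "continuous_on usq (cauchy_integrand F Y G)"
    unfolding cauchy_integrand_def
    by (intro continuous_on_sum blinfun_comp.continuous_on continuous_on_const
        bounded_linear.continuous_on[OF bounded_linear_scalar_op] cont_g cont_compose(1)[OF _ F] cont_compose(2)[OF _ G])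
  then show ?thesis by (rule integrable_continuous)
qed

lemma g_bounded: "\<exists>B>0. \<forall>x\<in>usq. (\<Sum>i\<in>I. cmod (g i x)) \<le> B"
proof -
  have "compact ((\<lambda>x. \<Sum>i\<in>I. cmod (g i x)) ` usq)"
    by (intro compact_continuous_image continuous_on_sum continuous_on_norm cont_g compact_cbox)
  then have "bounded ((\<lambda>x. \<Sum>i\<in>I. cmod (g i x)) ` usq)" by (rule compact_imp_bounded)
  then obtain B where "B > 0" "\<forall>y\<in>(\<lambda>x. \<Sum>i\<in>I. cmod (g i x)) ` usq. norm y \<le> B"
    unfolding bounded_pos by blast
  then show ?thesis
    by (intro exI[of _ B]) (auto simp: abs_le_iff)
qed

definition "g_bound = (SOME B. B > 0 \<and> (\<forall>x\<in>usq. (\<Sum>i\<in>I. cmod (g i x)) \<le> B))"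

lemma g_bound: "g_bound > 0" "x \<in> usq \<Longrightarrow> (\<Sum>i\<in>I. cmod (g i x)) \<le> g_bound"
  using someI_ex[OF g_bounded] unfolding g_bound_def by auto

text \<open>Serves twice: to replace Riemann sums by resolvents, and to replace the resolvents of
  approximating operators by those of the limits. In \<open>(F - F') Y G + F' Y (G - G')\<close> the
  first term brings the factor \<open>K + 1\<close>, through \<open>d \<le> 1\<close>, and the
  second the factor \<open>K\<close>; the unit square has measure \<open>1\<close>.\<close>

lemma cauchy_op_diff_le:
  fixes F F' G G' :: "complex \<Rightarrow> 'a::complex_hilbert \<Rightarrow>\<^sub>L 'a"
  assumes cont: "continuous_on Z1 F" "continuous_on Z1 F'" "continuous_on Z2 G" "continuous_on Z2 G'"
    and F: "\<And>z. z \<in> Z1 \<Longrightarrow> norm (F z - F' z) \<le> d" and G: "\<And>z. z \<in> Z2 \<Longrightarrow> norm (G z - G' z) \<le> d"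
    and K: "\<And>z. z \<in> Z1 \<Longrightarrow> norm (F' z) \<le> K" "\<And>z. z \<in> Z2 \<Longrightarrow> norm (G' z) \<le> K" "K \<ge> 0"
    and d: "0 \<le> d" "d \<le> 1"
  shows "norm (cauchy_op F Y G - cauchy_op F' Y G') \<le> g_bound * (d * norm Y * (2 * K + 1))"
proof -
  have pointwise: "norm ((F z o\<^sub>L Y o\<^sub>L G w) - (F' z o\<^sub>L Y o\<^sub>L G' w)) \<le> d * norm Y * (2 * K + 1)"
    if z: "z \<in> Z1" and w: "w \<in> Z2" for z w
  proof -
    have eq: "(F z o\<^sub>L Y o\<^sub>L G w) - (F' z o\<^sub>L Y o\<^sub>L G' w) =
        ((F z - F' z) o\<^sub>L Y o\<^sub>L G w) + (F' z o\<^sub>L Y o\<^sub>L (G w - G' w))"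
      by (simp add: blinfun_eq_iff blinfun.bilinear_simps)
    have nc: "norm (A o\<^sub>L B o\<^sub>L C) \<le> norm A * norm B * norm C" for A B C :: "'a \<Rightarrow>\<^sub>L 'a"
      by (meson mult_right_mono norm_blinfun_compose norm_ge_zero order_trans)
    have Gw: "norm (G w) \<le> K + 1"
      using norm_triangle_sub[of "G w" "G' w"] K(2)[OF w] G[OF w] d(2) by linarith
    have "norm ((F z - F' z) o\<^sub>L Y o\<^sub>L G w) \<le> d * norm Y * (K + 1)"
      by (rule order_trans[OF nc]) (use F[OF z] Gw K(3) d in \<open>auto intro!: mult_mono\<close>)
    moreover have "norm (F' z o\<^sub>L Y o\<^sub>L (G w - G' w)) \<le> K * norm Y * d"
      by (rule order_trans[OF nc]) (use G[OF w] K(1)[OF z] K(3) d in \<open>auto intro!: mult_mono\<close>)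
    ultimately show ?thesis
      unfolding eq by (intro order_trans[OF norm_triangle_ineq]) (simp add: algebra_simps)
  qed
  have bound: "norm (cauchy_integrand F Y G x - cauchy_integrand F' Y G' x) \<le> g_bound * (d * norm Y * (2 * K + 1))"
    if x: "x \<in> usq" for x
  proof -
    have "cauchy_integrand F Y G x - cauchy_integrand F' Y G' x =
        (\<Sum>i\<in>I. scalar_op (g i x) o\<^sub>L ((F (p i (fst x)) o\<^sub>L Y o\<^sub>L G (r i (snd x))) - (F' (p i (fst x)) o\<^sub>L Y o\<^sub>L G' (r i (snd x)))))"
      by (simp add: cauchy_integrand_def blinfun_comp.diff_right sum_subtractf)
    also have "norm \<dots> \<le> (\<Sum>i\<in>I. cmod (g i x) * (d * norm Y * (2 * K + 1)))"
    proof (rule sum_norm_le)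
      fix i assume i: "i \<in> I"
      show "norm (scalar_op (g i x) o\<^sub>L ((F (p i (fst x)) o\<^sub>L Y o\<^sub>L G (r i (snd x))) - (F' (p i (fst x)) o\<^sub>L Y o\<^sub>L G' (r i (snd x)))))
          \<le> cmod (g i x) * (d * norm Y * (2 * K + 1))"
        using pointwise[OF in_Z[OF i x]] norm_scalar_op_le
        by (intro order_trans[OF norm_blinfun_compose] mult_mono) auto
    qed
    also have "\<dots> \<le> g_bound * (d * norm Y * (2 * K + 1))"
      unfolding sum_distrib_right[symmetric] using g_bound(2)[OF x] d K(3) by (intro mult_right_mono) auto
    finally show ?thesis .
  qed
  have "((\<lambda>x. cauchy_integrand F Y G x - cauchy_integrand F' Y G' x) has_integral (cauchy_op F Y G - cauchy_op F' Y G')) usq"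
    unfolding cauchy_op_def
    by (intro has_integral_diff integrable_integral cauchy_integrand_integrable cont)
  from has_integral_bound[OF _ this bound] show ?thesis
    using g_bound(1) d K(3) by (simp add: content_Pair)
qed

text \<open>Composition with fixed operators is bounded and linear, hence passes through the
  integral; complex linearity of \<open>A\<close> moves it past the coefficients
  \<open>g i x\<close>.\<close>

lemma comp_cauchy_op_comp:
  assumes F: "continuous_on Z1 F" and G: "continuous_on Z2 G" and A: "complex_linear A"
  shows "A o\<^sub>L cauchy_op F Y G o\<^sub>L B = cauchy_op (\<lambda>z. A o\<^sub>L F z) Y (\<lambda>w. G w o\<^sub>L B)"
proof -
  have lin: "bounded_linear (\<lambda>T. A o\<^sub>L T o\<^sub>L B)"
    by (rule bounded_linear_compose[OF blinfun_comp.bounded_linear_left blinfun_comp.bounded_linear_right])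
  have "(\<lambda>T. A o\<^sub>L T o\<^sub>L B) \<circ> cauchy_integrand F Y G = cauchy_integrand (\<lambda>z. A o\<^sub>L F z) Y (\<lambda>w. G w o\<^sub>L B)"
    by (intro ext blinfun_eqI)
      (simp add: cauchy_integrand_def blinfun.bilinear_simps scalar_op_apply complex_linear_apply[OF A])
  then show ?thesis
    using integral_linear[OF cauchy_integrand_integrable[OF F G, of Y] lin] by (simp add: cauchy_op_def)
qed

end

context spectral_op
begin

lemma continuous_on_rsum:
  assumes P: "tagged_partition S P" and Z: "Z \<inter> S = {}"
  shows "continuous_on Z (\<lambda>z. rsum z P)"
proof -
  have "fst y \<in> S" if "y \<in> P" for y
    using tagged_partitionD(3,4)[OF P] that by blast
  then have "fst y \<notin> Z" if "y \<in> P" for y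
    using that Z by blast
  then show ?thesis
    unfolding rsum_def resolvent_jet_def case_prod_unfold
    by (intro continuous_on_sum blinfun_comp.continuous_on continuous_on_const
        bounded_linear.continuous_on[OF bounded_linear_scalar_op]) (auto intro!: continuous_intros)
qed

end

section \<open>Identification of the double operator integral with the Cauchy operator\<close>

locale gdoi_kernel = kernel I p r g V1 V2 \<beta> +
    o1: spectral_op X1 E1 m1 + o2: spectral_op X2 E2 m2
  for I :: "'i set" and p r g V1 V2 \<beta>
    and X1 :: "'a::complex_hilbert \<Rightarrow>\<^sub>L 'a" and E1 m1 and X2 :: "'a \<Rightarrow>\<^sub>L 'a" and E2 m2 +
  fixes Y :: "'a \<Rightarrow>\<^sub>L 'a"
  assumes Y: "complex_linear Y" and SV: "spectrum X1 \<subseteq> V1" "spectrum X2 \<subseteq> V2"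
begin

lemma Z_S: "Z1 \<inter> spectrum X1 = {}" "Z2 \<inter> spectrum X2 = {}"
  using Z1_V1 Z2_V2 SV by blast+

lemma cont_resolvents: "continuous_on Z1 (resolvent X1)" "continuous_on Z2 (resolvent X2)"
  by (rule continuous_on_subset[OF continuous_on_resolvent], use Z_S in blast)+

text \<open>The denominator of the kernel is a product of a factor in \<open>a\<close> and a factor
  in \<open>b\<close>. At each point of the unit square the sum over parts and orders therefore
  splits into one over \<open>P1\<close> and one over \<open>P2\<close>, with \<open>Y\<close> in
  between. All sums are finite, so they commute with the integral.\<close>

lemma gdoi_sum_eq_cauchy_op:
  assumes P1: "tagged_partition (spectrum X1) P1" and P2: "tagged_partition (spectrum X2) P2"
  shows "gdoi_sum X1 E1 m1 X2 E2 m2 \<beta> Y P1 P2 = cauchy_op (\<lambda>z. o1.rsum z P1) Y (\<lambda>w. o2.rsum w P2)"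
proof -
  define W where "W y1 y2 q1 q2 = op_pow (X1 - scalar_op (fst y1)) q1 o\<^sub>L E1 (snd y1) o\<^sub>L Y o\<^sub>L
      (op_pow (X2 - scalar_op (fst y2)) q2 o\<^sub>L E2 (snd y2))"
    for y1 y2 :: "complex \<times> complex set" and q1 q2
  define c where "c i x y1 y2 q1 q2 = g i x / ((p i (fst x) - fst y1) ^ Suc q1 * (r i (snd x) - fst y2) ^ Suc q2)"
    for i x and y1 y2 :: "complex \<times> complex set" and q1 q2
  have V: "fst y1 \<in> V1" "fst y2 \<in> V2" if "y1 \<in> P1" "y2 \<in> P2" for y1 y2
    using tagged_partitionD(3,4)[OF P1] tagged_partitionD(3,4)[OF P2] that SV by blast+
  have gs: "gdoi_sum X1 E1 m1 X2 E2 m2 \<beta> Y P1 P2 = (\<Sum>y1\<in>P1. \<Sum>y2\<in>P2. \<Sum>q1<m1 (fst y1). \<Sum>q2<m2 (fst y2).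
      scalar_op (partial_deriv q1 q2 \<beta> (fst y1, fst y2) / (fact q1 * fact q2)) o\<^sub>L W y1 y2 q1 q2)"
    unfolding gdoi_sum_def case_prod_unfold W_def
    by (intro sum.cong refl blinfun_eqI) simp
  have lin: "bounded_linear (\<lambda>c. scalar_op c o\<^sub>L W y1 y2 q1 q2)" for y1 y2 q1 q2
    by (rule bounded_linear_compose[OF blinfun_comp.bounded_linear_left bounded_linear_scalar_op])
  have "((\<lambda>x. \<Sum>y1\<in>P1. \<Sum>y2\<in>P2. \<Sum>q1<m1 (fst y1). \<Sum>q2<m2 (fst y2).
      scalar_op (\<Sum>i\<in>I. c i x y1 y2 q1 q2) o\<^sub>L W y1 y2 q1 q2)
      has_integral gdoi_sum X1 E1 m1 X2 E2 m2 \<beta> Y P1 P2) usq"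
    unfolding gs c_def
    by (intro has_integral_sum finite_lessThan tagged_partitionD(1)[OF P1] tagged_partitionD(1)[OF P2]
        has_integral_linear[OF partial_deriv_has_integral lin, unfolded o_def] V)
  moreover have "(\<Sum>y1\<in>P1. \<Sum>y2\<in>P2. \<Sum>q1<m1 (fst y1). \<Sum>q2<m2 (fst y2).
      scalar_op (\<Sum>i\<in>I. c i x y1 y2 q1 q2) o\<^sub>L W y1 y2 q1 q2) =
      cauchy_integrand (\<lambda>z. o1.rsum z P1) Y (\<lambda>w. o2.rsum w P2) x" for x
  proof (rule blinfun_eqI)
    fix v
    have 1: "(\<Sum>y1\<in>P1. \<Sum>y2\<in>P2. \<Sum>q1<m1 (fst y1). \<Sum>q2<m2 (fst y2). \<Sum>i\<in>I. c i x y1 y2 q1 q2 *\<^sub>C W y1 y2 q1 q2 v) =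
      (\<Sum>i\<in>I. \<Sum>y1\<in>P1. \<Sum>y2\<in>P2. \<Sum>q1<m1 (fst y1). \<Sum>q2<m2 (fst y2). c i x y1 y2 q1 q2 *\<^sub>C W y1 y2 q1 q2 v)"
      by (simp only: sum.swap[where B = I])
    \<comment> \<open>Complex linearity of \<open>Y\<close> and of the operators to its left brings
      the scalars of the second variable to the front.\<close>
    have lin1: "op_pow (X1 - scalar_op a) q (E1 A (Y (c *\<^sub>C u))) = c *\<^sub>C op_pow (X1 - scalar_op a) q (E1 A (Y u))"
      if "A \<in> borel_subsets (spectrum X1)" for a q A c u
      using that o1.X_linear
      by (simp add: complex_linear_apply[OF Y] o1.E_scalar complex_linear_apply complex_linear_op_pow
          complex_linear_diff complex_linear_scalar_op)
    have 2: "(\<Sum>y1\<in>P1. \<Sum>y2\<in>P2. \<Sum>q1<m1 (fst y1). \<Sum>q2<m2 (fst y2). c i x y1 y2 q1 q2 *\<^sub>C W y1 y2 q1 q2 v) =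
      g i x *\<^sub>C o1.rsum (p i (fst x)) P1 (Y (o2.rsum (r i (snd x)) P2 v))" for i
    proof -
      have "(\<Sum>y2\<in>P2. \<Sum>q1<m1 (fst y1). \<Sum>q2<m2 (fst y2). c i x y1 y2 q1 q2 *\<^sub>C W y1 y2 q1 q2 v) =
          g i x *\<^sub>C (\<Sum>q1<m1 (fst y1). (1 / (p i (fst x) - fst y1) ^ Suc q1) *\<^sub>C
            op_pow (X1 - scalar_op (fst y1)) q1 (E1 (snd y1) (Y (o2.rsum (r i (snd x)) P2 v))))"
        if y1: "y1 \<in> P1" for y1
      proof -
        have A: "snd y1 \<in> borel_subsets (spectrum X1)"
          using tagged_partitionD(5)[OF P1 y1] .
        have "o2.rsum (r i (snd x)) P2 v = (\<Sum>y2\<in>P2. \<Sum>q2<m2 (fst y2). (1 / (r i (snd x) - fst y2) ^ Suc q2) *\<^sub>C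
            op_pow (X2 - scalar_op (fst y2)) q2 (E2 (snd y2) v))"
          by (simp add: o2.rsum_def resolvent_jet_def case_prod_unfold blinfun.sum_left scalar_op_apply)
        then have "g i x *\<^sub>C (\<Sum>q1<m1 (fst y1). (1 / (p i (fst x) - fst y1) ^ Suc q1) *\<^sub>C
            op_pow (X1 - scalar_op (fst y1)) q1 (E1 (snd y1) (Y (o2.rsum (r i (snd x)) P2 v)))) =
           (\<Sum>q1<m1 (fst y1). \<Sum>y2\<in>P2. \<Sum>q2<m2 (fst y2). c i x y1 y2 q1 q2 *\<^sub>C W y1 y2 q1 q2 v)"
          by (simp add: blinfun.sum_right scaleC.sum_right lin1[OF A] scaleC_scaleC c_def W_def del: power_Suc)
        then show ?thesis
          by (simp only: sum.swap[where B = P2])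
      qed
      then show ?thesis
        by (simp add: o1.rsum_def resolvent_jet_def case_prod_unfold blinfun.sum_left scalar_op_apply scaleC.sum_right
            del: power_Suc)
    qed
    show "(\<Sum>y1\<in>P1. \<Sum>y2\<in>P2. \<Sum>q1<m1 (fst y1). \<Sum>q2<m2 (fst y2).
        scalar_op (\<Sum>i\<in>I. c i x y1 y2 q1 q2) o\<^sub>L W y1 y2 q1 q2) v =
      cauchy_integrand (\<lambda>z. o1.rsum z P1) Y (\<lambda>w. o2.rsum w P2) x v"
      by (simp add: blinfun.sum_left scalar_op_apply scaleC.sum_left 1 2 cauchy_integrand_def)
  qed
  ultimately show ?thesis
    unfolding cauchy_op_def by (simp add: integral_unique)
qed

text \<open>Between two level sets the Riemann sums converge in norm to the compressed Cauchy
  operator, because \<open>rsum\<close> converges uniformly on the cycles there. They also converge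
  strongly to the compression of \<open>T\<close>, and strong limits are unique.\<close>

lemma level_blocks_agree:
  assumes T: "has_gdoi X1 E1 m1 X2 E2 m2 \<beta> Y T"
    and C1: "C1 \<in> borel_subsets (spectrum X1)" "\<And>z. z \<in> C1 \<Longrightarrow> m1 z = j" "j \<ge> 1"
    and C2: "C2 \<in> borel_subsets (spectrum X2)" "\<And>z. z \<in> C2 \<Longrightarrow> m2 z = k" "k \<ge> 1"
  shows "E1 C1 (T (E2 C2 v)) = E1 C1 (cauchy_op (resolvent X1) Y (resolvent X2) (E2 C2 v))"
proof -
  let ?G = "cauchy_op (resolvent X1) Y (resolvent X2)"
  let ?F = "refinement_filter (spectrum X1) \<times>\<^sub>F refinement_filter (spectrum X2)"
  let ?s = "gdoi_sum X1 E1 m1 X2 E2 m2 \<beta> Y"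
  have nb: "?F \<noteq> bot"
    by (simp add: prod_filter_eq_bot refinement_filter_neq_bot)
  have cont': "continuous_on Z1 (\<lambda>z. E1 C1 o\<^sub>L resolvent X1 z)" "continuous_on Z2 (\<lambda>z. resolvent X2 z o\<^sub>L E2 C2)"
    by (intro blinfun_comp.continuous_on continuous_on_const cont_resolvents)+
  have bdd: "\<exists>K\<ge>0. \<forall>z\<in>Z. norm (f z) \<le> K" if "compact Z" "continuous_on Z f" for Z and f :: "complex \<Rightarrow> 'a \<Rightarrow>\<^sub>L 'a"
    using compact_imp_bounded[OF compact_continuous_image[OF that(2,1)]] unfolding bounded_pos
    by (meson image_eqI less_imp_le)
  obtain K1 K2 where K: "K1 \<ge> 0" "\<And>z. z \<in> Z1 \<Longrightarrow> norm (E1 C1 o\<^sub>L resolvent X1 z) \<le> K1"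
    "K2 \<ge> 0" "\<And>z. z \<in> Z2 \<Longrightarrow> norm (resolvent X2 z o\<^sub>L E2 C2) \<le> K2"
    using bdd[OF compact_Z(1) cont'(1)] bdd[OF compact_Z(2) cont'(2)] by metis
  define K where "K = max K1 K2"
  have K': "K \<ge> 0" "\<And>z. z \<in> Z1 \<Longrightarrow> norm (E1 C1 o\<^sub>L resolvent X1 z) \<le> K"
    "\<And>z. z \<in> Z2 \<Longrightarrow> norm (resolvent X2 z o\<^sub>L E2 C2) \<le> K"
    using K unfolding K_def by (auto intro: max.coboundedI1 max.coboundedI2)
  have "((\<lambda>(P1, P2). E1 C1 o\<^sub>L ?s P1 P2 o\<^sub>L E2 C2) \<longlongrightarrow> E1 C1 o\<^sub>L ?G o\<^sub>L E2 C2) ?F"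
  proof (rule tendstoI)
    fix e :: real assume e: "e > 0"
    \<comment> \<open>The summand \<open>1\<close> keeps \<open>b\<close> positive even for
      \<open>Y = 0\<close>, so that \<open>d\<close> can be defined by division.\<close>
    define b where "b = g_bound * (norm Y * (2 * K + 1)) + 1"
    have b: "b > 0" using g_bound(1) K'(1) by (simp add: b_def add_nonneg_pos)
    define d where "d = min 1 (e / (2 * b))"
    have d: "0 < d" "d \<le> 1" "d * b < e"
    proof -
      show "0 < d" "d \<le> 1" using e b by (auto simp: d_def)
      have "d * b \<le> e / (2 * b) * b" using b by (intro mult_right_mono) (auto simp: d_def)
      also have "\<dots> < e" using b e by simp
      finally show "d * b < e" .
    qed
    have ev1: "\<forall>\<^sub>F P in refinement_filter (spectrum X1). tagged_partition (spectrum X1) P \<and>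
        (\<forall>z\<in>Z1. norm ((E1 C1 o\<^sub>L o1.rsum z P) - (E1 C1 o\<^sub>L resolvent X1 z)) \<le> d)"
      by (rule o1.rsum_uniform_limit[OF compact_Z(1) Z_S(1) C1 d(1)])
    have ev2: "\<forall>\<^sub>F P in refinement_filter (spectrum X2). tagged_partition (spectrum X2) P \<and>
        (\<forall>z\<in>Z2. norm ((E2 C2 o\<^sub>L o2.rsum z P) - (E2 C2 o\<^sub>L resolvent X2 z)) \<le> d)"
      by (rule o2.rsum_uniform_limit[OF compact_Z(2) Z_S(2) C2 d(1)])
    show "\<forall>\<^sub>F P in ?F. dist (case P of (P1, P2) \<Rightarrow> E1 C1 o\<^sub>L ?s P1 P2 o\<^sub>L E2 C2) (E1 C1 o\<^sub>L ?G o\<^sub>L E2 C2) < e"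
      using eventually_prodI[OF ev1 ev2]
    proof eventually_elim
      case (elim P)
      obtain P1 P2 where P: "P = (P1, P2)" by fastforce
      have P12: "tagged_partition (spectrum X1) P1" "tagged_partition (spectrum X2) P2"
        using elim P by auto
      have cont: "continuous_on Z1 (\<lambda>z. o1.rsum z P1)" "continuous_on Z2 (\<lambda>z. o2.rsum z P2)"
        using o1.continuous_on_rsum[OF P12(1) Z_S(1)] o2.continuous_on_rsum[OF P12(2) Z_S(2)] by auto
      have 1: "E1 C1 o\<^sub>L ?s P1 P2 o\<^sub>L E2 C2 = cauchy_op (\<lambda>z. E1 C1 o\<^sub>L o1.rsum z P1) Y (\<lambda>w. o2.rsum w P2 o\<^sub>L E2 C2)"
        unfolding gdoi_sum_eq_cauchy_op[OF P12] by (rule comp_cauchy_op_comp[OF cont o1.E_linear[OF C1(1)]])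
      have 2: "E1 C1 o\<^sub>L ?G o\<^sub>L E2 C2 = cauchy_op (\<lambda>z. E1 C1 o\<^sub>L resolvent X1 z) Y (\<lambda>w. resolvent X2 w o\<^sub>L E2 C2)"
        by (rule comp_cauchy_op_comp[OF cont_resolvents o1.E_linear[OF C1(1)]])
      have "norm ((E1 C1 o\<^sub>L ?s P1 P2 o\<^sub>L E2 C2) - (E1 C1 o\<^sub>L ?G o\<^sub>L E2 C2)) \<le> g_bound * (d * norm Y * (2 * K + 1))"
        unfolding 1 2
      proof (rule cauchy_op_diff_le[OF _ cont'(1) _ cont'(2)])
        \<comment> \<open>The approximation is known with the projection on the left. Here it stands
          on the right, so it is first commuted past the Riemann sum and the resolvent.\<close>
        show "norm ((o2.rsum z P2 o\<^sub>L E2 C2) - (resolvent X2 z o\<^sub>L E2 C2)) \<le> d" if "z \<in> Z2" for z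
        proof -
          have "z \<notin> spectrum X2" using that Z_S(2) by blast
          then show ?thesis
            using elim that unfolding P o2.rsum_E_commute[OF P12(2) C2(1)] by (simp add: o2.resolvent_E_commute[OF C2(1)])
        qed
      qed (use elim P K' d cont in \<open>auto intro!: blinfun_comp.continuous_on continuous_on_const\<close>)
      also have "\<dots> \<le> d * b"
        using d(1) by (simp add: b_def algebra_simps)
      also have "\<dots> < e" by (rule d(3))
      finally show ?case by (simp add: P dist_norm)
    qed
  qed
  then have "((\<lambda>P. (case P of (P1, P2) \<Rightarrow> E1 C1 o\<^sub>L ?s P1 P2 o\<^sub>L E2 C2) v) \<longlongrightarrow> (E1 C1 o\<^sub>L ?G o\<^sub>L E2 C2) v) ?F"
    by (rule blinfun.tendsto[OF _ tendsto_const])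
  then have lim1: "((\<lambda>(P1, P2). E1 C1 (?s P1 P2 (E2 C2 v))) \<longlongrightarrow> E1 C1 (?G (E2 C2 v))) ?F"
    by (simp add: case_prod_unfold)
  have "((\<lambda>(P1, P2). ?s P1 P2 (E2 C2 v)) \<longlongrightarrow> T (E2 C2 v)) ?F"
    using T by (simp add: has_gdoi_def)
  then have lim2: "((\<lambda>P. E1 C1 (case P of (P1, P2) \<Rightarrow> ?s P1 P2 (E2 C2 v))) \<longlongrightarrow> E1 C1 (T (E2 C2 v))) ?F"
    by (rule blinfun.tendsto[OF tendsto_const])
  show ?thesis
    by (rule tendsto_unique[OF nb lim2]) (use lim1 in \<open>simp add: case_prod_unfold\<close>)
qed

text \<open>The difference \<open>D\<close> vanishes between any two level sets. Summing strongly,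
  over the levels of \<open>m2\<close> on the right and then over those of \<open>m1\<close> on the
  left, gives \<open>D = 0\<close>; no uniformity across levels enters, so the orders may be
  unbounded.\<close>

lemma has_gdoi_imp_eq_cauchy_op:
  assumes T: "has_gdoi X1 E1 m1 X2 E2 m2 \<beta> Y T"
  shows "T = cauchy_op (resolvent X1) Y (resolvent X2)"
proof (rule blinfun_eqI)
  fix v
  define D where "D = T - cauchy_op (resolvent X1) Y (resolvent X2)"
  define C1 where "C1 j = {z \<in> spectrum X1. m1 z = j}" for j
  define C2 where "C2 k = {z \<in> spectrum X2. m2 z = k}" for k
  have C: "C1 j \<in> borel_subsets (spectrum X1)" "C2 j \<in> borel_subsets (spectrum X2)" for j
    unfolding C1_def C2_def by (rule o1.level_set_borel o2.level_set_borel)+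
  \<comment> \<open>The series run over all naturals, but the orders are at least \<open>1\<close>:
    level zero is empty and its projection vanishes.\<close>
  have zero: "E1 (C1 0) = 0" "E2 (C2 0) = 0"
    by (simp_all add: C1_def C2_def o1.level_set_0 o2.level_set_0 o1.E_empty o2.E_empty)
  have block: "E1 (C1 j) (D (E2 (C2 k) w)) = 0" for j k w
  proof (cases "j = 0 \<or> k = 0")
    case True
    then show ?thesis by (auto simp: zero)
  next
    case False
    then have "E1 (C1 j) (T (E2 (C2 k) w)) = E1 (C1 j) (cauchy_op (resolvent X1) Y (resolvent X2) (E2 (C2 k) w))"
      by (intro level_blocks_agree[OF T C(1) _ _ C(2)]) (auto simp: C1_def C2_def)
    then show ?thesis by (simp add: D_def blinfun.bilinear_simps)
  qed
  have sums1: "(\<lambda>j. E1 (C1 j) w) sums w" for w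
  proof -
    have "disjoint_family C1" "(\<Union>j. C1 j) = spectrum X1"
      by (auto simp: C1_def disjoint_family_on_def)
    then show ?thesis using o1.E_sums[of C1 w] C(1) o1.E_S by simp
  qed
  have sums2: "(\<lambda>k. E2 (C2 k) w) sums w" for w
  proof -
    have "disjoint_family C2" "(\<Union>j. C2 j) = spectrum X2"
      by (auto simp: C2_def disjoint_family_on_def)
    then show ?thesis using o2.E_sums[of C2 w] C(2) o2.E_S by simp
  qed
  have row: "E1 (C1 j) (D w) = 0" for j w
  proof -
    have "(\<lambda>k. (E1 (C1 j) o\<^sub>L D) (E2 (C2 k) w)) sums (E1 (C1 j) o\<^sub>L D) w"
      by (rule bounded_linear.sums[OF blinfun.bounded_linear_right sums2])
    then show ?thesis by (simp add: block sums_iff)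
  qed
  have "D v = 0"
    using sums1[of "D v"] by (simp add: row sums_iff)
  then show "T v = cauchy_op (resolvent X1) Y (resolvent X2) v"
    by (simp add: D_def blinfun.diff_left)
qed

end

section \<open>Continuity\<close>

text \<open>Three layers around \<open>K\<close>: an open set on which Cauchy's formula is to hold,
  a compact set for the cycle to surround, and an open set in which the cycle must stay. Adding a
  closed ball of radius \<open>e / 2\<close> to \<open>K\<close> preserves compactness.\<close>

lemma compact_nested_nbhds:
  fixes K :: "'a::euclidean_space set"
  assumes "compact K" "e > 0"
  shows "\<exists>V K' U. open V \<and> compact K' \<and> open U \<and> K \<subseteq> V \<and> V \<subseteq> K' \<and> K' \<subseteq> U \<and> (\<forall>u\<in>U. \<exists>x\<in>K. dist x u < e)"
proof -
  define V where "V = (\<Union>x\<in>K. ball x (e / 2))"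
  define K' where "K' = {x + y |x y. x \<in> K \<and> y \<in> cball 0 (e / 2)}"
  define U where "U = (\<Union>x\<in>K. ball x e)"
  have "open V" "open U" by (auto simp: V_def U_def)
  moreover have "compact K'"
    unfolding K'_def using assms(1) by (intro compact_sums) auto
  moreover have "K \<subseteq> V" using assms(2) by (auto simp: V_def)
  moreover have "V \<subseteq> K'"
  proof
    fix z assume "z \<in> V"
    then obtain x where "x \<in> K" "dist x z < e / 2" by (auto simp: V_def)
    then have "z = x + (z - x)" "x \<in> K" "z - x \<in> cball 0 (e / 2)"
      by (auto simp: dist_norm norm_minus_commute)
    then show "z \<in> K'" unfolding K'_def by blast
  qed
  moreover have "K' \<subseteq> U"
  proof
    fix z assume "z \<in> K'"
    then obtain x y where "z = x + y" "x \<in> K" "norm y \<le> e / 2" by (auto simp: K'_def)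
    then have "x \<in> K" "dist x z < e" using assms(2) by (auto simp: dist_norm)
    then show "z \<in> U" by (auto simp: U_def)
  qed
  moreover have "\<forall>u\<in>U. \<exists>x\<in>K. dist x u < e" by (auto simp: U_def)
  ultimately show ?thesis by blast
qed

lemma holomorphic2_on_sections:
  assumes \<beta>: "holomorphic2_on \<beta> D" and D: "open D" and U: "U1 \<times> U2 \<subseteq> D"
  shows "continuous_on (U1 \<times> U2) \<beta>"
    and "w \<in> U2 \<Longrightarrow> (\<lambda>z. \<beta> (z, w)) holomorphic_on U1"
    and "z \<in> U1 \<Longrightarrow> (\<lambda>w. \<beta> (z, w)) holomorphic_on U2"
proof -
  have d: "\<exists>a b. (\<beta> has_derivative (\<lambda>(h, k). a * h + b * k)) (at x)" if "x \<in> U1 \<times> U2" for x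
  proof -
    have "x \<in> D" using U that by blast
    from bspec[OF \<beta>[unfolded holomorphic2_on_def] this] show ?thesis
      unfolding at_within_open[OF \<open>x \<in> D\<close> D] .
  qed
  show "continuous_on (U1 \<times> U2) \<beta>"
  proof (intro continuous_at_imp_continuous_on ballI)
    fix x assume "x \<in> U1 \<times> U2"
    from d[OF this] show "continuous (at x) \<beta>"
      by (elim exE) (rule has_derivative_continuous)
  qed
  show "(\<lambda>z. \<beta> (z, w)) holomorphic_on U1" if w: "w \<in> U2"
    unfolding holomorphic_on_def
  proof
    fix z assume "z \<in> U1"
    then obtain a b where ab: "(\<beta> has_derivative (\<lambda>(h, k). a * h + b * k)) (at (z, w))"
      using d w by blast
    have "((\<lambda>z. (z, w)) has_derivative (\<lambda>h. (h, 0))) (at z)"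
      by (auto intro!: derivative_eq_intros)
    from has_derivative_compose[OF this ab] have "((\<lambda>z. \<beta> (z, w)) has_field_derivative a) (at z)"
      by (simp add: has_field_derivative_def)
    then show "(\<lambda>z. \<beta> (z, w)) field_differentiable at z within U1"
      using field_differentiable_def field_differentiable_at_within by blast
  qed
  show "(\<lambda>w. \<beta> (z, w)) holomorphic_on U2" if z: "z \<in> U1"
    unfolding holomorphic_on_def
  proof
    fix w assume "w \<in> U2"
    then obtain a b where ab: "(\<beta> has_derivative (\<lambda>(h, k). a * h + b * k)) (at (z, w))"
      using d z by blast
    have "((\<lambda>w. (z, w)) has_derivative (\<lambda>h. (0, h))) (at w)"
      by (auto intro!: derivative_eq_intros)
    from has_derivative_compose[OF this ab] have "((\<lambda>w. \<beta> (z, w)) has_field_derivative b) (at w)"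
      by (simp add: has_field_derivative_def)
    then show "(\<lambda>w. \<beta> (z, w)) field_differentiable at w within U2"
      using field_differentiable_def field_differentiable_at_within by blast
  qed
qed

text \<open>\<open>D\<close> need not be a product. As \<open>K1 \<times> K2\<close> is compact, a
  product of neighbourhoods of radius \<open>e / 2\<close> in each factor still fits into
  it.\<close>

lemma cauchy_kernel_on_nbhds:
  assumes K: "compact K1" "compact K2" and D: "open D" "K1 \<times> K2 \<subseteq> D" and \<beta>: "holomorphic2_on \<beta> D"
  shows "\<exists>(I :: (nat \<times> nat) set) p r g V1 V2. open V1 \<and> open V2 \<and> K1 \<subseteq> V1 \<and> K2 \<subseteq> V2 \<and>
    cauchy_kernel I p r g V1 V2 \<beta>"
proof -
  obtain e where e: "e > 0" "(\<Union>x\<in>K1 \<times> K2. ball x e) \<subseteq> D"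
    using compact_subset_open_imp_ball_epsilon_subset[OF compact_Times[OF K] D] by blast
  obtain V1 K1' U1 where 1: "open V1" "compact K1'" "open U1" "K1 \<subseteq> V1" "V1 \<subseteq> K1'" "K1' \<subseteq> U1"
    "\<And>u. u \<in> U1 \<Longrightarrow> \<exists>x\<in>K1. dist x u < e / 2"
    using compact_nested_nbhds[OF K(1), of "e / 2"] e(1) by auto
  obtain V2 K2' U2 where 2: "open V2" "compact K2'" "open U2" "K2 \<subseteq> V2" "V2 \<subseteq> K2'" "K2' \<subseteq> U2"
    "\<And>u. u \<in> U2 \<Longrightarrow> \<exists>x\<in>K2. dist x u < e / 2"
    using compact_nested_nbhds[OF K(2), of "e / 2"] e(1) by auto
  have U: "U1 \<times> U2 \<subseteq> D"
  proof clarify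
    fix u w assume "u \<in> U1" "w \<in> U2"
    then obtain x y where xy: "x \<in> K1" "dist x u < e / 2" "y \<in> K2" "dist y w < e / 2"
      using 1(7) 2(7) by blast
    have "dist (x, y) (u, w) \<le> dist x u + dist y w"
      unfolding dist_prod_def by (simp add: sqrt_sum_squares_le_sum)
    then have "(u, w) \<in> ball (x, y) e"
      using xy by simp
    then show "(u, w) \<in> D" using e(2) xy by blast
  qed
  have "\<exists>(I :: (nat \<times> nat) set) p r g. cauchy_kernel I p r g V1 V2 \<beta>"
    by (rule cauchy_kernel_exists[OF 1(2) 2(2) 1(1) 2(1) 1(5) 2(5) 1(3) 2(3) 1(6) 2(6)
          holomorphic2_on_sections[OF \<beta> D(1) U]])
  then show ?thesis using 1(1,4) 2(1,4) by blast
qed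

text \<open>On the compact set \<open>K - V\<close>, which misses the spectrum of \<open>X\<close>,
  the resolvents of \<open>Xs l\<close> eventually exist; outside \<open>K\<close> there is no
  spectrum at all.\<close>

lemma eventually_spectrum_subset:
  assumes "Xs \<longlonglongrightarrow> X" "open V" "spectrum X \<subseteq> V" "compact K" "\<And>l. spectrum (Xs l) \<subseteq> K"
  shows "\<forall>\<^sub>F l in sequentially. spectrum (Xs l) \<subseteq> V"
proof -
  have "compact (K - V)" "(K - V) \<inter> spectrum X = {}"
    using assms(2-4) compact_diff by auto
  from resolvent_uniform_limit(1)[OF assms(1) this] show ?thesis
    by eventually_elim (use assms(5) in blast)
qed

theorem theorem10:
  fixes X1 X2 Y :: "'a::complex_hilbert \<Rightarrow>\<^sub>L 'a"
    and X1s X2s :: "nat \<Rightarrow> 'a \<Rightarrow>\<^sub>L 'a"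
    and E1 E2 :: "complex set \<Rightarrow> 'a \<Rightarrow>\<^sub>L 'a"
    and E1s E2s :: "nat \<Rightarrow> complex set \<Rightarrow> 'a \<Rightarrow>\<^sub>L 'a"
    and m1 m2 :: "complex \<Rightarrow> nat"
    and m1s m2s :: "nat \<Rightarrow> complex \<Rightarrow> nat"
    and K S1 S2 :: "complex set"
    and D :: "(complex \<times> complex) set"
    and \<beta> :: "complex \<times> complex \<Rightarrow> complex"
  assumes "spectral_decomposition X1 E1 m1"
    and "spectral_decomposition X2 E2 m2"
    and "\<And>l. spectral_decomposition (X1s l) (E1s l) (m1s l)"
    and "\<And>l. spectral_decomposition (X2s l) (E2s l) (m2s l)"
    and "X1s \<longlonglongrightarrow> X1"
    and "X2s \<longlonglongrightarrow> X2"
    and "S1 = spectrum X1 \<union> (\<Union>l. spectrum (X1s l))"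
    and "S2 = spectrum X2 \<union> (\<Union>l. spectrum (X2s l))"
    and "bounded K" and "compact K" and "polynomially_convex K"
    and "S1 \<subseteq> K" and "S2 \<subseteq> K"
    and "open D" and "S1 \<times> S2 \<subseteq> D"
    and "holomorphic2_on \<beta> D"
    and "\<And>\<theta>1 \<theta>2. bounded (partial_deriv \<theta>1 \<theta>2 \<beta> ` (S1 \<times> S2))"
    and "complex_linear Y"
    and "gdoi_exists X1 E1 m1 X2 E2 m2 \<beta> Y"
    and "\<And>l1 l2. gdoi_exists (X1s l1) (E1s l1) (m1s l1) (X2s l2) (E2s l2) (m2s l2) \<beta> Y"
  shows "((\<lambda>(l1, l2). norm (gdoi (X1s l1) (E1s l1) (m1s l1) (X2s l2) (E2s l2) (m2s l2) \<beta> Y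
                             - gdoi X1 E1 m1 X2 E2 m2 \<beta> Y)) \<longlongrightarrow> 0)
           (sequentially \<times>\<^sub>F sequentially)"
proof -
  have S1: "spectrum X1 \<subseteq> S1" "\<And>l. spectrum (X1s l) \<subseteq> S1" and S2: "spectrum X2 \<subseteq> S2" "\<And>l. spectrum (X2s l) \<subseteq> S2"
    using assms(7,8) by auto
  have bdd: "bounded (spectrum X1)" "bounded (spectrum X2)" "\<And>l. bounded (spectrum (X1s l))" "\<And>l. bounded (spectrum (X2s l))"
    using S1 S2 assms(9,12,13) by (meson bounded_subset order_trans)+
  have op: "spectral_op X1 E1 m1" "spectral_op X2 E2 m2"
    "\<And>l. spectral_op (X1s l) (E1s l) (m1s l)" "\<And>l. spectral_op (X2s l) (E2s l) (m2s l)"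
    using assms(1-4) bdd by (auto intro: spectral_op.intro)
  have comp: "compact (spectrum X1)" "compact (spectrum X2)"
    using bdd closed_spectrum by (auto simp: compact_eq_bounded_closed)
  have "spectrum X1 \<times> spectrum X2 \<subseteq> D"
    using S1(1) S2(1) assms(15) by blast
  \<comment> \<open>The kernel is built around the spectra of the limits alone, so it is fixed
    before the sequences enter.\<close>
  then obtain I :: "(nat \<times> nat) set" and p r g V1 V2
    where V: "open V1" "open V2" "spectrum X1 \<subseteq> V1" "spectrum X2 \<subseteq> V2"
      and ker: "cauchy_kernel I p r g V1 V2 \<beta>"
    using cauchy_kernel_on_nbhds[OF comp assms(14) _ assms(16)] by blast
  interpret kernel I p r g V1 V2 \<beta>
    by unfold_locales (rule ker)
  \<comment> \<open>Stated for arbitrary pairs of operators, so that the limits and the members of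
    the sequences are represented along the same cycles.\<close>
  have repr: "gdoi A1 F1 n1 A2 F2 n2 \<beta> Y = cauchy_op (resolvent A1) Y (resolvent A2)"
    if "spectral_op A1 F1 n1" "spectral_op A2 F2 n2" "spectrum A1 \<subseteq> V1" "spectrum A2 \<subseteq> V2"
      "gdoi_exists A1 F1 n1 A2 F2 n2 \<beta> Y" for A1 F1 n1 A2 F2 n2
  proof -
    interpret o1: spectral_op A1 F1 n1 by (rule that(1))
    interpret o2: spectral_op A2 F2 n2 by (rule that(2))
    interpret gdoi_kernel I p r g V1 V2 \<beta> A1 F1 n1 A2 F2 n2 Y
      by unfold_locales (use that assms(18) in auto)
    show ?thesis
      using that(5) gdoi_unique has_gdoi_imp_eq_cauchy_op unfolding gdoi_exists_def by blast
  qed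
  have Z: "Z1 \<inter> spectrum X1 = {}" "Z2 \<inter> spectrum X2 = {}"
    using V(3,4) Z1_V1 Z2_V2 by blast+
  have cont: "continuous_on Z1 (resolvent A)" if "spectrum A \<subseteq> V1" for A :: "'a \<Rightarrow>\<^sub>L 'a"
    by (rule continuous_on_subset[OF continuous_on_resolvent]) (use that Z1_V1 in blast)
  have cont': "continuous_on Z2 (resolvent A)" if "spectrum A \<subseteq> V2" for A :: "'a \<Rightarrow>\<^sub>L 'a"
    by (rule continuous_on_subset[OF continuous_on_resolvent]) (use that Z2_V2 in blast)
  obtain K1 K2 where K12: "K1 > 0" "\<And>z. z \<in> Z1 \<Longrightarrow> norm (resolvent X1 z) \<le> K1"
    "K2 > 0" "\<And>z. z \<in> Z2 \<Longrightarrow> norm (resolvent X2 z) \<le> K2"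
    using resolvent_bounded_on_compact[OF compact_Z(1) Z(1)] resolvent_bounded_on_compact[OF compact_Z(2) Z(2)]
    by metis
  define C where "C = max K1 K2"
  have C: "C \<ge> 0" "\<And>z. z \<in> Z1 \<Longrightarrow> norm (resolvent X1 z) \<le> C" "\<And>z. z \<in> Z2 \<Longrightarrow> norm (resolvent X2 z) \<le> C"
    using K12 unfolding C_def by (auto intro: max.coboundedI1 max.coboundedI2)
  define b where "b = g_bound * (norm Y * (2 * C + 1)) + 1"
  have b: "b > 0" using g_bound(1) C(1) by (simp add: b_def add_nonneg_pos)
  let ?G = "gdoi X1 E1 m1 X2 E2 m2 \<beta> Y"
  let ?Gs = "\<lambda>l1 l2. gdoi (X1s l1) (E1s l1) (m1s l1) (X2s l2) (E2s l2) (m2s l2) \<beta> Y"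
  show ?thesis
  proof (rule tendstoI)
    fix e :: real assume e: "e > 0"
    define d where "d = min 1 (e / (2 * b))"
    have d: "0 < d" "d \<le> 1" "d * b < e"
    proof -
      show "0 < d" "d \<le> 1" using e b by (auto simp: d_def)
      have "d * b \<le> e / (2 * b) * b" using b by (intro mult_right_mono) (auto simp: d_def)
      also have "\<dots> < e" using b e by simp
      finally show "d * b < e" .
    qed
    have "\<forall>\<^sub>F l in sequentially. spectrum (X1s l) \<subseteq> V1"
      by (rule eventually_spectrum_subset[OF assms(5) V(1,3) assms(10)]) (use S1(2) assms(12) in blast)
    moreover have "\<forall>\<^sub>F l in sequentially. \<forall>z\<in>Z1. dist (resolvent (X1s l) z) (resolvent X1 z) < d"
      by (rule uniform_limitD[OF resolvent_uniform_limit(2)[OF assms(5) compact_Z(1) Z(1)] d(1)])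
    ultimately have ev1: "\<forall>\<^sub>F l in sequentially. spectrum (X1s l) \<subseteq> V1 \<and>
        (\<forall>z\<in>Z1. dist (resolvent (X1s l) z) (resolvent X1 z) < d)"
      by (rule eventually_conj)
    have "\<forall>\<^sub>F l in sequentially. spectrum (X2s l) \<subseteq> V2"
      by (rule eventually_spectrum_subset[OF assms(6) V(2,4) assms(10)]) (use S2(2) assms(13) in blast)
    moreover have "\<forall>\<^sub>F l in sequentially. \<forall>z\<in>Z2. dist (resolvent (X2s l) z) (resolvent X2 z) < d"
      by (rule uniform_limitD[OF resolvent_uniform_limit(2)[OF assms(6) compact_Z(2) Z(2)] d(1)])
    ultimately have ev2: "\<forall>\<^sub>F l in sequentially. spectrum (X2s l) \<subseteq> V2 \<and>
        (\<forall>z\<in>Z2. dist (resolvent (X2s l) z) (resolvent X2 z) < d)"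
      by (rule eventually_conj)
    \<comment> \<open>The closeness conditions concern \<open>l1\<close> and \<open>l2\<close>
      separately, as the joint limit over the product filter requires.\<close>
    show "\<forall>\<^sub>F l in sequentially \<times>\<^sub>F sequentially.
        dist (case l of (l1, l2) \<Rightarrow> norm (?Gs l1 l2 - ?G)) 0 < e"
      using eventually_prodI[OF ev1 ev2]
    proof eventually_elim
      case (elim l)
      obtain l1 l2 where l: "l = (l1, l2)" by fastforce
      have sub: "spectrum (X1s l1) \<subseteq> V1" "spectrum (X2s l2) \<subseteq> V2"
        using elim l by auto
      have "norm (?Gs l1 l2 - ?G) \<le> g_bound * (d * norm Y * (2 * C + 1))"
        unfolding repr[OF op(1,2) V(3,4) assms(19)] repr[OF op(3,4) sub assms(20)]
        by (rule cauchy_op_diff_le[OF cont[OF sub(1)] cont[OF V(3)] cont'[OF sub(2)] cont'[OF V(4)]])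
          (use elim l C d in \<open>auto simp: dist_norm intro: less_imp_le\<close>)
      also have "\<dots> \<le> d * b"
        using d(1) by (simp add: b_def algebra_simps)
      also have "\<dots> < e" by (rule d(3))
      finally show ?case by (simp add: l)
    qed
  qed
qed

end
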